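(* Let $q\in[0,n)$ and suppose $n+q>2$. For every positive integer $k<\frac{n+q}{2}$ and every real $s\in\left[1,\frac{2n-2k}{n-q}\right]$, there exists a non-negative convex function $v$ on $B_1(0)\subset\mathbb{R}^n$ solving $$\det D^2v=v^{q}\chi_{\{v>0\}}\quad\text{in }B_1(0)$$ in the Aleksandrov sense, such that $\{x\in B_1(0): v(x)=0\}=\mathbb{R}^k\cap B_1(0)$ and, for some positive constants $c$ and $C$, $$c\,\operatorname{dist}(x,\mathbb{R}^k)^{s}\le v(x)\le C\,\operatorname{dist}(x,\mathbb{R}^k)^{s}\quad\text{for all }x\in B_1(0).$$
   Context: $B_1(0)$ is the open unit ball of $\mathbb{R}^n$ centered at the origin. $\mathbb{R}^k$ is identified with a $k$-dimensional coordinate subspace of $\mathbb{R}^n$ (through the origin). $\chi_A$ is the characteristic function of a set $A$. The equation is understood in the Aleksandrov sense: the Monge-Ampère measure $A\mapsto|\partial v(A)|$ of the convex function $v$ equals $v^q\chi_{\{v>0\}}\,dx$. *)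

theory Defs
  imports "HOL-Analysis.Analysis"
begin

definition subdifferential :: "'a::euclidean_space set \<Rightarrow> ('a \<Rightarrow> real) \<Rightarrow> 'a \<Rightarrow> 'a set" where
  "subdifferential \<Omega> v x = {p. \<forall>y\<in>\<Omega>. v x + p \<bullet> (y - x) \<le> v y}"

definition gradient_image :: "'a::euclidean_space set \<Rightarrow> ('a \<Rightarrow> real) \<Rightarrow> 'a set \<Rightarrow> 'a set" where
  "gradient_image \<Omega> v A = (\<Union>x\<in>A. subdifferential \<Omega> v x)"

definition monge_ampere :: "'a::euclidean_space set \<Rightarrow> ('a \<Rightarrow> real) \<Rightarrow> 'a set \<Rightarrow> ennreal" where
  "monge_ampere \<Omega> v A = emeasure lebesgue (gradient_image \<Omega> v A)"

text \<open>The Monge--Ampere measure of \<open>v\<close> equals \<open>f dx\<close> as a Borel measure on \<open>\<Omega>\<close>.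
  Gradient images of Borel sets need not be Borel, hence \<^const>\<open>lebesgue\<close> above. Their Lebesgue
  measurability, automatic for convex \<open>v\<close> on open \<open>\<Omega>\<close>, is demanded explicitly because
  \<^const>\<open>emeasure\<close> is 0 on non-measurable sets.\<close>

definition aleksandrov_solution ::
    "'a::euclidean_space set \<Rightarrow> ('a \<Rightarrow> real) \<Rightarrow> ('a \<Rightarrow> ennreal) \<Rightarrow> bool" where
  "aleksandrov_solution \<Omega> v f \<longleftrightarrow>
     convex_on \<Omega> v \<and>
     (\<forall>A\<in>sets borel. A \<subseteq> \<Omega> \<longrightarrow>
        gradient_image \<Omega> v A \<in> sets lebesgue \<and>
        monge_ampere \<Omega> v A = (\<integral>\<^sup>+x\<in>A. f x \<partial>lborel))"

definition coord_subspace :: "'n set \<Rightarrow> (real ^ 'n::finite) set" where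
  "coord_subspace K = {x. \<forall>i. i \<notin> K \<longrightarrow> x $ i = 0}"

end

theory Submission
  imports Defs
begin

text \<open>
  Write \<open>n = k + m\<close>, \<open>x = (x', x'')\<close> with \<open>x'\<close> in the \<open>k\<close>-dimensional subspace, \<open>t = |x'|^2/2\<close>,
  \<open>w = |x''|^2/2\<close> and \<open>\<sigma> = s/2\<close>. The solution is sought in the form \<open>v = A w^\<sigma> \<phi> (w^\<delta> Y(t))\<close>. For
  \<open>s > 1\<close> one takes \<open>Y\<close> linear and \<open>\<delta> = (m - \<sigma>(n - q))/k\<close>, which is non-negative exactly when
  \<open>s \<le> (2n - 2k)/(n - q)\<close>: then \<open>v\<close> is invariant under a one-parameter group of dilations that preserves
  the equation, so that only an ODE for \<open>\<phi>\<close> is left. For \<open>s = 1\<close> the invariant ansatz is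
  not convex, but a partial Legendre transform in \<open>|x''|\<close> separates the variables; in the original variables
  this means that with \<open>\<delta> = (q + m - k)/(2(k + 1))\<close> the equation decouples into one ODE for \<open>Y\<close> and one for
  \<open>\<phi>\<close>. All these ODEs are singular at the origin, of Briot--Bouquet type
  \<open>M + (t/\<alpha>) M' = h(t, \<phi>, M)\<close>, \<open>\<phi>' = M powr (1/N)\<close>, and are solved by a contraction for the
  averaging operator that inverts the left-hand side.

  Off \<open>x'' = 0\<close> the function \<open>v\<close> is twice differentiable with positive definite Hessian, so its gradient is
  injective and the change of variables formula gives the Monge--Ampere measure. At a point with \<open>x'' = 0\<close>
  every subgradient has vanishing \<open>x'\<close>-part, so that these points contribute a null set.
\<close>

subsection \<open>Continuously differentiable functions\<close>

text \<open>In the variables t and w the Hessian of G has the eigenvalue G_t on k - 1 directions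
  tangent to spheres in x', the eigenvalue G_w on m - 1 directions in x'', and a 2 x 2 block on the
  two radial directions. For a profile \<phi>(w^\<delta> Y(t)) both products in the determinant of
  that block contain (\<phi>'')^2, and these terms cancel; the rest is linear in \<phi>'' and can be
  solved for it. With Y linear, the coefficient at the origin is a positive multiple of s - 1, which
  is why s = 1 needs its own ansatz. The condition k < (n + q)/2 says exactly that (2n - 2k)/(n - q)
  exceeds 1 and, in the case s = 1, that \<delta> > 0. Points with x' = 0 are interior to the ball,
  so the profiles must be twice differentiable at the singular point t = 0 from both sides; hence
  the symmetric intervals in the contraction. The ODEs are solved on a small interval only, while
  the ball is fixed: rescaling the arguments makes the ball fit, and the amplitude A, available
  because q < n, restores the equation.\<close>

definition C1_on :: "('a::real_normed_vector \<Rightarrow> real) \<Rightarrow> 'a set \<Rightarrow> bool" where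
  "C1_on f U \<longleftrightarrow> (\<exists>f'. continuous_on U f' \<and> (\<forall>x\<in>U. (f has_derivative blinfun_apply (f' x)) (at x)))"

lemma C1_on_imp_continuous_on: "C1_on f U \<Longrightarrow> continuous_on U f"
  unfolding C1_on_def
  by (meson continuous_at_imp_continuous_on has_derivative_continuous)

lemma C1_on_const: "C1_on (\<lambda>x. c) U"
  unfolding C1_on_def by (rule exI[of _ "\<lambda>x. 0"]) (auto simp: zero_blinfun.rep_eq)

lemma C1_on_bounded_linear:
  assumes "bounded_linear f"
  shows "C1_on f U"
  unfolding C1_on_def
  by (rule exI[of _ "\<lambda>x. Blinfun f"])
     (auto simp: bounded_linear_Blinfun_apply[OF assms] intro: bounded_linear_imp_has_derivative assms)

lemma C1_on_add:
  assumes "C1_on f U" "C1_on g U"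
  shows "C1_on (\<lambda>x. f x + g x) U"
proof -
  obtain f' g' where "continuous_on U f'" "continuous_on U g'"
    and "\<And>x. x \<in> U \<Longrightarrow> (f has_derivative blinfun_apply (f' x)) (at x)"
    and "\<And>x. x \<in> U \<Longrightarrow> (g has_derivative blinfun_apply (g' x)) (at x)"
    using assms unfolding C1_on_def by auto
  then show ?thesis unfolding C1_on_def
    by (intro exI[of _ "\<lambda>x. f' x + g' x"])
       (auto intro!: continuous_intros derivative_eq_intros simp: blinfun.bilinear_simps)
qed

lemma C1_on_mult:
  assumes "C1_on f U" "C1_on g U"
  shows "C1_on (\<lambda>x. f x * g x) U"
proof -
  obtain f' g' where "continuous_on U f'" "continuous_on U g'"
    and "\<And>x. x \<in> U \<Longrightarrow> (f has_derivative blinfun_apply (f' x)) (at x)"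
    and "\<And>x. x \<in> U \<Longrightarrow> (g has_derivative blinfun_apply (g' x)) (at x)"
    using assms unfolding C1_on_def by auto
  then show ?thesis unfolding C1_on_def
    by (intro exI[of _ "\<lambda>x. f x *\<^sub>R g' x + g x *\<^sub>R f' x"])
       (auto intro!: continuous_intros derivative_eq_intros C1_on_imp_continuous_on assms
         simp: blinfun.bilinear_simps)
qed

lemma C1_on_compose_real:
  assumes "C1_on f U" "\<And>x. x \<in> U \<Longrightarrow> f x \<in> V"
    and "\<And>y. y \<in> V \<Longrightarrow> (g has_real_derivative g' y) (at y)" "continuous_on V g'"
  shows "C1_on (\<lambda>x. g (f x)) U"
proof -
  obtain f' where f': "continuous_on U f'"
    "\<And>x. x \<in> U \<Longrightarrow> (f has_derivative blinfun_apply (f' x)) (at x)"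
    using assms(1) unfolding C1_on_def by auto
  show ?thesis unfolding C1_on_def
  proof (intro exI[of _ "\<lambda>x. g' (f x) *\<^sub>R f' x"] conjI ballI)
    show "continuous_on U (\<lambda>x. g' (f x) *\<^sub>R f' x)"
      using assms f' by (intro continuous_intros continuous_on_compose2[OF assms(4)]
          C1_on_imp_continuous_on) auto
    fix x assume x: "x \<in> U"
    have "(g has_derivative (\<lambda>h. g' (f x) * h)) (at (f x))"
      using assms(3)[OF assms(2)[OF x]] by (simp add: has_field_derivative_def)
    from has_derivative_compose[OF f'(2)[OF x] this]
    show "((\<lambda>x. g (f x)) has_derivative blinfun_apply (g' (f x) *\<^sub>R f' x)) (at x)"
      by (simp add: scaleR_blinfun.rep_eq)
  qed
qed

lemma C1_on_powr:
  assumes "C1_on f U" "\<And>x. x \<in> U \<Longrightarrow> f x > 0"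
  shows "C1_on (\<lambda>x. f x powr a) U"
proof (rule C1_on_compose_real[where V = "{0<..}" and g = "\<lambda>y. y powr a" and g' = "\<lambda>y. a * y powr (a - 1)"])
  show "((\<lambda>y. y powr a) has_real_derivative a * y powr (a - 1)) (at y)" if "y \<in> {0<..}" for y
    using that has_real_derivative_powr by auto
  show "continuous_on {0<..} (\<lambda>y. a * y powr (a - 1))"
    by (intro continuous_intros) auto
qed (use assms in auto)

lemma C1_on_inverse:
  assumes "C1_on f U" "\<And>x. x \<in> U \<Longrightarrow> f x > 0"
  shows "C1_on (\<lambda>x. inverse (f x)) U"
  by (rule C1_on_compose_real[where V = "{0<..}" and g = inverse and g' = "\<lambda>y. - (inverse y ^ Suc (Suc 0))"])
     (use assms in \<open>auto intro!: DERIV_inverse continuous_intros simp del: power_Suc\<close>)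

lemma C1_on_subset: "C1_on f U \<Longrightarrow> V \<subseteq> U \<Longrightarrow> C1_on f V"
  unfolding C1_on_def by (meson continuous_on_subset subsetD)

lemma C1_on_diff:
  assumes "C1_on f U" "C1_on g U"
  shows "C1_on (\<lambda>x. f x - g x) U"
  using C1_on_add[OF assms(1) C1_on_mult[OF C1_on_const[of "-1"] assms(2)]] by simp

lemma C1_on_coordinates:
  "C1_on (\<lambda>p :: real \<times> real \<times> real. fst p) U"
  "C1_on (\<lambda>p :: real \<times> real \<times> real. fst (snd p)) U"
  "C1_on (\<lambda>p :: real \<times> real \<times> real. snd (snd p)) U"
  by (intro C1_on_bounded_linear bounded_linear_fst bounded_linear_snd
      bounded_linear_compose[OF bounded_linear_fst bounded_linear_snd]
      bounded_linear_compose[OF bounded_linear_snd bounded_linear_snd])+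

lemmas C1_intros = C1_on_add C1_on_diff C1_on_mult C1_on_const C1_on_powr C1_on_inverse C1_on_coordinates

lemma open_C1_pos:
  assumes "C1_on f V" "open V"
  shows "open {x \<in> V. f x > 0}"
proof -
  have "open (V \<inter> f -` {0<..})"
    by (rule continuous_open_preimage[OF C1_on_imp_continuous_on[OF assms(1)] assms(2)]) simp
  moreover have "V \<inter> f -` {0<..} = {x \<in> V. f x > 0}" by auto
  ultimately show ?thesis by simp
qed

subsection \<open>A singular ordinary differential equation\<close>

text \<open>The average is the solution operator of M + (t/\<alpha>) M' = f: the substitution z =
  t^\<alpha> y turns it into t^(-\<alpha>) times the integral of f(z^(1/\<alpha>)) over
  [0, t^\<alpha>], which the fundamental theorem of calculus differentiates. The form over [0, 1]
  stays meaningful for t <= 0.\<close>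

lemma power_average_has_derivative:
  fixes f :: "real \<Rightarrow> real"
  assumes "\<alpha> > 0" "0 < t" "t < b" "continuous_on {0..b} f"
  shows "((\<lambda>\<tau>. integral {0..1} (\<lambda>y. f (\<tau> * y powr (1/\<alpha>)))) has_real_derivative
    \<alpha> * (f t - integral {0..1} (\<lambda>y. f (t * y powr (1/\<alpha>)))) / t) (at t)"
proof -
  define F where "F z = f (z powr (1/\<alpha>))" for z
  have pb: "z powr (1/\<alpha>) \<le> b" if "0 \<le> z" "z \<le> b powr \<alpha>" for z
  proof -
    have "z powr (1/\<alpha>) \<le> (b powr \<alpha>) powr (1/\<alpha>)"
      using that assms by (intro powr_mono2) auto
    then show ?thesis using assms by (simp add: powr_powr)
  qed
  have contF: "continuous_on {0..b powr \<alpha>} F"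
    unfolding F_def
    by (rule continuous_on_compose2[OF assms(4)])
       (use pb assms in \<open>auto intro!: continuous_intros continuous_on_powr'\<close>)
  define I where "I z = integral {0..z} F" for z
  have M: "integral {0..1} (\<lambda>y. f (\<tau> * y powr (1/\<alpha>))) = \<tau> powr (-\<alpha>) * I (\<tau> powr \<alpha>)"
    if \<tau>: "0 < \<tau>" "\<tau> < b" for \<tau>
  proof -
    have "((\<lambda>y. \<tau> powr \<alpha> *\<^sub>R F (\<tau> powr \<alpha> * y)) has_integral
        integral {\<tau> powr \<alpha> * 0..\<tau> powr \<alpha> * 1} F) {0..1}"
    proof (rule has_integral_substitution[OF _ _ _ contF])
      show "(*) (\<tau> powr \<alpha>) ` {0..1} \<subseteq> {0..b powr \<alpha>}"
        using \<tau> assms by (auto intro!: mult_le_one order_trans[OF mult_left_le] powr_mono2)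
    qed (use \<tau> in \<open>auto intro!: derivative_eq_intros\<close>)
    then have "((\<lambda>y. \<tau> powr (-\<alpha>) * (\<tau> powr \<alpha> * F (\<tau> powr \<alpha> * y))) has_integral
        \<tau> powr (-\<alpha>) * I (\<tau> powr \<alpha>)) {0..1}"
      unfolding I_def by (intro has_integral_mult_right) simp
    also have "(\<lambda>y. \<tau> powr (-\<alpha>) * (\<tau> powr \<alpha> * F (\<tau> powr \<alpha> * y))) = (\<lambda>y. F (\<tau> powr \<alpha> * y))"
      using \<tau> by (auto simp: powr_minus)
    finally have "integral {0..1} (\<lambda>y. F (\<tau> powr \<alpha> * y)) = \<tau> powr (-\<alpha>) * I (\<tau> powr \<alpha>)"
      by (rule integral_unique)
    moreover have "integral {0..1} (\<lambda>y. F (\<tau> powr \<alpha> * y)) = integral {0..1} (\<lambda>y. f (\<tau> * y powr (1/\<alpha>)))"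
      using \<tau> assms by (intro integral_cong) (auto simp: F_def powr_mult powr_powr)
    ultimately show ?thesis by simp
  qed
  have ta: "0 < t powr \<alpha>" "t powr \<alpha> < b powr \<alpha>"
    using assms by (auto intro: powr_less_mono2)
  have "(I has_real_derivative F (t powr \<alpha>)) (at (t powr \<alpha>) within {0..b powr \<alpha>})"
    unfolding I_def by (rule integral_has_real_derivative[OF contF]) (use ta in auto)
  then have dI: "(I has_real_derivative F (t powr \<alpha>)) (at (t powr \<alpha>))"
    using ta by (simp add: at_within_Icc_at)
  have "((\<lambda>\<tau>. I (\<tau> powr \<alpha>)) has_real_derivative
     F (t powr \<alpha>) * (\<alpha> * t powr (\<alpha> - 1))) (at t)"
    by (rule DERIV_chain2[where g = "\<lambda>\<tau>. \<tau> powr \<alpha>", OF dI])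
       (use assms in \<open>auto intro!: derivative_eq_intros\<close>)
  moreover have "((\<lambda>\<tau>. \<tau> powr (-\<alpha>)) has_real_derivative (- \<alpha> * t powr (-\<alpha> - 1))) (at t)"
    using assms by (auto intro!: derivative_eq_intros)
  ultimately have d: "((\<lambda>\<tau>. \<tau> powr (-\<alpha>) * I (\<tau> powr \<alpha>)) has_real_derivative
     - \<alpha> * t powr (-\<alpha> - 1) * I (t powr \<alpha>) + F (t powr \<alpha>) * (\<alpha> * t powr (\<alpha> - 1)) * t powr (-\<alpha>)) (at t)"
    by (intro DERIV_mult)
  have "t powr (\<alpha> - 1) * t powr (-\<alpha>) = 1 / t" "t powr (-\<alpha> - 1) = t powr (-\<alpha>) / t"
    using assms by (simp_all add: powr_diff flip: powr_add)
  then have "((\<lambda>\<tau>. \<tau> powr (-\<alpha>) * I (\<tau> powr \<alpha>)) has_real_derivative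
     \<alpha> * (f t - t powr (-\<alpha>) * I (t powr \<alpha>)) / t) (at t)"
    using assms by (intro DERIV_cong[OF d]) (simp add: F_def powr_powr algebra_simps diff_divide_distrib)
  then have "((\<lambda>\<tau>. \<tau> powr (-\<alpha>) * I (\<tau> powr \<alpha>)) has_real_derivative
     \<alpha> * (f t - integral {0..1} (\<lambda>y. f (t * y powr (1/\<alpha>)))) / t) (at t)"
    using M[of t] assms by simp
  then show ?thesis
  proof (rule has_field_derivative_transform_within_open[where S = "{0<..<b}"])
  qed (use M assms in auto)
qed

lemma abs_scaled_power_le:
  fixes \<tau> y :: real
  assumes "0 \<le> y" "y \<le> 1" "a > 0"
  shows "\<bar>\<tau> * y powr a\<bar> \<le> \<bar>\<tau>\<bar>"
  using assms by (auto simp: abs_mult intro!: mult_left_le powr_le1)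

lemma continuous_on_scaled_power:
  fixes f :: "real \<Rightarrow> real"
  assumes "continuous_on {-b..b} f" "\<bar>\<tau>\<bar> \<le> b" "a > 0"
  shows "continuous_on {0..1} (\<lambda>y. f (\<tau> * y powr a))"
proof (rule continuous_on_compose2[OF assms(1)])
  show "continuous_on {0..1} (\<lambda>y. \<tau> * y powr a)"
    using assms by (intro continuous_intros continuous_on_powr') auto
  have "\<bar>\<tau> * y powr a\<bar> \<le> b" if "y \<in> {0..1}" for y
    using abs_scaled_power_le[of y a \<tau>] that assms by force
  then show "(\<lambda>y. \<tau> * y powr a) ` {0..1} \<subseteq> {-b..b}" by (force simp: abs_le_iff)
qed

lemma continuous_on_power_average:
  fixes f :: "real \<Rightarrow> real"
  assumes "continuous_on {-b..b} f" "a > 0"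
  shows "continuous_on {-b..b} (\<lambda>\<tau>. integral {0..1} (\<lambda>y. f (\<tau> * y powr a)))"
proof -
  have "continuous_on ({-b..b} \<times> cbox 0 1) (\<lambda>(\<tau>, y). f (\<tau> * y powr a))"
    unfolding case_prod_beta
  proof (rule continuous_on_compose2[OF assms(1)])
    show "continuous_on ({-b..b} \<times> cbox 0 1) (\<lambda>p. fst p * snd p powr a)"
      using assms by (intro continuous_intros continuous_on_powr') auto
    have "\<bar>fst p * snd p powr a\<bar> \<le> b" if "p \<in> {-b..b} \<times> cbox 0 1" for p
      using abs_scaled_power_le[of "snd p" a "fst p"] that assms by (force simp: mem_Times_iff)
    then show "(\<lambda>p. fst p * snd p powr a) ` ({-b..b} \<times> cbox 0 1) \<subseteq> {-b..b}"
      by (force simp: abs_le_iff)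
  qed
  from integral_continuous_on_param[OF this] show ?thesis by simp
qed

text \<open>The sample points \<tau> y^a have modulus at most |\<tau>|, so bounds pass to averages
  without loss. The confinement to the set \<open>S\<close>, the contraction and the derivative at 0
  below all rest on this.\<close>

lemma power_average_bound:
  fixes f g :: "real \<Rightarrow> real"
  assumes "continuous_on {-b..b} f" "continuous_on {-b..b} g" "a > 0" "\<bar>\<tau>\<bar> \<le> b"
    and "\<And>\<sigma>. \<bar>\<sigma>\<bar> \<le> \<bar>\<tau>\<bar> \<Longrightarrow> \<bar>f \<sigma> - g \<sigma>\<bar> \<le> B"
  shows "\<bar>integral {0..1} (\<lambda>y. f (\<tau> * y powr a)) - integral {0..1} (\<lambda>y. g (\<tau> * y powr a))\<bar> \<le> B"
proof -
  note c = continuous_on_scaled_power[OF assms(1,4,3)] continuous_on_scaled_power[OF assms(2,4,3)]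
  have "integral {0..1} (\<lambda>y. f (\<tau> * y powr a)) - integral {0..1} (\<lambda>y. g (\<tau> * y powr a))
      = integral {0..1} (\<lambda>y. f (\<tau> * y powr a) - g (\<tau> * y powr a))"
    by (rule integral_diff[symmetric]) (use c in \<open>auto intro: integrable_continuous_real\<close>)
  also have "norm \<dots> \<le> integral {0..1::real} (\<lambda>y. B)"
    using c assms(3) by (intro Henstock_Kurzweil_Integration.integral_norm_bound_integral)
      (auto intro!: integrable_continuous_real continuous_intros assms(5) abs_scaled_power_le)
  finally show ?thesis by simp
qed

text \<open>At 0 the substitution used for t > 0 breaks down. Instead, the affine part f(0) + d
  \<sigma> is averaged exactly, giving f(0) + d c \<tau> with c the integral of y^a, and the
  remainder is at most e |\<tau>| at every sample point.\<close>

lemma power_average_has_derivative_0: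
  fixes f :: "real \<Rightarrow> real"
  assumes "a > 0" "b > 0" "continuous_on {-b..b} f" "(f has_real_derivative d) (at 0)"
  shows "((\<lambda>\<tau>. integral {0..1} (\<lambda>y. f (\<tau> * y powr a))) has_real_derivative
    d * integral {0..1} (\<lambda>y. y powr a)) (at 0)"
proof -
  let ?M = "\<lambda>\<tau>. integral {0..1} (\<lambda>y. f (\<tau> * y powr a))"
  let ?c = "integral {0..1} (\<lambda>y. y powr a)"
  have "\<exists>\<delta>>0. \<forall>\<tau>. norm (\<tau> - 0) < \<delta> \<longrightarrow> norm (?M \<tau> - ?M 0 - (d * ?c) * (\<tau> - 0)) \<le> e * norm (\<tau> - 0)"
    if "e > 0" for e
  proof -
    have "\<forall>e>0. \<exists>\<delta>>0. \<forall>\<tau>. norm (\<tau> - 0) < \<delta> \<longrightarrow> norm (f \<tau> - f 0 - d * (\<tau> - 0)) \<le> e * norm (\<tau> - 0)"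
      using assms(4) unfolding has_field_derivative_def has_derivative_at_alt by blast
    then obtain \<delta> where \<delta>: "\<delta> > 0" "\<And>\<tau>. \<bar>\<tau>\<bar> < \<delta> \<Longrightarrow> \<bar>f \<tau> - f 0 - d * \<tau>\<bar> \<le> e * \<bar>\<tau>\<bar>"
      using \<open>e > 0\<close> by (metis diff_zero real_norm_def)
    show ?thesis
    proof (intro exI[of _ "min \<delta> b"] conjI allI impI)
      show "min \<delta> b > 0" using \<delta> assms by auto
      fix \<tau> :: real assume "norm (\<tau> - 0) < min \<delta> b"
      then have \<tau>: "\<bar>\<tau>\<bar> < \<delta>" "\<bar>\<tau>\<bar> \<le> b" by auto
      have cg: "continuous_on {-b..b} (\<lambda>\<sigma>. f 0 + d * \<sigma>)" by (intro continuous_intros)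
      have ci: "continuous_on {0..1} (\<lambda>y. y powr a)"
        using assms(1) by (intro continuous_intros continuous_on_powr') auto
      have "integral {0..1} (\<lambda>y. f 0 + d * (\<tau> * y powr a)) = f 0 + integral {0..1} (\<lambda>y. (d * \<tau>) * y powr a)"
        using ci by (subst integral_add)
          (auto intro!: integrable_continuous_real continuous_intros simp: mult.assoc)
      also have "\<dots> = f 0 + d * \<tau> * ?c"
        by (subst integral_mult_right) auto
      finally have g: "integral {0..1} (\<lambda>y. f 0 + d * (\<tau> * y powr a)) = f 0 + d * \<tau> * ?c" .
      have "\<bar>f \<sigma> - (f 0 + d * \<sigma>)\<bar> \<le> e * \<bar>\<tau>\<bar>" if "\<bar>\<sigma>\<bar> \<le> \<bar>\<tau>\<bar>" for \<sigma>
      proof -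
        have "\<bar>f \<sigma> - (f 0 + d * \<sigma>)\<bar> \<le> e * \<bar>\<sigma>\<bar>"
          using \<delta>(2)[of \<sigma>] that \<tau> by (simp add: algebra_simps)
        also have "\<dots> \<le> e * \<bar>\<tau>\<bar>" using that \<open>e > 0\<close> by simp
        finally show ?thesis .
      qed
      from power_average_bound[OF assms(3) cg assms(1) \<tau>(2) this]
      show "norm (?M \<tau> - ?M 0 - (d * ?c) * (\<tau> - 0)) \<le> e * norm (\<tau> - 0)"
        unfolding g by (simp add: algebra_simps)
    qed
  qed
  then show ?thesis
    unfolding has_field_derivative_def has_derivative_at_alt
    by (auto intro: bounded_linear_mult_right)
qed

text \<open>The linear bound in \<open>S\<close> is what makes the fixed point differentiable at 0.\<close>

lemma power_average_fixed_point:
  fixes E :: "(real \<Rightarrow> real) \<Rightarrow> real \<Rightarrow> real"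
  defines "S C e m \<equiv> {M. continuous_on {-e..e} M \<and> (\<forall>\<tau>\<in>{-e..e}. \<bar>M \<tau> - m\<bar> \<le> C * \<bar>\<tau>\<bar>)}"
  assumes "a > 0" "e > 0" "C \<ge> 0"
    and cont: "\<And>M. M \<in> S C e m \<Longrightarrow> continuous_on {-e..e} (E M)"
    and into: "\<And>M \<tau>. M \<in> S C e m \<Longrightarrow> \<bar>\<tau>\<bar> \<le> e \<Longrightarrow> \<bar>E M \<tau> - m\<bar> \<le> C * \<bar>\<tau>\<bar>"
    and contr: "\<And>M N d \<tau>. M \<in> S C e m \<Longrightarrow> N \<in> S C e m \<Longrightarrow> \<bar>\<tau>\<bar> \<le> e \<Longrightarrow>
       (\<And>\<sigma>. \<bar>\<sigma>\<bar> \<le> e \<Longrightarrow> \<bar>M \<sigma> - N \<sigma>\<bar> \<le> d) \<Longrightarrow> \<bar>E M \<tau> - E N \<tau>\<bar> \<le> d / 2"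
  obtains M where "M \<in> S C e m"
    "\<And>\<tau>. \<bar>\<tau>\<bar> \<le> e \<Longrightarrow> M \<tau> = integral {0..1} (\<lambda>y. E M (\<tau> * y powr a))"
proof -
  \<comment> \<open>Bounded continuous functions live on the whole line, so arguments are clamped to
    [-e, e]. \<open>X\<close> constrains values on that interval only, and \<open>T\<close>
    evaluates \<open>E M\<close> only there.\<close>
  define c where "c \<tau> = max (-e) (min e \<tau>)" for \<tau>
  have c: "c \<tau> \<in> {-e..e}" "\<bar>c \<tau>\<bar> \<le> e" for \<tau> using \<open>e > 0\<close> by (auto simp: c_def)
  have cid: "c \<tau> = \<tau>" if "\<bar>\<tau>\<bar> \<le> e" for \<tau> using that by (auto simp: c_def)
  have contc: "continuous_on UNIV c" unfolding c_def by (intro continuous_intros)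
  define T where "T M \<tau> = integral {0..1} (\<lambda>y. E M (c \<tau> * y powr a))" for M \<tau>
  define X where "X = PiC {-e..e} (\<lambda>\<tau>. cball m (C * \<bar>\<tau>\<bar>)) "
  have XS: "apply_bcontfun M \<in> S C e m" if "M \<in> X" for M
    using that by (auto simp: X_def mem_PiC_iff S_def Pi_iff dist_real_def abs_minus_commute)
  have Tb: "\<bar>T M \<tau> - m\<bar> \<le> C * \<bar>c \<tau>\<bar>" if M: "M \<in> S C e m" for M \<tau>
  proof -
    have "\<bar>T M \<tau> - integral {0..1} (\<lambda>y. (\<lambda>_. m) (c \<tau> * y powr a))\<bar> \<le> C * \<bar>c \<tau>\<bar>"
      unfolding T_def
    proof (rule power_average_bound[OF cont[OF M] _ \<open>a > 0\<close> c(2)])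
      fix \<sigma> assume "\<bar>\<sigma>\<bar> \<le> \<bar>c \<tau>\<bar>"
      then show "\<bar>E M \<sigma> - m\<bar> \<le> C * \<bar>c \<tau>\<bar>"
        using into[OF M, of \<sigma>] c(2)[of \<tau>] \<open>C \<ge> 0\<close> by (smt (verit) mult_left_mono)
    qed auto
    then show ?thesis by simp
  qed
  have Tc: "continuous_on UNIV (T M)" if M: "M \<in> S C e m" for M
    unfolding T_def
    by (rule continuous_on_compose2[OF continuous_on_power_average[OF cont[OF M] \<open>a > 0\<close>] contc])
       (use c in auto)
  have Tbc: "T M \<in> bcontfun" if M: "M \<in> S C e m" for M
  proof (rule bcontfun_normI[OF Tc[OF M]])
    fix \<tau>
    have "\<bar>T M \<tau> - m\<bar> \<le> C * e"
      using Tb[OF M, of \<tau>] c(2)[of \<tau>] \<open>C \<ge> 0\<close> by (smt (verit) mult_left_mono)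
    then show "norm (T M \<tau>) \<le> \<bar>m\<bar> + C * e" by auto
  qed
  have Tapp: "apply_bcontfun (Bcontfun (T M)) = T M" if "M \<in> S C e m" for M
    using Tbc[OF that] by (rule Bcontfun_inverse)
  have "\<exists>!M\<in>X. Bcontfun (T (apply_bcontfun M)) = M"
  proof (rule Banach_fix[of _ "1/2"])
    show "complete X" unfolding X_def complete_eq_closed by (rule closed_PiC) auto
    have "const_bcontfun m \<in> X"
      using \<open>C \<ge> 0\<close> by (auto simp: X_def mem_PiC_iff const_bcontfun.rep_eq)
    then show "X \<noteq> {}" by auto
    show "(\<lambda>M. Bcontfun (T (apply_bcontfun M))) ` X \<subseteq> X"
    proof safe
      fix M assume "M \<in> X"
      from XS[OF this] show "Bcontfun (T (apply_bcontfun M)) \<in> X"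
        using Tb[OF XS[OF \<open>M \<in> X\<close>]] cid
        by (auto simp: X_def mem_PiC_iff Tapp dist_real_def abs_minus_commute[of m]) (metis abs_le_iff minus_le_iff)
    qed
    fix M N assume MN: "M \<in> X" "N \<in> X"
    note MN' = XS[OF MN(1)] XS[OF MN(2)]
    show "dist (Bcontfun (T (apply_bcontfun M))) (Bcontfun (T (apply_bcontfun N))) \<le> 1/2 * dist M N"
    proof (rule dist_bound)
      fix \<tau>
      have "\<bar>E M \<sigma> - E N \<sigma>\<bar> \<le> dist M N / 2" if "\<bar>\<sigma>\<bar> \<le> \<bar>c \<tau>\<bar>" for \<sigma>
        by (rule contr[OF MN']) (use that c(2)[of \<tau>] dist_bounded[of M _ N] in \<open>auto simp: dist_real_def\<close>)
      from power_average_bound[OF cont[OF MN'(1)] cont[OF MN'(2)] \<open>a > 0\<close> c(2) this]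
      show "dist (apply_bcontfun (Bcontfun (T (apply_bcontfun M))) \<tau>)
         (apply_bcontfun (Bcontfun (T (apply_bcontfun N))) \<tau>) \<le> 1/2 * dist M N"
        using MN' by (simp add: Tapp dist_real_def T_def)
    qed
  qed auto
  then obtain M where M: "M \<in> X" "Bcontfun (T (apply_bcontfun M)) = M" by blast
  show thesis
  proof (rule that[OF XS[OF M(1)]])
    fix \<tau> :: real assume "\<bar>\<tau>\<bar> \<le> e"
    then show "M \<tau> = integral {0..1} (\<lambda>y. E M (\<tau> * y powr a))"
      using Tapp[OF XS[OF M(1)]] unfolding M(2) T_def by (metis cid)
  qed
qed

section \<open>Local existence for the Briot-Bouquet system\<close>

text \<open>Mean value inequality for h - A, whose derivative is small near p by continuity. A plain
  derivative would compare values only with the one at p, whereas a contraction estimate compares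
  two nearby arguments.\<close>

lemma C1_on_strict_derivative:
  assumes "C1_on h U" "open U" "p \<in> U"
  obtains A where "(h has_derivative blinfun_apply A) (at p)"
    "\<And>\<eta>. \<eta> > 0 \<Longrightarrow> \<exists>r>0. ball p r \<subseteq> U \<and>
       (\<forall>x\<in>ball p r. \<forall>y\<in>ball p r. \<bar>h x - h y - A (x - y)\<bar> \<le> \<eta> * norm (x - y))"
proof -
  obtain h' where h': "continuous_on U h'"
    "\<And>x. x \<in> U \<Longrightarrow> (h has_derivative blinfun_apply (h' x)) (at x)"
    using assms(1) unfolding C1_on_def by auto
  show thesis
  proof (rule that[of "h' p"])
    show "(h has_derivative blinfun_apply (h' p)) (at p)" using h' assms by auto
    fix \<eta> :: real assume "\<eta> > 0"
    have "isCont h' p" using h'(1) assms by (simp add: continuous_on_eq_continuous_at)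
    then obtain d where d: "d > 0" "\<And>x. dist x p < d \<Longrightarrow> dist (h' x) (h' p) < \<eta>"
      using \<open>\<eta> > 0\<close> unfolding continuous_at_eps_delta by blast
    obtain r0 where r0: "r0 > 0" "ball p r0 \<subseteq> U" using assms openE by blast
    define r where "r = min r0 d"
    have r: "r > 0" "ball p r \<subseteq> U" "\<And>x. x \<in> ball p r \<Longrightarrow> norm (h' x - h' p) \<le> \<eta>"
      using r0 d(1) d(2) by (auto simp: r_def dist_commute dist_norm dest: less_imp_le)
    have "norm ((h x - h' p x) - (h y - h' p y)) \<le> \<eta> * norm (x - y)"
      if "x \<in> ball p r" "y \<in> ball p r" for x y
    proof (rule differentiable_bound[where f' = "\<lambda>x. blinfun_apply (h' x - h' p)"])
      fix z assume z: "z \<in> ball p r"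
      have "((\<lambda>x. h x - h' p x) has_derivative (\<lambda>u. h' z u - h' p u)) (at z)"
        using h'(2)[of z] z r(2) by (intro derivative_intros) (auto intro!: derivative_eq_intros)
      then show "((\<lambda>x. h x - h' p x) has_derivative blinfun_apply (h' z - h' p)) (at z within ball p r)"
        by (simp add: minus_blinfun.rep_eq has_derivative_at_withinI)
      show "onorm (blinfun_apply (h' z - h' p)) \<le> \<eta>"
        using r(3)[OF z] by (simp add: norm_blinfun.rep_eq)
    qed (use that in auto)
    then show "\<exists>r>0. ball p r \<subseteq> U \<and>
       (\<forall>x\<in>ball p r. \<forall>y\<in>ball p r. \<bar>h x - h y - h' p (x - y)\<bar> \<le> \<eta> * norm (x - y))"
      using r by (intro exI[of _ r]) (auto simp: blinfun.bilinear_simps algebra_simps)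
  qed
qed

lemma norm_triple_le: "norm (a, b, c) \<le> norm a + norm b + norm c"
  using norm_Pair_le[of a "(b, c)"] norm_Pair_le[of b c] by linarith

text \<open>With \<phi> = 1 + integral of g(M), the system is a fixed point problem for M alone: M
  is the average of h(t, \<phi>, M). Since h(0, 1, M) does not depend on M, the M-derivative of h
  vanishes at the base point, so h is 1/4-Lipschitz in M nearby, while the dependence through \<phi>
  gains a factor e from the integration.\<close>

lemma briot_bouquet:
  fixes h :: "real \<times> real \<times> real \<Rightarrow> real" and g g' :: "real \<Rightarrow> real"
  assumes "\<alpha> > 0" "m > 0" and U: "open U" "(0, 1, m) \<in> U" and h: "C1_on h U"
    and h0: "\<And>M. (0, 1, M) \<in> U \<Longrightarrow> h (0, 1, M) = m"
    and g: "\<And>y. y > 0 \<Longrightarrow> (g has_real_derivative g' y) (at y)" and g': "continuous_on {0<..} g'"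
  obtains e \<phi> M M' where "e > 0" "\<phi> 0 = 1" "M 0 = m"
    "\<And>t. \<bar>t\<bar> < e \<Longrightarrow> (\<phi> has_real_derivative g (M t)) (at t)"
    "\<And>t. \<bar>t\<bar> < e \<Longrightarrow> (t, \<phi> t, M t) \<in> U"
    "\<And>t. 0 \<le> t \<Longrightarrow> t < e \<Longrightarrow> (M has_real_derivative M' t) (at t)"
    "\<And>t. 0 \<le> t \<Longrightarrow> t < e \<Longrightarrow> M t + t / \<alpha> * M' t = h (t, \<phi> t, M t)"
proof -
  let ?p = "(0, 1, m) :: real \<times> real \<times> real"
  obtain A where A: "(h has_derivative blinfun_apply A) (at ?p)"
    and strict: "\<And>\<eta>. \<eta> > 0 \<Longrightarrow> \<exists>r>0. ball ?p r \<subseteq> U \<and>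
       (\<forall>x\<in>ball ?p r. \<forall>y\<in>ball ?p r. \<bar>h x - h y - A (x - y)\<bar> \<le> \<eta> * norm (x - y))"
    using C1_on_strict_derivative[OF h U] by blast
  \<comment> \<open>\<open>h\<close> is insensitive to \<open>M\<close> to first order, hence a contraction in \<open>M\<close> near the base point.\<close>
  have A3: "A (0, 0, z) = 0" for z
  proof -
    define V where "V = (\<lambda>M. (0, 1, M)) -` U"
    have V: "open V" "m \<in> V" unfolding V_def using U
      by (auto intro!: open_vimage continuous_intros)
    have "((\<lambda>M. h (0, 1, M)) has_derivative (\<lambda>z. A (0, 0, z))) (at m)"
      by (rule has_derivative_compose[where f = "\<lambda>M. (0, 1, M)", OF _ A])
         (auto intro!: derivative_eq_intros)
    moreover have "((\<lambda>M. h (0, 1, M)) has_derivative (\<lambda>z. 0)) (at m)"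
    proof (rule has_derivative_transform_within_open)
      show "((\<lambda>M. m) has_derivative (\<lambda>z. 0)) (at m)" by simp
    qed (use V h0 in \<open>auto simp: V_def\<close>)
    ultimately show ?thesis using has_derivative_unique by (metis (no_types))
  qed
  have Asplit: "A (a, b, c) = A (a, b, 0)" for a b c
  proof -
    have "A ((a, b, 0) + (0, 0, c)) = A (a, b, 0) + A (0, 0, c)" by (rule blinfun.add_right)
    then show ?thesis by (simp add: A3)
  qed
  define L where "L = norm A + 1/4"
  have "L > 0" unfolding L_def by (intro add_nonneg_pos) auto
  obtain r where r: "r > 0" "ball ?p r \<subseteq> U" and
    r14: "\<And>x y. x \<in> ball ?p r \<Longrightarrow> y \<in> ball ?p r \<Longrightarrow> \<bar>h x - h y - A (x - y)\<bar> \<le> 1/4 * norm (x - y)"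
    using strict[of "1/4", OF divide_pos_pos[OF zero_less_one zero_less_numeral]] by blast
  have lip: "\<bar>h (a, b, c) - h (a', b', c')\<bar> \<le> L * (\<bar>a - a'\<bar> + \<bar>b - b'\<bar>) + \<bar>c - c'\<bar> / 4"
    if "(a, b, c) \<in> ball ?p r" "(a', b', c') \<in> ball ?p r" for a b c a' b' c'
  proof -
    have 1: "\<bar>h (a, b, c) - h (a', b', c') - A (a - a', b - b', c - c')\<bar> \<le> 1/4 * norm (a - a', b - b', c - c')"
      using r14[OF that] by simp
    have 2: "norm (a - a', b - b', c - c') \<le> \<bar>a - a'\<bar> + \<bar>b - b'\<bar> + \<bar>c - c'\<bar>"
      using norm_triple_le[of "a - a'" "b - b'" "c - c'"] by simp
    have 3: "\<bar>A (a - a', b - b', c - c')\<bar> \<le> norm A * (\<bar>a - a'\<bar> + \<bar>b - b'\<bar>)"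
    proof -
      have "\<bar>A (a - a', b - b', 0)\<bar> \<le> norm A * norm (a - a', b - b', 0::real)"
        using norm_blinfun[of A "(a - a', b - b', 0)"] by simp
      also have "\<dots> \<le> norm A * (\<bar>a - a'\<bar> + \<bar>b - b'\<bar>)"
        using norm_triple_le[of "a - a'" "b - b'" "0::real"] by (intro mult_left_mono) auto
      finally show ?thesis by (subst Asplit)
    qed
    have 4: "\<bar>h (a, b, c) - h (a', b', c')\<bar> \<le> \<bar>h (a, b, c) - h (a', b', c') - A (a - a', b - b', c - c')\<bar>
        + \<bar>A (a - a', b - b', c - c')\<bar>" by arith
    have "X \<le> (n + 1/4) * (p + q) + r / 4"
      if "Y \<le> 1/4 * N" "N \<le> p + q + r" "Z \<le> n * (p + q)" "X \<le> Y + Z" for X Y Z N n p q r :: real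
      using that unfolding distrib_left distrib_right by linarith
    from this[OF 1 2 3 4] show ?thesis unfolding L_def .
  qed
  \<comment> \<open>A compact range for M away from 0, on which g and g' are bounded.\<close>
  define J where "J = {m/2..3*m/2}"
  have J: "compact J" "J \<subseteq> {0<..}" using \<open>m > 0\<close> by (auto simp: J_def)
  have gcont: "continuous_on {0<..} g"
    by (rule DERIV_continuous_on[where D = g']) (use g in \<open>auto intro: has_field_derivative_at_within\<close>)
  have "bounded (g ` J)"
    using J continuous_on_subset[OF gcont] by (intro compact_imp_bounded compact_continuous_image) auto
  then obtain B where B: "B > 0" "\<And>y. y \<in> J \<Longrightarrow> \<bar>g y\<bar> \<le> B" by (auto simp: bounded_pos)
  have "bounded (g' ` J)"
    using J continuous_on_subset[OF g'] by (intro compact_imp_bounded compact_continuous_image) auto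
  then obtain G where G: "G > 0" "\<And>y. y \<in> J \<Longrightarrow> \<bar>g' y\<bar> \<le> G" by (auto simp: bounded_pos)
  have glip: "\<bar>g x - g y\<bar> \<le> G * \<bar>x - y\<bar>" if "x \<in> J" "y \<in> J" for x y
  proof -
    have "norm (g x - g y) \<le> G * norm (x - y)"
    proof (rule field_differentiable_bound)
      show "(g has_real_derivative g' z) (at z within J)" if "z \<in> J" for z
        using that J(2) g by (auto intro: has_field_derivative_at_within)
    qed (use that G in \<open>auto simp: J_def\<close>)
    then show ?thesis by simp
  qed
  \<comment> \<open>\<open>E M\<close> deviates from m by at most (L (1 + B) + C/4) |\<tau>|, which
    is (3C/4) |\<tau>| for this C.\<close>
  define C where "C = 2 * L * (1 + B)"
  have "C > 0" using \<open>L > 0\<close> B by (simp add: C_def)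
  \<comment> \<open>The three bounds keep the curve in the ball of radius r, keep M in
    \<open>J\<close>, and make the contribution of \<phi> to the contraction constant at most 1/4;
    with the 1/4 coming from M the total is 1/2.\<close>
  define e where "e = Min {r / (2 * (1 + B + C)), m / (2 * C), 1 / (4 * (L * G))}"
  have e: "e > 0" "(1 + B + C) * e < r" "C * e \<le> m / 2" "L * (G * e) \<le> 1 / 4"
  proof -
    show "e > 0" using r B \<open>C > 0\<close> \<open>m > 0\<close> \<open>L > 0\<close> G by (simp add: e_def)
    have "e \<le> r / (2 * (1 + B + C))" "e \<le> m / (2 * C)" "e \<le> 1 / (4 * (L * G))" by (auto simp: e_def)
    then have "(1 + B + C) * e \<le> r / 2" "C * e \<le> m / 2" "L * G * e \<le> 1 / 4"
      using B \<open>C > 0\<close> \<open>L > 0\<close> G by (auto simp: field_simps)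
    then show "(1 + B + C) * e < r" "C * e \<le> m / 2" "L * (G * e) \<le> 1 / 4"
      using r by (auto simp: mult.assoc)
  qed
  define S where "S = {M. continuous_on {-e..e} M \<and> (\<forall>\<tau>\<in>{-e..e}. \<bar>M \<tau> - m\<bar> \<le> C * \<bar>\<tau>\<bar>)}"
  \<comment> \<open>The difference of two integrals starting at -e is the oriented integral from 0,
    also for \<tau> < 0, where the integral over {0..\<tau>} would be 0.\<close>
  define \<Phi> where "\<Phi> M \<tau> = 1 + (integral {-e..\<tau>} (\<lambda>\<sigma>. g (M \<sigma>)) - integral {-e..0} (\<lambda>\<sigma>. g (M \<sigma>)))" for M \<tau>
  define E where "E M \<tau> = h (\<tau>, \<Phi> M \<tau>, M \<tau>)" for M \<tau>
  have SJ: "M \<tau> \<in> J" if "M \<in> S" "\<bar>\<tau>\<bar> \<le> e" for M \<tau>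
  proof -
    have "\<bar>M \<tau> - m\<bar> \<le> C * \<bar>\<tau>\<bar>" using that by (auto simp: S_def abs_le_iff)
    also have "\<dots> \<le> C * e" using that \<open>C > 0\<close> by simp
    finally show ?thesis using e unfolding J_def by (simp add: abs_le_iff)
  qed
  have gM: "continuous_on {-e..e} (\<lambda>\<sigma>. g (M \<sigma>))" if "M \<in> S" for M
    using that SJ J(2)
    by (intro continuous_on_compose2[OF gcont]) (force simp: S_def abs_le_iff)+
  have \<Phi>d: "(\<Phi> M has_real_derivative g (M \<tau>)) (at \<tau> within {-e..e})" if "M \<in> S" "\<bar>\<tau>\<bar> \<le> e" for M \<tau>
    unfolding \<Phi>_def using that
    by (auto intro!: derivative_eq_intros integral_has_real_derivative[OF gM[OF that(1)]])
  have \<Phi>0: "\<Phi> M 0 = 1" for M by (simp add: \<Phi>_def)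
  have \<Phi>1: "\<bar>\<Phi> M \<tau> - 1\<bar> \<le> B * \<bar>\<tau>\<bar>" if "M \<in> S" "\<bar>\<tau>\<bar> \<le> e" for M \<tau>
    using field_differentiable_bound[of "{-e..e}" "\<Phi> M" "\<lambda>\<tau>. g (M \<tau>)" B \<tau> 0] that \<Phi>d[OF that(1)]
      B(2) SJ[OF that(1)] e(1) by (auto simp: \<Phi>0 abs_le_iff)
  have \<Phi>c: "continuous_on {-e..e} (\<Phi> M)" if "M \<in> S" for M
    by (rule DERIV_continuous_on[where D = "\<lambda>\<tau>. g (M \<tau>)"]) (use \<Phi>d[OF that] in auto)
  have \<Phi>lip: "\<bar>\<Phi> M \<tau> - \<Phi> N \<tau>\<bar> \<le> (G * d) * e" if "M \<in> S" "N \<in> S" "\<bar>\<tau>\<bar> \<le> e"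
    and d: "\<And>\<sigma>. \<bar>\<sigma>\<bar> \<le> e \<Longrightarrow> \<bar>M \<sigma> - N \<sigma>\<bar> \<le> d" for M N d \<tau>
  proof -
    have "norm ((\<Phi> M \<tau> - \<Phi> N \<tau>) - (\<Phi> M 0 - \<Phi> N 0)) \<le> (G * d) * norm (\<tau> - 0)"
    proof (rule field_differentiable_bound[of "{-e..e}" _ "\<lambda>\<tau>. g (M \<tau>) - g (N \<tau>)"])
      fix \<sigma> assume s: "\<sigma> \<in> {-e..e}"
      then have s': "\<bar>\<sigma>\<bar> \<le> e" by auto
      show "((\<lambda>\<tau>. \<Phi> M \<tau> - \<Phi> N \<tau>) has_real_derivative g (M \<sigma>) - g (N \<sigma>)) (at \<sigma> within {-e..e})"
        using \<Phi>d that s' by (intro derivative_intros) auto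
      have "\<bar>g (M \<sigma>) - g (N \<sigma>)\<bar> \<le> G * \<bar>M \<sigma> - N \<sigma>\<bar>" using SJ that s' by (intro glip) auto
      also have "\<dots> \<le> G * d" using d[OF s'] G by simp
      finally show "norm (g (M \<sigma>) - g (N \<sigma>)) \<le> G * d" by simp
    qed (use that e in auto)
    also have "\<dots> \<le> (G * d) * e" using that(3) G(1) order_trans[OF abs_ge_zero d[of 0]] e(1) by (intro mult_left_mono) auto
    finally show ?thesis by (simp add: \<Phi>0)
  qed
  have near: "norm ((\<tau>, \<Phi> M \<tau>, M \<tau>) - ?p) \<le> (1 + B + C) * \<bar>\<tau>\<bar>"
             "norm ((\<tau>, \<Phi> M \<tau>, m) - ?p) \<le> (1 + B + C) * \<bar>\<tau>\<bar>" if "M \<in> S" "\<bar>\<tau>\<bar> \<le> e" for M \<tau>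
  proof -
    have 1: "\<bar>M \<tau> - m\<bar> \<le> C * \<bar>\<tau>\<bar>" using that by (auto simp: S_def abs_le_iff)
    show "norm ((\<tau>, \<Phi> M \<tau>, M \<tau>) - ?p) \<le> (1 + B + C) * \<bar>\<tau>\<bar>"
      using norm_triple_le[of \<tau> "\<Phi> M \<tau> - 1" "M \<tau> - m"] 1 \<Phi>1[OF that] by (simp add: algebra_simps)
    show "norm ((\<tau>, \<Phi> M \<tau>, m) - ?p) \<le> (1 + B + C) * \<bar>\<tau>\<bar>"
      using norm_triple_le[of \<tau> "\<Phi> M \<tau> - 1" "0::real"] 1 \<Phi>1[OF that] by (simp add: algebra_simps)
  qed
  have inball: "(\<tau>, \<Phi> M \<tau>, M \<tau>) \<in> ball ?p r" if "M \<in> S" "\<bar>\<tau>\<bar> \<le> e" for M \<tau>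
  proof -
    have "(1 + B + C) * \<bar>\<tau>\<bar> \<le> (1 + B + C) * e" using that B \<open>C > 0\<close> by (intro mult_left_mono) auto
    then show ?thesis using near(1)[OF that] e(2) unfolding mem_ball dist_norm norm_minus_commute[of ?p] by linarith
  qed
  have Ec: "continuous_on {-e..e} (E M)" if "M \<in> S" for M
    unfolding E_def
    by (rule continuous_on_compose2[OF C1_on_imp_continuous_on[OF h]])
       (use that \<Phi>c[OF that] inball[OF that] r(2) in \<open>fastforce simp: S_def abs_le_iff intro!: continuous_intros\<close>)+
  have hp: "h ?p = m" using h0 U by auto
  obtain M where M: "M \<in> S"
    and Mavg: "\<And>\<tau>. \<bar>\<tau>\<bar> \<le> e \<Longrightarrow> M \<tau> = integral {0..1} (\<lambda>y. E M (\<tau> * y powr (1/\<alpha>)))"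
  proof (rule power_average_fixed_point[of "1/\<alpha>" e C m E, folded S_def])
    fix M assume M: "M \<in> S"
    show "continuous_on {-e..e} (E M)" by (rule Ec[OF M])
    fix \<tau> assume t: "\<bar>\<tau>\<bar> \<le> e"
    have "\<bar>E M \<tau> - m\<bar> \<le> L * (\<bar>\<tau>\<bar> + \<bar>\<Phi> M \<tau> - 1\<bar>) + \<bar>M \<tau> - m\<bar> / 4"
      using lip[OF inball[OF M t], of 0 1 m] r(1) by (simp add: E_def hp)
    also have "\<dots> \<le> L * (\<bar>\<tau>\<bar> + B * \<bar>\<tau>\<bar>) + C * \<bar>\<tau>\<bar> / 4"
      using \<Phi>1[OF M t] M t \<open>L > 0\<close> by (intro add_mono mult_left_mono divide_right_mono) (auto simp: S_def abs_le_iff)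
    also have "\<dots> = (L * (1 + B) + C / 4) * \<bar>\<tau>\<bar>" by (simp add: algebra_simps)
    also have "\<dots> \<le> C * \<bar>\<tau>\<bar>" using \<open>C > 0\<close> by (intro mult_right_mono) (auto simp: C_def)
    finally show "\<bar>E M \<tau> - m\<bar> \<le> C * \<bar>\<tau>\<bar>" .
  next
    fix M N d \<tau>
    assume MN: "M \<in> S" "N \<in> S" and t: "\<bar>\<tau>\<bar> \<le> e" and d: "\<And>\<sigma>. \<bar>\<sigma>\<bar> \<le> e \<Longrightarrow> \<bar>M \<sigma> - N \<sigma>\<bar> \<le> d"
    have "d \<ge> 0" using d[of 0] e by auto
    have "\<bar>E M \<tau> - E N \<tau>\<bar> \<le> L * \<bar>\<Phi> M \<tau> - \<Phi> N \<tau>\<bar> + \<bar>M \<tau> - N \<tau>\<bar> / 4"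
      using lip[OF inball[OF MN(1) t] inball[OF MN(2) t]] by (simp add: E_def)
    also have "\<dots> \<le> L * ((G * d) * e) + d / 4"
      using \<Phi>lip[OF MN t d] d[OF t] \<open>L > 0\<close> by (intro add_mono mult_left_mono divide_right_mono) auto
    also have "L * ((G * d) * e) = (L * (G * e)) * d" by simp
    also have "\<dots> \<le> 1/4 * d" using e(4) \<open>d \<ge> 0\<close> by (rule mult_right_mono)
    finally show "\<bar>E M \<tau> - E N \<tau>\<bar> \<le> d / 2" by simp
  qed (use assms e \<open>C > 0\<close> in auto)
  define \<phi> where "\<phi> = \<Phi> M"
  have M0: "M 0 = m" using M e(1) by (auto simp: S_def dest!: bspec[of _ _ 0])
  have \<phi>d: "(\<phi> has_real_derivative g (M t)) (at t)" if "\<bar>t\<bar> < e" for t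
    using \<Phi>d[OF M, of t] that unfolding \<phi>_def by (simp add: at_within_Icc_at abs_less_iff)
  have E0: "E M 0 = m" by (simp add: E_def \<Phi>0 M0 hp)
  \<comment> \<open>Differentiability of M itself is not yet known. With M frozen at m the chain
    rule applies; replacing m by M changes h by o(1) |M - m|, which is o(\<tau>) because |M - m| <=
    C |\<tau>|.\<close>
  have dE0: "\<exists>d. (E M has_real_derivative d) (at 0)"
  proof -
    have "((\<lambda>\<tau>. (\<tau>, \<Phi> M \<tau>, m)) has_derivative (\<lambda>z. (z, g m * z, 0))) (at 0)"
      using \<phi>d[of 0] e unfolding \<phi>_def M0 has_field_derivative_def
      by (auto intro!: derivative_eq_intros)
    then have 1: "((\<lambda>\<tau>. h (\<tau>, \<Phi> M \<tau>, m)) has_derivative (\<lambda>z. A (z, g m * z, 0))) (at 0)"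
      by (rule has_derivative_compose) (simp add: \<Phi>0 A)
    have "\<forall>\<eta>>0. \<exists>\<delta>>0. \<forall>\<tau>. norm (\<tau> - 0) < \<delta> \<longrightarrow>
       norm ((h (\<tau>, \<Phi> M \<tau>, M \<tau>) - h (\<tau>, \<Phi> M \<tau>, m)) - (h (0, \<Phi> M 0, M 0) - h (0, \<Phi> M 0, m)) - 0) \<le> \<eta> * norm (\<tau> - 0)"
    proof (intro allI impI)
      fix \<eta> :: real assume "\<eta> > 0"
      then obtain s where s: "s > 0"
        "\<And>x y. x \<in> ball ?p s \<Longrightarrow> y \<in> ball ?p s \<Longrightarrow> \<bar>h x - h y - A (x - y)\<bar> \<le> \<eta> / C * norm (x - y)"
        using strict[of "\<eta> / C", OF divide_pos_pos[OF _ \<open>C > 0\<close>]] by blast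
      have pos: "1 + B + C > 0" using B \<open>C > 0\<close> by auto
      show "\<exists>\<delta>>0. \<forall>\<tau>. norm (\<tau> - 0) < \<delta> \<longrightarrow>
        norm ((h (\<tau>, \<Phi> M \<tau>, M \<tau>) - h (\<tau>, \<Phi> M \<tau>, m)) - (h (0, \<Phi> M 0, M 0) - h (0, \<Phi> M 0, m)) - 0) \<le> \<eta> * norm (\<tau> - 0)"
      proof (intro exI[of _ "min e (s / (1 + B + C))"] conjI allI impI)
        show "0 < min e (s / (1 + B + C))" using e s pos by simp
        fix \<tau> :: real assume "norm (\<tau> - 0) < min e (s / (1 + B + C))"
        then have t: "\<bar>\<tau>\<bar> \<le> e" "(1 + B + C) * \<bar>\<tau>\<bar> < s" using pos by (auto simp: field_simps)
        have "(\<tau>, \<Phi> M \<tau>, M \<tau>) \<in> ball ?p s" "(\<tau>, \<Phi> M \<tau>, m) \<in> ball ?p s"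
          using near[OF M t(1)] t(2) unfolding mem_ball dist_norm norm_minus_commute[of ?p] by linarith+
        from s(2)[OF this] have "\<bar>h (\<tau>, \<Phi> M \<tau>, M \<tau>) - h (\<tau>, \<Phi> M \<tau>, m)\<bar> \<le> \<eta> / C * \<bar>M \<tau> - m\<bar>"
          by (simp add: A3)
        also have "\<dots> \<le> \<eta> / C * (C * \<bar>\<tau>\<bar>)"
          using M t \<open>C > 0\<close> \<open>\<eta> > 0\<close> by (intro mult_left_mono) (auto simp: S_def abs_le_iff)
        finally show "norm ((h (\<tau>, \<Phi> M \<tau>, M \<tau>) - h (\<tau>, \<Phi> M \<tau>, m)) - (h (0, \<Phi> M 0, M 0) - h (0, \<Phi> M 0, m)) - 0) \<le> \<eta> * norm (\<tau> - 0)"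
          using \<open>C > 0\<close> by (simp add: M0)
      qed
    qed
    then have 2: "((\<lambda>\<tau>. h (\<tau>, \<Phi> M \<tau>, M \<tau>) - h (\<tau>, \<Phi> M \<tau>, m)) has_derivative (\<lambda>z. 0)) (at 0)"
      unfolding has_derivative_at_alt by (simp add: bounded_linear_zero)
    have "A (z, g m * z, 0) = A (1, g m, 0) * z" for z
      using blinfun.scaleR_right[of A z "(1, g m, 0)"] by (simp add: mult.commute)
    then have "(E M has_derivative (\<lambda>z. A (1, g m, 0) * z)) (at 0)"
      using has_derivative_add[OF 1 2] by (simp add: E_def[abs_def])
    then show ?thesis unfolding has_field_derivative_def by blast
  qed
  have "\<exists>d. (M has_real_derivative d) (at t) \<and> M t + t / \<alpha> * d = h (t, \<phi> t, M t)" if t: "0 \<le> t" "t < e" for t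
  proof (cases "t = 0")
    \<comment> \<open>The term with the factor t drops out, so at 0 the ODE is just the initial
      condition.\<close>
    case True
    obtain d where "(E M has_real_derivative d) (at 0)" using dE0 by blast
    from power_average_has_derivative_0[OF _ e(1) Ec[OF M] this, of "1/\<alpha>"]
    have "((\<lambda>\<tau>. integral {0..1} (\<lambda>y. E M (\<tau> * y powr (1/\<alpha>)))) has_real_derivative
      d * integral {0..1} (\<lambda>y. y powr (1/\<alpha>))) (at 0)" using \<open>\<alpha> > 0\<close> by simp
    then have "(M has_real_derivative d * integral {0..1} (\<lambda>y. y powr (1/\<alpha>))) (at 0)"
      by (rule has_field_derivative_transform_within_open[where S = "{-e<..<e}"])
         (use Mavg e in \<open>auto simp: abs_le_iff\<close>)
    then show ?thesis using True M0 E0 unfolding E_def \<phi>_def by auto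
  next
    case False
    with t have t: "0 < t" "t < e" by auto
    have cont: "continuous_on {0..e} (E M)" using Ec[OF M] by (rule continuous_on_subset) (use e in auto)
    from power_average_has_derivative[OF \<open>\<alpha> > 0\<close> t cont]
    have "((\<lambda>\<tau>. integral {0..1} (\<lambda>y. E M (\<tau> * y powr (1/\<alpha>)))) has_real_derivative
      \<alpha> * (E M t - M t) / t) (at t)" using Mavg[of t] t by simp
    then have "(M has_real_derivative \<alpha> * (E M t - M t) / t) (at t)"
      by (rule has_field_derivative_transform_within_open[where S = "{-e<..<e}"])
         (use Mavg e t in \<open>auto simp: abs_le_iff\<close>)
    moreover have "M t + t / \<alpha> * (\<alpha> * (E M t - M t) / t) = h (t, \<phi> t, M t)"
      using t \<open>\<alpha> > 0\<close> by (simp add: E_def \<phi>_def)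
    ultimately show ?thesis by blast
  qed
  then obtain M' where "\<And>t. 0 \<le> t \<Longrightarrow> t < e \<Longrightarrow> (M has_real_derivative M' t) (at t) \<and> M t + t / \<alpha> * M' t = h (t, \<phi> t, M t)"
    by metis
  moreover have "(t, \<phi> t, M t) \<in> U" if "\<bar>t\<bar> < e" for t
    unfolding \<phi>_def by (rule subsetD[OF r(2) inball[OF M]]) (use that in auto)
  ultimately show thesis
    using that[of e \<phi> M M'] e(1) \<phi>d M0 \<Phi>0 by (auto simp: \<phi>_def)
qed

lemma powr_inverse_power:
  fixes x :: real
  assumes "x > 0" "n > 0"
  shows "(x ^ n) powr (1 / real n) = x"
proof -
  have "(x ^ n) powr (1 / real n) = x powr (real n * (1 / real n))"
    using assms by (simp only: powr_powr powr_realpow[symmetric])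
  then show ?thesis using assms by simp
qed

text \<open>Here g is the N-th root, so M = \<phi>1^N and M' = N \<phi>1^(N-1) \<phi>2. In terms of
  M the Monge-Ampere equations below become affine in the highest derivative.\<close>

lemma briot_bouquet_power:
  fixes h :: "real \<times> real \<times> real \<Rightarrow> real" and N :: nat
  assumes "\<alpha> > 0" "m > 0" "N > 0" and U: "open U" "(0, 1, m) \<in> U" "\<And>t x M. (t, x, M) \<in> U \<Longrightarrow> M > 0"
    and h: "C1_on h U" and h0: "\<And>M. (0, 1, M) \<in> U \<Longrightarrow> h (0, 1, M) = m"
  obtains e and \<phi> \<phi>1 \<phi>2 :: "real \<Rightarrow> real" where "e > 0"
    "\<And>t. 0 \<le> t \<Longrightarrow> t < e \<Longrightarrow> (\<phi> has_real_derivative \<phi>1 t) (at t)"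
    "\<And>t. 0 \<le> t \<Longrightarrow> t < e \<Longrightarrow> (\<phi>1 has_real_derivative \<phi>2 t) (at t)"
    "\<And>t. 0 \<le> t \<Longrightarrow> t < e \<Longrightarrow> 0 < \<phi>1 t"
    "\<And>t. 0 \<le> t \<Longrightarrow> t < e \<Longrightarrow> (t, \<phi> t, \<phi>1 t ^ N) \<in> U"
    "\<And>t. 0 \<le> t \<Longrightarrow> t < e \<Longrightarrow>
      \<phi>1 t ^ N + t / \<alpha> * (N * \<phi>1 t ^ (N - 1) * \<phi>2 t) = h (t, \<phi> t, \<phi>1 t ^ N)"
proof -
  obtain e \<phi> M M' where e: "e > 0"
    and \<phi>: "\<And>t. \<bar>t\<bar> < e \<Longrightarrow> (\<phi> has_real_derivative M t powr (1 / N)) (at t)"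
    and inU: "\<And>t. \<bar>t\<bar> < e \<Longrightarrow> (t, \<phi> t, M t) \<in> U"
    and M: "\<And>t. 0 \<le> t \<Longrightarrow> t < e \<Longrightarrow> (M has_real_derivative M' t) (at t)"
    and ode: "\<And>t. 0 \<le> t \<Longrightarrow> t < e \<Longrightarrow> M t + t / \<alpha> * M' t = h (t, \<phi> t, M t)"
  proof (rule briot_bouquet[OF assms(1,2) U(1,2) h h0, of "\<lambda>y. y powr (1 / N)" "\<lambda>y. 1 / N * y powr (1 / N - 1)"])
    show "((\<lambda>y. y powr (1 / N)) has_real_derivative 1 / N * y powr (1 / N - 1)) (at y)" if "y > 0" for y
      using that by (rule has_real_derivative_powr)
    show "continuous_on {0<..} (\<lambda>y. 1 / N * y powr (1 / N - 1))"
      by (intro continuous_intros) auto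
  qed blast+
  define \<phi>1 where "\<phi>1 t = M t powr (1 / N)" for t
  define \<phi>2 where "\<phi>2 t = 1 / N * M t powr (1 / N - 1) * M' t" for t
  have Mpos: "M t > 0" if "\<bar>t\<bar> < e" for t using U(3) inU that by blast
  have pw: "\<phi>1 t ^ N = M t" if "\<bar>t\<bar> < e" for t
    using Mpos[OF that] \<open>N > 0\<close> by (simp add: \<phi>1_def powr_power)
  have pw1: "N * \<phi>1 t ^ (N - 1) * \<phi>2 t = M' t" if "\<bar>t\<bar> < e" for t
  proof -
    have "\<phi>1 t ^ (N - 1) * M t powr (1 / N - 1) = M t powr (1 / N * real (N - 1) + (1 / N - 1))"
      using Mpos[OF that] by (simp add: \<phi>1_def powr_power powr_add)
    also have "1 / N * real (N - 1) + (1 / N - 1) = 0" using \<open>N > 0\<close> by (simp add: field_simps of_nat_diff)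
    finally have "\<phi>1 t ^ (N - 1) * M t powr (1 / N - 1) = 1" using Mpos[OF that] by simp
    then show ?thesis using \<open>N > 0\<close> by (simp add: \<phi>2_def)
  qed
  show thesis
  proof (rule that[OF e])
    fix t assume t: "0 \<le> t" "t < e"
    then have t': "\<bar>t\<bar> < e" by simp
    show "(\<phi> has_real_derivative \<phi>1 t) (at t)" unfolding \<phi>1_def by (rule \<phi>[OF t'])
    show "(\<phi>1 has_real_derivative \<phi>2 t) (at t)" unfolding \<phi>1_def[abs_def] \<phi>2_def
      by (rule DERIV_chain2[OF has_real_derivative_powr[OF Mpos[OF t']] M[OF t]])
    show "0 < \<phi>1 t" using Mpos[OF t'] by (simp add: \<phi>1_def)
    show "(t, \<phi> t, \<phi>1 t ^ N) \<in> U" using inU[OF t'] by (simp add: pw[OF t'])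
    show "\<phi>1 t ^ N + t / \<alpha> * (N * \<phi>1 t ^ (N - 1) * \<phi>2 t) = h (t, \<phi> t, \<phi>1 t ^ N)"
      using ode[OF t] by (simp only: pw[OF t'] pw1[OF t'])
  qed
qed

subsection \<open>Determinants and change of variables\<close>

text \<open>The change of variables theorem of the library requires a well-ordered index type, hence this copy
  of a finite type with an order taken from an arbitrary enumeration.\<close>

typedef 'a wo = "UNIV :: 'a set" morphisms of_wo to_wo by simp

lemma bij_of_wo: "bij of_wo"
  by (rule bij_betw_byWitness[of _ to_wo]) (auto simp: of_wo_inverse to_wo_inverse)

instance wo :: (finite) finite
proof
  have "(UNIV :: 'a wo set) = range to_wo" by (metis of_wo_inverse surjI)
  then show "finite (UNIV :: 'a wo set)" by (metis finite finite_imageI)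
qed

instantiation wo :: (finite) linorder
begin

definition "x \<le> y \<longleftrightarrow> to_nat (of_wo x) \<le> to_nat (of_wo y)"
definition "x < y \<longleftrightarrow> to_nat (of_wo x) < to_nat (of_wo y)"

instance
  by standard (auto simp: less_eq_wo_def less_wo_def of_wo_inject)

end

instance wo :: (finite) wellorder
proof
  fix P :: "'a wo \<Rightarrow> bool" and a
  assume step: "\<And>x. (\<And>y. y < x \<Longrightarrow> P y) \<Longrightarrow> P x"
  show "P a"
    by (induction a rule: measure_induct_rule[where f = "\<lambda>x. to_nat (of_wo x)"])
       (rule step, unfold less_wo_def)
qed

section \<open>Change of variables for an arbitrary finite index type\<close>

text \<open>Conjugation by f carries the permutations of one index type onto those of the other and
  preserves signs, so the Leibniz sums agree term by term.\<close>

lemma det_reindex: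
  fixes A :: "'b::comm_ring_1 ^ 'n::finite ^ 'n" and f :: "'m::finite \<Rightarrow> 'n"
  assumes f: "bij f"
  shows "det (\<chi> i j. A $ f i $ f j) = det A"
proof -
  have inj: "inj f" using f by (rule bij_is_inj)
  have bf: "bij_betw f UNIV UNIV" "bij_betw (inv f) UNIV UNIV"
    using f bij_imp_bij_inv by auto
  have "(\<Sum>p | p permutes (UNIV :: 'm set). of_int (sign p) * (\<Prod>i\<in>UNIV. A $ f i $ f (p i))) =
    (\<Sum>p | p permutes (UNIV :: 'n set). of_int (sign p) * (\<Prod>i\<in>UNIV. A $ i $ p i))"
  proof (rule sum.reindex_bij_witness[where i = "map_permutation UNIV (inv f)" and j = "map_permutation UNIV f"])
    fix p assume p: "p \<in> {p. p permutes (UNIV :: 'm set)}"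
    show "map_permutation UNIV (inv f) (map_permutation UNIV f p) = p"
      using p inj bf by (intro map_permutation_compose_inv) auto
    show "map_permutation UNIV f p \<in> {p. p permutes (UNIV :: 'n set)}"
      using p bf by (auto intro!: map_permutation_permutes)
    have "(\<Prod>i\<in>UNIV. A $ i $ map_permutation UNIV f p i) = (\<Prod>i\<in>UNIV. A $ f i $ map_permutation UNIV f p (f i))"
      by (rule prod.reindex_bij_betw[OF bf(1), symmetric])
    then show "of_int (sign (map_permutation UNIV f p)) * (\<Prod>i\<in>UNIV. A $ i $ map_permutation UNIV f p i) =
       of_int (sign p) * (\<Prod>i\<in>UNIV. A $ f i $ f (p i))"
      using p inj by (simp add: map_permutation_apply sign_map_permutation)
  next
    fix p assume p: "p \<in> {p. p permutes (UNIV :: 'n set)}"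
    show "map_permutation UNIV f (map_permutation UNIV (inv f) p) = p"
      using p f bf by (intro map_permutation_compose_inv) (auto simp: bij_is_surj surj_f_inv_f)
    show "map_permutation UNIV (inv f) p \<in> {p. p permutes (UNIV :: 'm set)}"
      using p bf by (auto intro!: map_permutation_permutes)
  qed
  then show ?thesis by (simp add: det_def)
qed

lemma emeasure_lborel_box_cart:
  fixes l u :: "real ^ 'n"
  assumes "\<And>i. l $ i \<le> u $ i"
  shows "emeasure lborel (box l u) = (\<Prod>i\<in>UNIV. u $ i - l $ i)"
proof -
  have "emeasure lborel (box l u) = (\<Prod>b\<in>Basis. (u - l) \<bullet> b)"
    using assms by (intro emeasure_lborel_box) (auto simp: Basis_vec_def inner_axis)
  also have "(\<Prod>b\<in>Basis. (u - l) \<bullet> b) = (\<Prod>b\<in>(\<lambda>i. axis i 1) ` UNIV. (u - l) \<bullet> b)"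
    by (rule prod.cong) (auto simp: Basis_vec_def)
  also have "\<dots> = (\<Prod>i\<in>UNIV. u $ i - l $ i)"
    by (subst prod.reindex) (auto simp: inj_on_def axis_eq_axis inner_axis)
  finally show ?thesis .
qed

text \<open>Boxes determine \<open>lborel\<close>, and relabelling the coordinates turns a box into
  a box with the same side lengths. The result then passes to the completion.\<close>

lemma
  fixes f :: "'m::finite \<Rightarrow> 'n::finite"
  defines "T \<equiv> (\<lambda>x :: real ^ 'n. \<chi> i. x $ f i)"
  assumes f: "bij f"
  shows lebesgue_reindex_measurable: "T \<in> lebesgue \<rightarrow>\<^sub>M lebesgue"
    and lebesgue_reindex: "distr lebesgue lebesgue T = lebesgue"
proof -
  have Tm[measurable]: "T \<in> borel_measurable borel"
    unfolding T_def by (intro borel_measurable_continuous_onI continuous_intros)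
  have "lborel = distr lborel borel T"
  proof (rule lborel_eqI)
    fix l u :: "real ^ 'm" assume le: "\<And>b. b \<in> Basis \<Longrightarrow> l \<bullet> b \<le> u \<bullet> b"
    have lu: "l $ i \<le> u $ i" for i
      using le[of "axis i 1"] by (simp add: inner_axis)
    define l' u' :: "real ^ 'n" where "l' = (\<chi> j. l $ inv f j)" and "u' = (\<chi> j. u $ inv f j)"
    have finv: "f (inv f j) = j" "inv f (f i) = i" for i j
      using f by (simp_all add: bij_is_surj surj_f_inv_f bij_is_inj)
    have "T -` box l u = box l' u'"
      unfolding T_def l'_def u'_def vimage_def by (auto simp: mem_box_cart) (metis finv)+
    then have "emeasure (distr lborel borel T) (box l u) = emeasure lborel (box l' u')"
      by (simp add: emeasure_distr)
    also have "\<dots> = (\<Prod>j\<in>UNIV. u' $ j - l' $ j)"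
      by (rule emeasure_lborel_box_cart) (simp add: l'_def u'_def lu)
    also have "(\<Prod>j\<in>UNIV. u' $ j - l' $ j) = (\<Prod>i\<in>UNIV. u' $ f i - l' $ f i)"
      using f by (intro prod.reindex_bij_betw[symmetric]) auto
    also have "\<dots> = (\<Prod>i\<in>UNIV. u $ i - l $ i)" by (simp add: l'_def u'_def finv)
    also have "ennreal \<dots> = emeasure lborel (box l u)"
      by (rule emeasure_lborel_box_cart[symmetric, OF lu])
    also have "\<dots> = (\<Prod>b\<in>Basis. (u - l) \<bullet> b)"
      using lu by (intro emeasure_lborel_box) (auto simp: Basis_vec_def inner_axis)
    finally show "emeasure (distr lborel borel T) (box l u) = (\<Prod>b\<in>Basis. (u - l) \<bullet> b)" .
  qed simp
  then have d: "distr lebesgue lborel T = lborel"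
    by (simp add: distr_completion cong: distr_cong)
  have Tl: "T \<in> lebesgue \<rightarrow>\<^sub>M lborel" by (simp add: measurable_completion)
  show "T \<in> lebesgue \<rightarrow>\<^sub>M lebesgue"
    by (rule completion.measurable_completion2) (use Tl d in auto)
  show "distr lebesgue lebesgue T = lebesgue"
    using completion.completion_distr_eq[OF Tl] d by simp
qed

lemma emeasure_differentiable_image_wellorder:
  fixes f :: "real ^ 'n::{finite,wellorder} \<Rightarrow> real ^ 'n::_"
  assumes S: "S \<in> sets lebesgue"
    and der: "\<And>x. x \<in> S \<Longrightarrow> (f has_derivative f' x) (at x within S)"
    and inj: "inj_on f S"
    and int: "(\<lambda>x. det (matrix (f' x))) absolutely_integrable_on S"
  shows "f ` S \<in> sets lebesgue \<and> emeasure lebesgue (f ` S) = (\<integral>\<^sup>+x\<in>S. ennreal \<bar>det (matrix (f' x))\<bar> \<partial>lebesgue)"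
proof -
  have int': "(\<lambda>x. \<bar>det (matrix (f' x))\<bar>) absolutely_integrable_on S"
    using int by (auto simp: absolutely_integrable_on_def dest: absolutely_integrable_abs)
  then have i: "(\<lambda>x. \<bar>det (matrix (f' x))\<bar>) integrable_on S" by (simp add: absolutely_integrable_on_def)
  have m: "f ` S \<in> lmeasurable" using measurable_differentiable_image_eq[OF S der inj] i by blast
  have "emeasure lebesgue (f ` S) = ennreal (measure lebesgue (f ` S))"
    by (rule emeasure_eq_measure2[OF m])
  also have "measure lebesgue (f ` S) = integral S (\<lambda>x. \<bar>det (matrix (f' x))\<bar>)"
    by (rule measure_differentiable_image_eq[OF S der inj i])
  also have "\<dots> = (LINT x:S|lebesgue. \<bar>det (matrix (f' x))\<bar>)"
    using set_lebesgue_integral_eq_integral[OF int'] by simp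
  also have "ennreal \<dots> = (\<integral>\<^sup>+x. ennreal (indicator S x *\<^sub>R \<bar>det (matrix (f' x))\<bar>) \<partial>lebesgue)"
    using int' unfolding set_integrable_def set_lebesgue_integral_def
    by (intro nn_integral_eq_integral[symmetric]) auto
  also have "\<dots> = (\<integral>\<^sup>+x\<in>S. ennreal \<bar>det (matrix (f' x))\<bar> \<partial>lebesgue)"
    by (intro nn_integral_cong) (auto split: split_indicator)
  finally show ?thesis using m by auto
qed

text \<open>The map is conjugated by a relabelling of coordinates into the well-ordered copy of the
  index type. Relabelling preserves Lebesgue measure and, applied to rows and columns alike,
  determinants.\<close>

lemma emeasure_differentiable_image:
  fixes f :: "real ^ 'n::finite \<Rightarrow> real ^ 'n"
  assumes S: "S \<in> sets lebesgue"
    and der: "\<And>x. x \<in> S \<Longrightarrow> (f has_derivative f' x) (at x within S)"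
    and inj: "inj_on f S"
    and int: "(\<lambda>x. det (matrix (f' x))) absolutely_integrable_on S"
  shows "f ` S \<in> sets lebesgue \<and> emeasure lebesgue (f ` S) = (\<integral>\<^sup>+x\<in>S. ennreal \<bar>det (matrix (f' x))\<bar> \<partial>lebesgue)"
proof -
  define T :: "real ^ 'n \<Rightarrow> real ^ 'n wo" where "T = (\<lambda>x. \<chi> i. x $ of_wo i)"
  define R :: "real ^ 'n wo \<Rightarrow> real ^ 'n" where "R = (\<lambda>x. \<chi> i. x $ to_wo i)"
  have bij: "bij (to_wo :: 'n \<Rightarrow> 'n wo)"
    by (rule bij_betw_byWitness[of _ of_wo]) (auto simp: of_wo_inverse to_wo_inverse)
  have RT[simp]: "R (T x) = x" and TR[simp]: "T (R y) = y" for x y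
    by (simp_all add: R_def T_def vec_eq_iff to_wo_inverse of_wo_inverse)
  have lT: "bounded_linear T" and lR: "bounded_linear R"
    unfolding T_def R_def by (auto intro!: linear_conv_bounded_linear[THEN iffD1] linearI simp: vec_eq_iff)
  have Tm: "T \<in> lebesgue \<rightarrow>\<^sub>M lebesgue" unfolding T_def by (rule lebesgue_reindex_measurable[OF bij_of_wo])
  have Rm: "R \<in> lebesgue \<rightarrow>\<^sub>M lebesgue" unfolding R_def by (rule lebesgue_reindex_measurable[OF bij])
  have Rd: "distr lebesgue lebesgue R = lebesgue" unfolding R_def by (rule lebesgue_reindex[OF bij])
  have imT: "T ` X = R -` X" for X using TR RT by (auto simp: image_iff) (metis TR)
  have imR: "R ` X = T -` X" for X using TR RT by (auto simp: image_iff) (metis RT)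
  have setsT: "T ` X \<in> sets lebesgue" if "X \<in> sets lebesgue" for X
    using measurable_sets[OF Rm that] by (simp add: imT)
  have setsR: "R ` X \<in> sets lebesgue" if "X \<in> sets lebesgue" for X
    using measurable_sets[OF Tm that] by (simp add: imR)
  define g where "g = T \<circ> f \<circ> R"
  define g' where "g' y = T \<circ> f' (R y) \<circ> R" for y
  have detg: "det (matrix (g' y)) = det (matrix (f' (R y)))" if "y \<in> T ` S" for y
  proof -
    have "R (axis j 1) = axis (of_wo j) 1" for j :: "'n wo"
      unfolding R_def axis_def vec_eq_iff by (auto simp: of_wo_inverse to_wo_inverse)
    then have "matrix (g' y) = (\<chi> i j. matrix (f' (R y)) $ of_wo i $ of_wo j)"
      by (simp add: matrix_def g'_def T_def)
    then show ?thesis using det_reindex[OF bij_of_wo, of "matrix (f' (R y))"] by simp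
  qed
  have int1: "integrable (distr lebesgue lebesgue R) (\<lambda>x. indicator S x *\<^sub>R det (matrix (f' x)))"
    using int by (simp add: Rd set_integrable_def)
  have "(\<lambda>y. det (matrix (f' (R y)))) absolutely_integrable_on T ` S"
    using integrable_distr[OF Rm int1] by (simp add: set_integrable_def imT indicator_vimage comp_def indicator_def)
  then have intg: "(\<lambda>y. det (matrix (g' y))) absolutely_integrable_on T ` S"
    by (rule set_integrable_cong[THEN iffD1, rotated 3]) (auto simp: detg)
  have "g ` T ` S \<in> sets lebesgue \<and>
     emeasure lebesgue (g ` T ` S) = (\<integral>\<^sup>+y\<in>T ` S. ennreal \<bar>det (matrix (g' y))\<bar> \<partial>lebesgue)"
  proof (rule emeasure_differentiable_image_wellorder[OF setsT[OF S] _ _ intg])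
    fix y assume y: "y \<in> T ` S"
    then have Ry: "R y \<in> S" "R ` T ` S = S" by (auto simp: image_image)
    have "(f has_derivative f' (R y)) (at (R y) within R ` T ` S)" using der Ry by simp
    then show "(g has_derivative g' y) (at y within T ` S)"
      unfolding g_def g'_def
      by (intro diff_chain_within bounded_linear_imp_has_derivative lT lR)
         (auto simp: bounded_linear_imp_has_derivative lT lR)
  next
    show "inj_on g (T ` S)"
      unfolding g_def inj_on_def comp_def using inj by (metis (no_types, lifting) RT imageE inj_onD)
  qed
  moreover have "g ` T ` S = T ` f ` S" by (auto simp: g_def image_image)
  ultimately have g1: "T ` f ` S \<in> sets lebesgue" and
    g2: "emeasure lebesgue (T ` f ` S) = (\<integral>\<^sup>+y\<in>T ` S. ennreal \<bar>det (matrix (g' y))\<bar> \<partial>lebesgue)" by auto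
  have "R ` T ` f ` S = f ` S" by (auto simp: image_image)
  then have fS: "f ` S \<in> sets lebesgue" using setsR[OF g1] by simp
  have "(\<lambda>x. indicator S x *\<^sub>R det (matrix (f' x))) \<in> borel_measurable lebesgue"
    using int by (auto simp: set_integrable_def)
  then have "(\<lambda>x. ennreal \<bar>indicator S x *\<^sub>R det (matrix (f' x))\<bar>) \<in> borel_measurable lebesgue"
    by measurable
  also have "(\<lambda>x. ennreal \<bar>indicator S x *\<^sub>R det (matrix (f' x))\<bar>) = (\<lambda>x. ennreal \<bar>det (matrix (f' x))\<bar> * indicator S x)"
    by (auto split: split_indicator)
  finally have meas: "(\<lambda>x. ennreal \<bar>det (matrix (f' x))\<bar> * indicator S x) \<in> borel_measurable lebesgue" .
  have "emeasure lebesgue (f ` S) = emeasure (distr lebesgue lebesgue R) (f ` S)" by (simp add: Rd)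
  also have "\<dots> = emeasure lebesgue (T ` f ` S)"
    by (subst emeasure_distr[OF Rm fS]) (simp add: imT)
  also have "\<dots> = (\<integral>\<^sup>+y. ennreal \<bar>det (matrix (f' (R y)))\<bar> * indicator S (R y) \<partial>lebesgue)"
    unfolding g2 by (intro nn_integral_cong) (auto simp: detg imT split: split_indicator)
  also have "\<dots> = (\<integral>\<^sup>+x\<in>S. ennreal \<bar>det (matrix (f' x))\<bar> \<partial>distr lebesgue lebesgue R)"
    by (rule nn_integral_distr[OF Rm, symmetric]) (simp add: meas)
  finally show ?thesis using fS by (simp add: Rd)
qed

section \<open>Determinants of low-rank perturbations of the identity\<close>

lemma mat_plus_rank2_mult:
  fixes u u' p q x :: "real ^ 'n"
  shows "(\<chi> i j. (if i = j then 1 else 0) + u $ i * p $ j + u' $ i * q $ j) *v x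
     = x + (p \<bullet> x) *\<^sub>R u + (q \<bullet> x) *\<^sub>R u'"
proof -
  have "(\<Sum>j\<in>UNIV. ((if i = j then 1 else 0) + u $ i * p $ j + u' $ i * q $ j) * x $ j) =
    (\<Sum>j\<in>UNIV. if j = i then x $ j else 0) + (\<Sum>j\<in>UNIV. p $ j * x $ j) * u $ i + (\<Sum>j\<in>UNIV. q $ j * x $ j) * u' $ i" for i
    unfolding sum_distrib_right sum.distrib[symmetric] by (rule sum.cong) (auto simp: algebra_simps)
  then show ?thesis by (simp add: matrix_vector_mult_def vec_eq_iff inner_vec_def)
qed

lemma mat_plus_rank1_mult:
  fixes u p x :: "real ^ 'n"
  shows "(\<chi> i j. (if i = j then 1 else 0) + u $ i * p $ j) *v x = x + (p \<bullet> x) *\<^sub>R u"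
  using mat_plus_rank2_mult[of u p 0 0 x] by simp

text \<open>Conjugation by an orthogonal matrix preserves the determinant and acts on u and p
  simultaneously, which reduces the claim to p parallel to a coordinate axis.\<close>

lemma det_mat_plus_rank1:
  fixes u p :: "real ^ 'n"
  shows "det (\<chi> i j. (if i = j then 1 else 0) + u $ i * p $ j) = 1 + u \<bullet> p"
proof -
  obtain k :: 'n where True by blast
  have "\<exists>r. orthogonal_transformation r \<and> r p = norm p *\<^sub>R axis k (1::real)"
    by (rule orthogonal_transformation_exists[of p "norm p *\<^sub>R axis k 1"]) auto
  then obtain r where r: "orthogonal_transformation r" "r p = norm p *\<^sub>R axis k (1::real)" by (elim exE conjE)
  define Q where "Q = matrix r"
  have Q: "orthogonal_matrix Q" using r(1) by (simp add: Q_def orthogonal_transformation_matrix)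
  have Qv: "Q *v x = r x" for x
    using r(1) by (simp add: Q_def orthogonal_transformation_def matrix_works)
  have ip: "(Q *v x) \<bullet> (Q *v y) = x \<bullet> y" for x y
    using r(1) by (simp add: Qv orthogonal_transformation_def)
  let ?A = "\<lambda>u p :: real ^ 'n. (\<chi> i j. (if i = j then 1 else 0) + u $ i * p $ j)"
  have "Q ** ?A u p = ?A (Q *v u) (Q *v p) ** Q"
    unfolding matrix_eq
    by (simp add: matrix_vector_mul_assoc[symmetric] mat_plus_rank1_mult ip matrix_vector_right_distrib matrix_vector_mult_scaleR)
  from arg_cong[OF this, of det] have "det Q * det (?A u p) = det (?A (Q *v u) (Q *v p)) * det Q"
    by (simp only: det_mul)
  moreover have "det Q \<noteq> 0" using det_orthogonal_matrix[OF Q] by auto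
  ultimately have "det (?A u p) = det (?A (Q *v u) (Q *v p))" by simp
  \<comment> \<open>Once p lies on the k-th axis, the matrix differs from the identity in column k
    only, so Cramer's rule evaluates the determinant.\<close>
  also have "?A (Q *v u) (Q *v p) =
     (\<chi> i j. if j = k then (mat 1 *v (axis k 1 + norm p *\<^sub>R (Q *v u))) $ i else (mat 1 :: real^'n^'n) $ i $ j)"
    unfolding Qv r(2) matrix_vector_mul_lid by (simp add: vec_eq_iff axis_def mat_def)
  also have "det \<dots> = (axis k 1 + norm p *\<^sub>R (Q *v u)) $ k" by (subst cramer_lemma) simp
  also have "\<dots> = 1 + (Q *v u) \<bullet> (Q *v p)" using r(2) by (simp add: Qv inner_axis)
  finally show ?thesis by (simp add: ip)
qed

text \<open>The matrix factors as (I + u p^T)(I + w q^T) as soon as (I + u p^T) w = u', which is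
  solvable because 1 + u . p is nonzero.\<close>

lemma det_mat_plus_rank2:
  fixes u u' p q :: "real ^ 'n"
  assumes "1 + u \<bullet> p \<noteq> 0"
  shows "det (\<chi> i j. (if i = j then 1 else 0) + u $ i * p $ j + u' $ i * q $ j) =
    (1 + u \<bullet> p) * (1 + u' \<bullet> q) - (p \<bullet> u') * (q \<bullet> u)"
proof -
  let ?A = "\<lambda>u p :: real ^ 'n. (\<chi> i j. (if i = j then 1 else 0) + u $ i * p $ j)"
  \<comment> \<open>Sherman-Morrison formula for the inverse of I + u p^T, applied to u'.\<close>
  define w where "w = u' - ((p \<bullet> u') / (1 + u \<bullet> p)) *\<^sub>R u"
  have w: "w + (p \<bullet> w) *\<^sub>R u = u'"
  proof -
    define D c where "D = 1 + u \<bullet> p" and "c = p \<bullet> u'"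
    have "D \<noteq> 0" "p \<bullet> u = D - 1" using assms by (simp_all add: D_def inner_commute)
    moreover have "p \<bullet> w = c - c / D * (p \<bullet> u)" by (simp add: w_def inner_diff_right D_def c_def)
    ultimately have "p \<bullet> w = c - c / D * (D - 1)" by simp
    then have "p \<bullet> w = c / D" using \<open>D \<noteq> 0\<close> by (simp add: field_simps)
    then show ?thesis by (simp add: w_def D_def c_def)
  qed
  have "(\<chi> i j. (if i = j then 1 else 0) + u $ i * p $ j + u' $ i * q $ j) = ?A u p ** ?A w q"
    unfolding matrix_eq mat_plus_rank2_mult matrix_vector_mul_assoc[symmetric] mat_plus_rank1_mult
  proof
    fix x
    have "x + (p \<bullet> x) *\<^sub>R u + (q \<bullet> x) *\<^sub>R u' = x + (p \<bullet> x) *\<^sub>R u + (q \<bullet> x) *\<^sub>R (w + (p \<bullet> w) *\<^sub>R u)"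
      by (simp only: w)
    then show "x + (p \<bullet> x) *\<^sub>R u + (q \<bullet> x) *\<^sub>R u' = x + (q \<bullet> x) *\<^sub>R w + (p \<bullet> (x + (q \<bullet> x) *\<^sub>R w)) *\<^sub>R u"
      by (simp add: algebra_simps inner_add_right)
  qed
  then have "det (\<chi> i j. (if i = j then 1 else 0) + u $ i * p $ j + u' $ i * q $ j) = (1 + u \<bullet> p) * (1 + w \<bullet> q)"
    by (simp add: det_mul det_mat_plus_rank1)
  also have "\<dots> = (1 + u \<bullet> p) * (1 + u' \<bullet> q) - (p \<bullet> u') * (q \<bullet> u)"
  proof -
    define D where "D = 1 + u \<bullet> p"
    have "w \<bullet> q = u' \<bullet> q - (p \<bullet> u') / D * (q \<bullet> u)"
      by (simp add: w_def D_def inner_diff_left) (simp add: inner_commute)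
    then show ?thesis using assms unfolding D_def[symmetric] by (simp add: field_simps)
  qed
  finally show ?thesis .
qed

subsection \<open>Functions of two distances\<close>

text \<open>The conclusion of the theorem as a predicate, to be delivered separately for s > 1 and s
  = 1.\<close>

definition has_singular_solution :: "'n::finite set \<Rightarrow> real \<Rightarrow> real \<Rightarrow> bool" where
  "has_singular_solution K q s \<longleftrightarrow> (\<exists>v :: real ^ 'n \<Rightarrow> real.
    (\<forall>x\<in>ball 0 1. 0 \<le> v x) \<and>
    convex_on (ball 0 1) v \<and>
    aleksandrov_solution (ball 0 1) v
      (\<lambda>x. ennreal (v x powr q) * indicator {x. v x > 0} x) \<and>
    {x \<in> ball 0 1. v x = 0} = coord_subspace K \<inter> ball 0 1 \<and>
    (\<exists>c C :: real. 0 < c \<and> 0 < C \<and>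
      (\<forall>x\<in>ball 0 1.
         c * infdist x (coord_subspace K) powr s \<le> v x \<and>
         v x \<le> C * infdist x (coord_subspace K) powr s)))"

text \<open>X and Y stand for the inner products of a vector h with x' and x'', and U and V for the
  squared lengths of its two parts. Cauchy-Schwarz allows U and V to be replaced by X^2/(2t) and
  Y^2/(2w), which leaves a binary form with positive leading coefficient and determinant.\<close>

lemma pos_quadratic_form:
  fixes a b t w U V X Y \<alpha> \<beta> \<gamma> :: real
  assumes "a > 0" "b > 0" "t \<ge> 0" "w > 0" "U \<ge> 0" "V \<ge> 0" "U + V > 0"
    and "X\<^sup>2 \<le> 2 * t * U" "Y\<^sup>2 \<le> 2 * w * V"
    and "a + 2 * t * \<alpha> > 0" "(a + 2 * t * \<alpha>) * (b + 2 * w * \<gamma>) - 4 * t * w * \<beta>\<^sup>2 > 0"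
  shows "a * U + b * V + \<alpha> * X\<^sup>2 + 2 * \<beta> * X * Y + \<gamma> * Y\<^sup>2 > 0"
proof (cases "X = 0 \<and> Y = 0")
  case True
  have "a * U + b * V > 0"
    using assms by (cases "U = 0") (auto intro: add_pos_nonneg)
  with True show ?thesis by simp
next
  case False
  have V: "b * V \<ge> b * Y\<^sup>2 / (2 * w)" using assms by (simp add: field_simps)
  show ?thesis
  \<comment> \<open>Division by t is impossible at x' = 0, but there X vanishes.\<close>
  proof (cases "t = 0")
    case True
    then have X: "X = 0" using assms(8) by simp
    have "0 < a * (b + 2 * w * \<gamma>)" using assms(11) True by simp
    then have "0 < b + 2 * w * \<gamma>" using \<open>a > 0\<close> by (rule zero_less_mult_pos)
    then have "0 < b / (2 * w) + \<gamma>" using \<open>w > 0\<close> by (simp add: field_simps)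
    moreover have "Y\<^sup>2 > 0" using X False by simp
    ultimately have "0 < (b / (2 * w) + \<gamma>) * Y\<^sup>2" by simp
    also have "\<dots> \<le> b * V + \<gamma> * Y\<^sup>2" using V by (simp add: algebra_simps)
    also have "\<dots> \<le> a * U + b * V + \<gamma> * Y\<^sup>2" using assms by simp
    finally show ?thesis using X by simp
  next
    case False': False
    then have "t > 0" using assms by simp
    define A where "A = a / (2 * t) + \<alpha>"
    define B where "B = b / (2 * w) + \<gamma>"
    have U: "a * U \<ge> a * X\<^sup>2 / (2 * t)" using assms \<open>t > 0\<close> by (simp add: field_simps)
    have At: "A * (2 * t) = a + 2 * t * \<alpha>" and Bw: "B * (2 * w) = b + 2 * w * \<gamma>"
      using \<open>t > 0\<close> assms by (simp_all add: A_def B_def field_simps)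
    have A: "A > 0" using At assms \<open>t > 0\<close> by (metis zero_less_mult_pos2 mult_pos_pos zero_less_numeral)
    have "(4 * t * w) * (A * B - \<beta>\<^sup>2) > 0"
      using assms(11) unfolding At[symmetric] Bw[symmetric] by (simp add: algebra_simps)
    then have AB: "A * B - \<beta>\<^sup>2 > 0" by (rule zero_less_mult_pos) (use \<open>t > 0\<close> assms in simp)
    have "0 < (A * X + \<beta> * Y)\<^sup>2 + (A * B - \<beta>\<^sup>2) * Y\<^sup>2"
    proof (cases "Y = 0")
      case True
      then have "X \<noteq> 0" using False by simp
      then show ?thesis using True A by simp
    next
      case False
      then show ?thesis using AB by (intro add_nonneg_pos) auto
    qed
    also have "\<dots> = A * (A * X\<^sup>2 + 2 * \<beta> * X * Y + B * Y\<^sup>2)" by (simp add: algebra_simps power2_eq_square)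
    finally have "0 < A * X\<^sup>2 + 2 * \<beta> * X * Y + B * Y\<^sup>2" using A by (simp add: zero_less_mult_iff)
    also have "\<dots> \<le> a * U + b * V + \<alpha> * X\<^sup>2 + 2 * \<beta> * X * Y + \<gamma> * Y\<^sup>2"
      using U V by (simp add: A_def B_def algebra_simps)
    finally show ?thesis .
  qed
qed

section \<open>From a profile in t and w to an Aleksandrov solution\<close>

text \<open>The powers in \<open>eq\<close> count the tangential directions in x' and x''; the
  remaining factor is the determinant of the radial 2 x 2 block, because |x'|^2 = 2t and |x''|^2 =
  2w. Of this block only the leading entry is assumed positive: its determinant is positive by
  \<open>eq\<close>. In the unit ball t and w are below 1/2.\<close>

locale cylindrical_profile =
  fixes K :: "'n::finite set" and q \<sigma> c C :: real
    and G G1 G2 G11 G12 G22 :: "real \<Rightarrow> real \<Rightarrow> real"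
  assumes K: "K \<noteq> {}" "- K \<noteq> {}" and q: "q \<ge> 0" and \<sigma>: "\<sigma> > 0" and c: "c > 0"
    and dG: "\<And>t w. 0 \<le> t \<Longrightarrow> t < 1/2 \<Longrightarrow> 0 < w \<Longrightarrow> w < 1/2 \<Longrightarrow>
      ((\<lambda>p. G (fst p) (snd p)) has_derivative (\<lambda>h. G1 t w * fst h + G2 t w * snd h)) (at (t, w))"
    and dG1: "\<And>t w. 0 \<le> t \<Longrightarrow> t < 1/2 \<Longrightarrow> 0 < w \<Longrightarrow> w < 1/2 \<Longrightarrow>
      ((\<lambda>p. G1 (fst p) (snd p)) has_derivative (\<lambda>h. G11 t w * fst h + G12 t w * snd h)) (at (t, w))"
    and dG2: "\<And>t w. 0 \<le> t \<Longrightarrow> t < 1/2 \<Longrightarrow> 0 < w \<Longrightarrow> w < 1/2 \<Longrightarrow>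
      ((\<lambda>p. G2 (fst p) (snd p)) has_derivative (\<lambda>h. G12 t w * fst h + G22 t w * snd h)) (at (t, w))"
    and pos: "\<And>t w. 0 \<le> t \<Longrightarrow> t < 1/2 \<Longrightarrow> 0 < w \<Longrightarrow> w < 1/2 \<Longrightarrow>
      0 < G1 t w \<and> 0 < G2 t w \<and> 0 < G1 t w + 2 * t * G11 t w"
    and bounds: "\<And>t w. 0 \<le> t \<Longrightarrow> t < 1/2 \<Longrightarrow> 0 < w \<Longrightarrow> w < 1/2 \<Longrightarrow>
      c * w powr \<sigma> \<le> G t w \<and> G t w \<le> C * w powr \<sigma>"
    and eq: "\<And>t w. 0 \<le> t \<Longrightarrow> t < 1/2 \<Longrightarrow> 0 < w \<Longrightarrow> w < 1/2 \<Longrightarrow>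
      G1 t w ^ (card K - 1) * G2 t w ^ (card (- K) - 1) *
        ((G1 t w + 2 * t * G11 t w) * (G2 t w + 2 * w * G22 t w) - 4 * t * w * (G12 t w)\<^sup>2)
      = G t w powr q"
begin

definition P :: "real ^ 'n \<Rightarrow> real ^ 'n" where "P x = (\<chi> i. if i \<in> K then x $ i else 0)"
definition Q :: "real ^ 'n \<Rightarrow> real ^ 'n" where "Q x = (\<chi> i. if i \<in> K then 0 else x $ i)"
definition T :: "real ^ 'n \<Rightarrow> real" where "T x = (P x \<bullet> P x) / 2"
definition W :: "real ^ 'n \<Rightarrow> real" where "W x = (Q x \<bullet> Q x) / 2"
text \<open>The profile is controlled for w > 0 only, so the value on the subspace is
  prescribed.\<close>

definition v :: "real ^ 'n \<Rightarrow> real" where "v x = (if Q x = 0 then 0 else G (T x) (W x))"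
definition grad :: "real ^ 'n \<Rightarrow> real ^ 'n" where
  "grad x = G1 (T x) (W x) *\<^sub>R P x + G2 (T x) (W x) *\<^sub>R Q x"
definition hess :: "real ^ 'n \<Rightarrow> real ^ 'n \<Rightarrow> real ^ 'n" where
  "hess x h = G1 (T x) (W x) *\<^sub>R P h + G2 (T x) (W x) *\<^sub>R Q h
    + (G11 (T x) (W x) * (P x \<bullet> h) + G12 (T x) (W x) * (Q x \<bullet> h)) *\<^sub>R P x
    + (G12 (T x) (W x) * (P x \<bullet> h) + G22 (T x) (W x) * (Q x \<bullet> h)) *\<^sub>R Q x"

lemma c_le_C: "c \<le> C"
proof -
  have "c * (1/4) powr \<sigma> \<le> C * (1/4) powr \<sigma>" using bounds[of 0 "1/4"] by linarith
  then show ?thesis by simp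
qed

lemma PQ: "P x + Q x = x" by (simp add: P_def Q_def vec_eq_iff)
lemma bl[bounded_linear]: "bounded_linear P" "bounded_linear Q"
  unfolding P_def Q_def
  by (auto intro!: linear_conv_bounded_linear[THEN iffD1] linearI simp: vec_eq_iff)
lemma PQ_orth: "P x \<bullet> Q y = 0" "Q y \<bullet> P x = 0"
  by (auto simp: P_def Q_def inner_vec_def intro!: sum.neutral)
lemma inner_P: "P x \<bullet> y = P x \<bullet> P y" and inner_Q: "Q x \<bullet> y = Q x \<bullet> Q y"
  using PQ[of y] PQ_orth by (metis add.right_neutral inner_add_right, metis add.left_neutral inner_add_right)

lemma W_pos_iff: "0 < W x \<longleftrightarrow> Q x \<noteq> 0" by (simp add: W_def)
lemma W_nonneg: "0 \<le> W x" and T_nonneg: "0 \<le> T x" by (simp_all add: W_def T_def)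

lemma TW_ball:
  assumes "x \<in> ball 0 1"
  shows "T x < 1/2" "W x < 1/2"
proof -
  have "x \<bullet> x = (P x + Q x) \<bullet> (P x + Q x)" by (simp only: PQ)
  also have "\<dots> = 2 * T x + 2 * W x" by (simp add: inner_add_left inner_add_right PQ_orth T_def W_def)
  finally have "2 * T x + 2 * W x = (norm x)\<^sup>2" by (simp add: power2_norm_eq_inner)
  also have "\<dots> < 1" using assms by (simp add: power_less_one_iff abs_square_less_1)
  finally show "T x < 1/2" "W x < 1/2" using W_nonneg[of x] T_nonneg[of x] by linarith+
qed

lemma TW:
  assumes "x \<in> ball 0 1" "Q x \<noteq> 0"
  shows "0 \<le> T x" "T x < 1/2" "0 < W x" "W x < 1/2"
  using TW_ball[OF assms(1)] T_nonneg assms(2) by (simp_all add: W_pos_iff)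

lemma dT: "(T has_derivative (\<lambda>h. P x \<bullet> h)) (at x)"
proof -
  have "((\<lambda>x. (P x \<bullet> P x) / 2) has_derivative (\<lambda>h. (P x \<bullet> P h + P h \<bullet> P x) / 2)) (at x)"
    by (auto intro!: derivative_eq_intros bounded_linear_imp_has_derivative bl)
  moreover have "(P x \<bullet> P h + P h \<bullet> P x) / 2 = P x \<bullet> h" for h
    by (simp add: inner_P[of x h] inner_commute[of "P h"])
  ultimately show ?thesis by (simp add: T_def[abs_def])
qed
lemma dW: "(W has_derivative (\<lambda>h. Q x \<bullet> h)) (at x)"
proof -
  have "((\<lambda>x. (Q x \<bullet> Q x) / 2) has_derivative (\<lambda>h. (Q x \<bullet> Q h + Q h \<bullet> Q x) / 2)) (at x)"
    by (auto intro!: derivative_eq_intros bounded_linear_imp_has_derivative bl)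
  moreover have "(Q x \<bullet> Q h + Q h \<bullet> Q x) / 2 = Q x \<bullet> h" for h
    by (simp add: inner_Q[of x h] inner_commute[of "Q h"])
  ultimately show ?thesis by (simp add: W_def[abs_def])
qed

lemma dTW:
  assumes "((\<lambda>p. F (fst p) (snd p)) has_derivative (\<lambda>h. a * fst h + b * snd h)) (at (T x, W x))"
  shows "((\<lambda>x. F (T x) (W x)) has_derivative (\<lambda>h. a * (P x \<bullet> h) + b * (Q x \<bullet> h))) (at x)"
  using has_derivative_compose[OF has_derivative_Pair[OF dT dW] assms] by simp

lemma open_nz: "open {x. Q x \<noteq> 0}"
  by (intro open_Collect_neq linear_continuous_on bl continuous_on_const)

lemma v_has_derivative:
  assumes "x \<in> ball 0 1" "Q x \<noteq> 0"
  shows "(v has_derivative (\<lambda>h. grad x \<bullet> h)) (at x)"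
proof -
  have "((\<lambda>x. G (T x) (W x)) has_derivative (\<lambda>h. grad x \<bullet> h)) (at x)"
    using dTW[of G, OF dG[OF TW[OF assms]]] by (simp add: grad_def inner_add_left)
  then show ?thesis
    by (rule has_derivative_transform_within_open[OF _ open_nz]) (use assms in \<open>auto simp: v_def\<close>)
qed

lemma grad_has_derivative:
  assumes "x \<in> ball 0 1" "Q x \<noteq> 0"
  shows "(grad has_derivative hess x) (at x)"
  unfolding grad_def[abs_def] hess_def[abs_def]
  by (rule has_derivative_eq_rhs, (rule derivative_intros dTW[OF dG1[OF TW[OF assms]]]
        dTW[OF dG2[OF TW[OF assms]]] bounded_linear_imp_has_derivative bl)+)
     (auto simp: algebra_simps)

lemma v_nonneg: "x \<in> ball 0 1 \<Longrightarrow> 0 \<le> v x"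
  and v_pos: "x \<in> ball 0 1 \<Longrightarrow> Q x \<noteq> 0 \<Longrightarrow> 0 < v x"
  and v_le: "x \<in> ball 0 1 \<Longrightarrow> v x \<le> C * W x powr \<sigma>"
  and v_ge: "x \<in> ball 0 1 \<Longrightarrow> c * W x powr \<sigma> \<le> v x"
proof -
  have 1: "0 < c * W x powr \<sigma>" "c * W x powr \<sigma> \<le> v x" "v x \<le> C * W x powr \<sigma>"
    if "x \<in> ball 0 1" "Q x \<noteq> 0" for x
    using bounds[OF TW[OF that]] TW(3)[OF that] c that by (auto simp: v_def)
  have 2: "W x = 0" "v x = 0" if "Q x = 0" for x
    using that by (auto simp: W_def v_def)
  show "x \<in> ball 0 1 \<Longrightarrow> 0 \<le> v x" "x \<in> ball 0 1 \<Longrightarrow> Q x \<noteq> 0 \<Longrightarrow> 0 < v x"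
    "x \<in> ball 0 1 \<Longrightarrow> v x \<le> C * W x powr \<sigma>" "x \<in> ball 0 1 \<Longrightarrow> c * W x powr \<sigma> \<le> v x"
    using 1[of x] 2[of x] by (cases "Q x = 0"; force)+
qed

text \<open>Near the subspace v is squeezed between 0 and C w^\<sigma>. Continuity there is what
  allows the mean value theorem on segments that end on the subspace.\<close>

lemma continuous_on_v: "continuous_on (ball 0 1) v"
proof (rule continuous_at_imp_continuous_on, rule ballI)
  fix x :: "real ^ 'n" assume x: "x \<in> ball 0 1"
  show "isCont v x"
  proof (cases "Q x = 0")
    case False
    then show ?thesis using v_has_derivative[OF x] has_derivative_continuous by blast
  next
    case True
    have "isCont W x" using dW has_derivative_continuous by blast
    then have "(W \<longlongrightarrow> W x) (at x)" by (simp add: isCont_def)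
    then have "((\<lambda>y. C * W y powr \<sigma>) \<longlongrightarrow> C * W x powr \<sigma>) (at x)"
      using \<sigma> by (intro tendsto_intros tendsto_powr') (auto simp: W_nonneg)
    then have lim: "((\<lambda>y. C * W y powr \<sigma>) \<longlongrightarrow> 0) (at x)" using True by (simp add: W_def)
    have "eventually (\<lambda>y. y \<in> ball 0 1) (at x)"
      using x by (intro eventually_at_in_open') auto
    then have "eventually (\<lambda>y. norm (v y) \<le> C * W y powr \<sigma>) (at x)"
      by eventually_elim (use v_nonneg v_le in auto)
    moreover have "v x = 0" using True by (simp add: v_def)
    ultimately show ?thesis using Lim_null_comparison[OF _ lim, of v] by (simp add: isCont_def)
  qed
qed

lemma hess_pos:
  assumes "x \<in> ball 0 1" "Q x \<noteq> 0" "h \<noteq> 0"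
  shows "0 < hess x h \<bullet> h"
proof -
  note tw = TW[OF assms(1,2)]
  let ?a = "G1 (T x) (W x)" and ?b = "G2 (T x) (W x)"
  have ps: "0 < ?a" "0 < ?b" "0 < ?a + 2 * T x * G11 (T x) (W x)" using pos[OF tw] by auto
  have "0 < G (T x) (W x)" using v_pos[OF assms(1,2)] assms(2) by (simp add: v_def)
  then have "0 < G (T x) (W x) powr q" by simp
  \<comment> \<open>The right-hand side of \<open>eq\<close> is positive, and so are the powers of
    G1 and G2, hence so is the remaining factor.\<close>
  then have D: "0 < (?a + 2 * T x * G11 (T x) (W x)) * (?b + 2 * W x * G22 (T x) (W x)) - 4 * T x * W x * (G12 (T x) (W x))\<^sup>2"
    unfolding eq[OF tw, symmetric] by (rule zero_less_mult_pos) (use ps in simp)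
  have "P h \<noteq> 0 \<or> Q h \<noteq> 0" using assms(3) PQ[of h] by auto
  then have UV: "0 < P h \<bullet> P h + Q h \<bullet> Q h"
    by (auto intro: add_pos_nonneg add_nonneg_pos)
  have CS: "(P x \<bullet> h)\<^sup>2 \<le> 2 * T x * (P h \<bullet> P h)" "(Q x \<bullet> h)\<^sup>2 \<le> 2 * W x * (Q h \<bullet> Q h)"
    using Cauchy_Schwarz_ineq[of "P x" "P h"] Cauchy_Schwarz_ineq[of "Q x" "Q h"]
    by (simp_all add: T_def W_def inner_P[of x h] inner_Q[of x h])
  have "hess x h \<bullet> h = ?a * (P h \<bullet> P h) + ?b * (Q h \<bullet> Q h) + G11 (T x) (W x) * (P x \<bullet> h)\<^sup>2
     + 2 * G12 (T x) (W x) * (P x \<bullet> h) * (Q x \<bullet> h) + G22 (T x) (W x) * (Q x \<bullet> h)\<^sup>2"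
    by (simp add: hess_def inner_add_left inner_P[of h h] inner_Q[of h h] power2_eq_square algebra_simps)
  also have "\<dots> > 0"
    by (rule pos_quadratic_form[OF ps(1,2) tw(1,3) _ _ UV CS ps(3) D]) auto
  finally show ?thesis .
qed

text \<open>Extracting from row i the factor G1 or G2, according to whether i lies in K, leaves the
  identity plus a matrix of rank at most two with covectors P x and Q x.\<close>

lemma matrix_hess_det:
  assumes "x \<in> ball 0 1" "Q x \<noteq> 0"
  shows "det (matrix (hess x)) = v x powr q"
proof -
  note tw = TW[OF assms]
  define a b \<alpha> \<beta> \<gamma> where "a = G1 (T x) (W x)" "b = G2 (T x) (W x)"
    "\<alpha> = G11 (T x) (W x)" "\<beta> = G12 (T x) (W x)" "\<gamma> = G22 (T x) (W x)"
  note defs = this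
  have ps: "0 < a" "0 < b" "0 < a + 2 * T x * \<alpha>" using pos[OF tw] by (auto simp: defs)
  define d where "d i = (if i \<in> K then a else b)" for i
  define u u' where "u = (\<alpha> / a) *\<^sub>R P x + (\<beta> / b) *\<^sub>R Q x" and "u' = (\<beta> / a) *\<^sub>R P x + (\<gamma> / b) *\<^sub>R Q x"
  have "matrix (hess x) = (\<chi> i. d i *s (\<chi> j. (if i = j then 1 else 0) + u $ i * P x $ j + u' $ i * Q x $ j))"
  proof -
    have "P x \<bullet> axis j 1 = P x $ j" "Q x \<bullet> axis j 1 = Q x $ j" for j by (simp_all add: inner_axis)
    moreover have "a * P (axis j 1) $ i + b * Q (axis j 1) $ i = d i * (if i = j then 1 else 0)" for i j
      by (auto simp: P_def Q_def d_def axis_def)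
    moreover have "(\<alpha> * s + \<beta> * r) * P x $ i + (\<beta> * s + \<gamma> * r) * Q x $ i = d i * (u $ i * s + u' $ i * r)" for i s r
      using ps(1,2) by (auto simp: P_def Q_def d_def u_def u'_def field_simps)
    ultimately show ?thesis
      by (simp add: matrix_def hess_def defs[symmetric] vec_eq_iff distrib_left add.assoc del: of_nat_Suc)
  qed
  then have "det (matrix (hess x)) = (\<Prod>i\<in>UNIV. d i) *
     det (\<chi> i j. (if i = j then 1 else 0) + u $ i * P x $ j + u' $ i * Q x $ j)"
    by (simp only: det_rows_mul)
  also have "(\<Prod>i\<in>UNIV. d i) = a ^ card K * b ^ card (- K)"
    using prod.union_disjoint[of K "- K" d] by (simp add: Compl_partition d_def)
  also have "det (\<chi> i j. (if i = j then 1 else 0) + u $ i * P x $ j + u' $ i * Q x $ j) =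
     (1 + u \<bullet> P x) * (1 + u' \<bullet> Q x) - (P x \<bullet> u') * (Q x \<bullet> u)"
  proof (rule det_mat_plus_rank2)
    have "1 + u \<bullet> P x = (a + 2 * T x * \<alpha>) / a"
      using ps by (simp add: u_def inner_add_left PQ_orth T_def field_simps)
    then show "1 + u \<bullet> P x \<noteq> 0" using ps by simp
  qed
  also have "\<dots> = ((a + 2 * T x * \<alpha>) * (b + 2 * W x * \<gamma>) - 4 * T x * W x * \<beta>\<^sup>2) / (a * b)"
    using ps by (simp add: u_def u'_def inner_add_left inner_add_right PQ_orth T_def W_def field_simps power2_eq_square)
  also have "a ^ card K * b ^ card (- K) * \<dots> = a ^ (card K - 1) * b ^ (card (- K) - 1) *
     ((a + 2 * T x * \<alpha>) * (b + 2 * W x * \<gamma>) - 4 * T x * W x * \<beta>\<^sup>2)"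
  proof -
    \<comment> \<open>Positivity makes the truncated exponents card K - 1 and card (- K) - 1 genuine
      differences.\<close>
    have "card K > 0" "card (- K) > 0" using K by (simp_all add: card_gt_0_iff)
    then have "a ^ card K = a * a ^ (card K - 1)" "b ^ card (- K) = b * b ^ (card (- K) - 1)"
      by (metis power_eq_if not_gr_zero)+
    then show ?thesis using ps by simp
  qed
  also have "\<dots> = v x powr q" using eq[OF tw] assms by (simp add: defs v_def)
  finally show ?thesis .
qed

lemma Q_segment: "Q (x + \<tau> *\<^sub>R (z - x)) = (1 - \<tau>) *\<^sub>R Q x + \<tau> *\<^sub>R Q z"
  by (simp add: Q_def vec_eq_iff algebra_simps)

lemma segment_ball:
  fixes x z :: "real ^ 'n"
  assumes "x \<in> ball 0 1" "z \<in> ball 0 1" "0 \<le> \<tau>" "\<tau> \<le> 1"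
  shows "x + \<tau> *\<^sub>R (z - x) \<in> ball 0 1"
proof -
  have "x + \<tau> *\<^sub>R (z - x) = (1 - \<tau>) *\<^sub>R x + \<tau> *\<^sub>R z" by (simp add: algebra_simps)
  also have "\<dots> \<in> ball 0 1" using convexD[OF convex_ball assms(1,2), of "1 - \<tau>" \<tau>] assms by simp
  finally show ?thesis .
qed

lemma supporting_aux:
  assumes x: "x \<in> ball 0 1" and z: "z \<in> ball 0 1" "z \<noteq> x"
    and nz: "\<And>\<tau>. 0 \<le> \<tau> \<Longrightarrow> \<tau> < 1 \<Longrightarrow> Q (x + \<tau> *\<^sub>R (z - x)) \<noteq> 0"
  shows "v x + grad x \<bullet> (z - x) < v z"
proof -
  define \<gamma> where "\<gamma> \<tau> = x + \<tau> *\<^sub>R (z - x)" for \<tau>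
  have d\<gamma>: "(\<gamma> has_derivative (\<lambda>s. s *\<^sub>R (z - x))) (at \<tau>)" for \<tau>
    unfolding \<gamma>_def by (auto intro!: derivative_eq_intros)
  have ball: "\<gamma> \<tau> \<in> ball 0 1" if "0 \<le> \<tau>" "\<tau> \<le> 1" for \<tau>
    unfolding \<gamma>_def by (rule segment_ball[OF x z(1) that])
  have d1: "((\<lambda>\<tau>. v (\<gamma> \<tau>)) has_real_derivative grad (\<gamma> \<tau>) \<bullet> (z - x)) (at \<tau>)" if "0 \<le> \<tau>" "\<tau> < 1" for \<tau>
    using has_derivative_compose[OF d\<gamma> v_has_derivative[OF ball[of \<tau>]]] nz[OF that] that
    by (simp add: has_field_derivative_def \<gamma>_def mult_commute_abs)
  have d2: "((\<lambda>\<tau>. grad (\<gamma> \<tau>) \<bullet> (z - x)) has_real_derivative hess (\<gamma> \<tau>) (z - x) \<bullet> (z - x)) (at \<tau>)"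
    if "0 \<le> \<tau>" "\<tau> < 1" for \<tau>
  proof -
    have g: "(grad has_derivative hess (\<gamma> \<tau>)) (at (\<gamma> \<tau>))"
      using nz[OF that] ball[of \<tau>] that by (intro grad_has_derivative) (auto simp: \<gamma>_def)
    then interpret bounded_linear "hess (\<gamma> \<tau>)" by (rule has_derivative_bounded_linear)
    show ?thesis using has_derivative_inner_left[OF has_derivative_compose[OF d\<gamma> g], of "z - x"]
      by (simp add: has_field_derivative_def scaleR mult_commute_abs)
  qed
  have "continuous_on {0..1} \<gamma>" unfolding \<gamma>_def by (intro continuous_intros)
  then have cont: "continuous_on {0..1} (\<lambda>\<tau>. v (\<gamma> \<tau>))"
    by (rule continuous_on_compose2[OF continuous_on_v]) (use ball in auto)
  obtain \<xi> l where \<xi>: "0 < \<xi>" "\<xi> < 1" "((\<lambda>\<tau>. v (\<gamma> \<tau>)) has_real_derivative l) (at \<xi>)" "v (\<gamma> 1) - v (\<gamma> 0) = l"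
  proof -
    have "(\<lambda>\<tau>. v (\<gamma> \<tau>)) differentiable (at \<tau>)" if "0 < \<tau>" "\<tau> < 1" for \<tau>
      using d1[of \<tau>] that unfolding real_differentiable_def by (meson less_imp_le)
    from MVT[OF zero_less_one cont this] show ?thesis using that by auto
  qed
  then have l: "l = grad (\<gamma> \<xi>) \<bullet> (z - x)" using d1[of \<xi>] DERIV_unique by auto
  obtain \<eta> where \<eta>: "0 < \<eta>" "\<eta> < \<xi>" "grad (\<gamma> \<xi>) \<bullet> (z - x) - grad (\<gamma> 0) \<bullet> (z - x) = (\<xi> - 0) * (hess (\<gamma> \<eta>) (z - x) \<bullet> (z - x))"
  proof -
    have "((\<lambda>\<tau>. grad (\<gamma> \<tau>) \<bullet> (z - x)) has_real_derivative hess (\<gamma> \<tau>) (z - x) \<bullet> (z - x)) (at \<tau>)"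
      if "0 \<le> \<tau>" "\<tau> \<le> \<xi>" for \<tau> using d2[of \<tau>] that \<xi>(2) by auto
    from MVT2[OF \<xi>(1) this] show ?thesis using that by blast
  qed
  have "0 < hess (\<gamma> \<eta>) (z - x) \<bullet> (z - x)"
    using \<eta> \<xi> nz[of \<eta>] z ball[of \<eta>] by (intro hess_pos) (auto simp: \<gamma>_def)
  then have "0 < (\<xi> - 0) * (hess (\<gamma> \<eta>) (z - x) \<bullet> (z - x))" using \<xi> by simp
  then show ?thesis using \<eta>(3) l \<xi>(4) by (simp add: \<gamma>_def)
qed

text \<open>If the segment meets the subspace at y, the tangent affine function is negative at y
  because v y = 0. It is nonnegative at x, hence negative at z as well, where v is
  nonnegative.\<close>

lemma supporting:
  assumes x: "x \<in> ball 0 1" "Q x \<noteq> 0" and z: "z \<in> ball 0 1" "z \<noteq> x"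
  shows "v x + grad x \<bullet> (z - x) < v z"
proof (cases "\<exists>\<tau>. 0 \<le> \<tau> \<and> \<tau> < 1 \<and> Q (x + \<tau> *\<^sub>R (z - x)) = 0")
  case False
  then show ?thesis using supporting_aux[OF x(1) z] by auto
next
  case True
  then obtain \<tau> where \<tau>: "0 \<le> \<tau>" "\<tau> < 1" "Q (x + \<tau> *\<^sub>R (z - x)) = 0" by auto
  then have "\<tau> > 0" using x(2) by (cases "\<tau> = 0") auto
  define y where "y = x + \<tau> *\<^sub>R (z - x)"
  have y: "y \<in> ball 0 1" unfolding y_def using segment_ball[OF x(1) z(1)] \<tau> by simp
  have yx: "y - x = \<tau> *\<^sub>R (z - x)" by (simp add: y_def)
  have "y \<noteq> x" using \<open>\<tau> > 0\<close> z yx by auto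
  have "Q y = 0" using \<tau> by (simp add: y_def)
  have "v x + grad x \<bullet> (y - x) < v y"
  proof (rule supporting_aux[OF x(1) y \<open>y \<noteq> x\<close>])
    fix s :: real assume "0 \<le> s" "s < 1"
    then show "Q (x + s *\<^sub>R (y - x)) \<noteq> 0" using x(2) \<open>Q y = 0\<close> by (simp add: Q_segment)
  qed
  then have "v x + \<tau> * (grad x \<bullet> (z - x)) < 0" using \<open>Q y = 0\<close> by (simp add: yx v_def)
  moreover have "\<tau> * v x \<le> v x" using \<tau> v_nonneg[OF x(1)] by (simp add: mult_left_le_one_le)
  ultimately have "\<tau> * (v x + grad x \<bullet> (z - x)) < 0" by (simp add: algebra_simps)
  then have "v x + grad x \<bullet> (z - x) < 0" using \<open>\<tau> > 0\<close> by (simp add: mult_less_0_iff)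
  then show ?thesis using v_nonneg[OF z(1)] by simp
qed

text \<open>For a subgradient p the function v y - p . y of y is minimal at the interior point x, so
  its derivative there vanishes.\<close>

lemma subdifferential_v:
  assumes x: "x \<in> ball 0 1" "Q x \<noteq> 0"
  shows "subdifferential (ball 0 1) v x = {grad x}"
proof
  show "{grad x} \<subseteq> subdifferential (ball 0 1) v x"
    using supporting[OF x] by (auto simp: subdifferential_def) (metis diff_self inner_zero_right add.right_neutral less_imp_le order_refl)
  show "subdifferential (ball 0 1) v x \<subseteq> {grad x}"
  proof
    fix p assume "p \<in> subdifferential (ball 0 1) v x"
    then have p: "v x + p \<bullet> (y - x) \<le> v y" if "y \<in> ball 0 1" for y using that by (auto simp: subdifferential_def)
    have "((\<lambda>y. v y - p \<bullet> y) has_derivative (\<lambda>h. grad x \<bullet> h - p \<bullet> h)) (at x)"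
      by (intro derivative_intros v_has_derivative x)
    then have "(\<lambda>h. grad x \<bullet> h - p \<bullet> h) = (\<lambda>h. 0)"
    proof (rule differential_zero_maxmin[OF x(1) open_ball])
      show "(\<forall>y\<in>ball 0 1. v y - p \<bullet> y \<le> v x - p \<bullet> x) \<or> (\<forall>y\<in>ball 0 1. v x - p \<bullet> x \<le> v y - p \<bullet> y)"
        using p by (force simp: inner_diff_right)
    qed
    then have "(grad x - p) \<bullet> (grad x - p) = 0" by (metis inner_diff_left)
    then show "p \<in> {grad x}" by simp
  qed
qed

text \<open>v vanishes near x on the line through x in direction i, so the subgradient inequality
  bounds both p $ i and - p $ i by 0. As K is nonempty, all subgradients over the zero set lie in
  one hyperplane, which is null.\<close>

lemma subdifferential_zero_set:
  assumes x: "x \<in> ball 0 1" "Q x = 0" and p: "p \<in> subdifferential (ball 0 1) v x" and i: "i \<in> K"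
  shows "p $ i = 0"
proof -
  obtain e where e: "e > 0" "ball x e \<subseteq> ball 0 1" using x openE[OF open_ball] by metis
  have le: "s * p $ i \<le> 0" if "\<bar>s\<bar> < e" for s
  proof -
    let ?y = "x + s *\<^sub>R axis i 1"
    have "Q (axis i 1) = 0" using i by (auto simp: Q_def axis_def vec_eq_iff)
    then have "Q ?y = 0" using x(2) linear_add linear_scale bl(2)[THEN bounded_linear.linear] by (simp add: linear_add linear_scale)
    moreover have "?y \<in> ball 0 1" using e(2) that by (intro subsetD[OF e(2)]) (simp add: dist_norm)
    ultimately have "v x + p \<bullet> (s *\<^sub>R axis i 1) \<le> 0"
      using p by (force simp: subdifferential_def v_def)
    then show ?thesis using x(2) by (simp add: v_def inner_axis)
  qed
  show ?thesis using le[of "e/2"] le[of "-e/2"] e(1) by (auto simp: mult_le_0_iff zero_le_mult_iff)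
qed

text \<open>Every point has a supporting affine function: the tangent one off the subspace, and 0 on
  it because v is nonnegative.\<close>

lemma convex_on_v: "convex_on (ball 0 1) v"
proof (rule convex_onI)
  fix \<tau> :: real and x y :: "real ^ 'n"
  assume \<tau>: "0 < \<tau>" "\<tau> < 1" and xy: "x \<in> ball 0 1" "y \<in> ball 0 1"
  define z where "z = (1 - \<tau>) *\<^sub>R x + \<tau> *\<^sub>R y"
  have z: "z \<in> ball 0 1" using convexD[OF convex_ball xy, of "1 - \<tau>" \<tau>] \<tau> by (simp add: z_def)
  have "\<exists>p. \<forall>y\<in>ball 0 1. v z + p \<bullet> (y - z) \<le> v y"
  proof (cases "Q z = 0")
    case True
    then show ?thesis using v_nonneg by (intro exI[of _ 0]) (simp add: v_def)
  next
    case False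
    then show ?thesis using subdifferential_v[OF z] by (auto simp: subdifferential_def)
  qed
  then obtain p where p: "\<And>y. y \<in> ball 0 1 \<Longrightarrow> v z + p \<bullet> (y - z) \<le> v y" by blast
  have "v z = (1 - \<tau>) * (v z + p \<bullet> (x - z)) + \<tau> * (v z + p \<bullet> (y - z))"
    by (simp add: z_def inner_diff_right inner_add_right algebra_simps)
  also have "\<dots> \<le> (1 - \<tau>) * v x + \<tau> * v y"
    using \<tau> p xy by (intro add_mono mult_left_mono) auto
  finally show "v ((1 - \<tau>) *\<^sub>R x + \<tau> *\<^sub>R y) \<le> (1 - \<tau>) * v x + \<tau> * v y" by (simp add: z_def)
qed simp

text \<open>Two strict supporting inequalities with a common gradient add up to 0 < 0.\<close>

lemma inj_grad: "inj_on grad (ball 0 1 \<inter> {x. Q x \<noteq> 0})"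
proof (rule inj_onI, rule ccontr)
  fix x y assume xy: "x \<in> ball 0 1 \<inter> {x. Q x \<noteq> 0}" "y \<in> ball 0 1 \<inter> {x. Q x \<noteq> 0}" "grad x = grad y" "x \<noteq> y"
  then have "v x + grad x \<bullet> (y - x) < v y" "v y + grad x \<bullet> (x - y) < v x"
    using supporting[of x y] supporting[of y x] by auto
  then show False by (simp add: inner_diff_right)
qed

text \<open>A splits into its part off the subspace, where the change of variables turns the
  Jacobian determinant into v^q, and its part on the subspace, which contributes the null set
  \<open>N\<close> on the left and, by the indicator, nothing on the right.\<close>

lemma aleksandrov_v:
  "aleksandrov_solution (ball 0 1) v (\<lambda>x. ennreal (v x powr q) * indicator {x. v x > 0} x)"
  unfolding aleksandrov_solution_def
proof (intro conjI ballI impI)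
  show "convex_on (ball 0 1) v" by (rule convex_on_v)
  fix A :: "(real ^ 'n) set" assume A: "A \<in> sets borel" "A \<subseteq> ball 0 1"
  define B where "B = A \<inter> {x. Q x \<noteq> 0}"
  define N where "N = (\<Union>x\<in>A - B. subdifferential (ball 0 1) v x)"
  have B: "B \<subseteq> ball 0 1" "\<And>x. x \<in> B \<Longrightarrow> Q x \<noteq> 0" using A by (auto simp: B_def)
  have Bs: "B \<in> sets borel" using A open_nz by (auto simp: B_def)
  obtain i where "i \<in> K" using K by auto
  have "N \<subseteq> {p. p $ i = 0}"
    using subdifferential_zero_set \<open>i \<in> K\<close> A(2) by (auto simp: N_def B_def)
  then have "negligible N" using negligible_standard_hyperplane_cart negligible_subset by blast
  then have N: "N \<in> null_sets lebesgue" by (simp add: negligible_iff_null_sets)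
  have "A = B \<union> (A - B)" by (auto simp: B_def)
  then have "gradient_image (ball 0 1) v A = (\<Union>x\<in>B. subdifferential (ball 0 1) v x) \<union> N"
    unfolding gradient_image_def N_def by (metis UN_Un)
  also have "(\<Union>x\<in>B. subdifferential (ball 0 1) v x) = grad ` B"
    using subdifferential_v B by (auto simp: subset_iff)
  finally have im: "gradient_image (ball 0 1) v A = grad ` B \<union> N" .
  have detv: "det (matrix (hess x)) = v x powr q" if "x \<in> B" for x
    using matrix_hess_det B that by auto
  have vp: "0 < v x" if "x \<in> B" for x using v_pos B that by auto
  have Bl: "B \<in> lmeasurable"
    using Bs B(1) bounded_ball bounded_subset by (intro bounded_set_imp_lmeasurable) auto
  have "continuous_on B (\<lambda>x. v x powr q)"
    by (intro continuous_intros continuous_on_subset[OF continuous_on_v B(1)]) (use vp in force)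
  then have "(\<lambda>x. v x powr q) \<in> borel_measurable (lebesgue_on B)"
    using Bs by (intro continuous_imp_measurable_on_sets_lebesgue) auto
  \<comment> \<open>As q >= 0, the bound on v bounds v^q on the bounded set \<open>B\<close>; this
    is the integrability that the change of variables demands.\<close>
  then have "(\<lambda>x. v x powr q) absolutely_integrable_on B"
  proof (rule measurable_bounded_by_integrable_imp_absolutely_integrable)
    show "(\<lambda>x. (C * 1) powr q) integrable_on B" using Bl by (rule integrable_on_const)
    fix x assume x: "x \<in> B"
    have "C > 0" using c c_le_C by simp
    have "W x < 1/2" using TW_ball B x by (auto simp: subset_iff)
    then have "W x powr \<sigma> \<le> 1" using \<sigma> W_nonneg by (intro powr_le1) auto
    then have "C * W x powr \<sigma> \<le> C * 1" using \<open>C > 0\<close> by (intro mult_left_mono) auto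
    then have "v x \<le> C * 1" using v_le[of x] B(1) x by (meson order_trans subsetD)
    then show "norm (v x powr q) \<le> (C * 1) powr q" using vp[OF x] q by (auto intro!: powr_mono2)
  qed (use Bl in auto)
  then have int: "(\<lambda>x. det (matrix (hess x))) absolutely_integrable_on B"
    by (rule set_integrable_cong[THEN iffD1, rotated 3]) (auto simp: detv)
  have *: "grad ` B \<in> sets lebesgue \<and> emeasure lebesgue (grad ` B) = (\<integral>\<^sup>+x\<in>B. ennreal \<bar>det (matrix (hess x))\<bar> \<partial>lebesgue)"
  proof (rule emeasure_differentiable_image[OF _ _ _ int])
    show "(grad has_derivative hess x) (at x within B)" if "x \<in> B" for x
      by (rule has_derivative_at_withinI, rule grad_has_derivative) (use B that in blast)+
    show "inj_on grad B" using inj_grad by (rule inj_on_subset) (use B in auto)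
  qed (use Bl in auto)
  then show "gradient_image (ball 0 1) v A \<in> sets lebesgue"
    using N unfolding im by auto
  have "monge_ampere (ball 0 1) v A = emeasure lebesgue (grad ` B)"
    unfolding monge_ampere_def im using * N by (intro emeasure_Un_null_set) auto
  also have "\<dots> = (\<integral>\<^sup>+x\<in>B. ennreal \<bar>det (matrix (hess x))\<bar> \<partial>lebesgue)" using * by simp
  also have "\<dots> = (\<integral>\<^sup>+x\<in>A. (ennreal (v x powr q) * indicator {x. v x > 0} x) \<partial>lebesgue)"
  proof (rule nn_integral_cong)
    fix x
    show "ennreal \<bar>det (matrix (hess x))\<bar> * indicator B x = ennreal (v x powr q) * indicator {x. v x > 0} x * indicator A x"
      using vp[of x] detv[of x] by (cases "x \<in> B") (auto simp: B_def v_def split: split_indicator)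
  qed
  also have "\<dots> = (\<integral>\<^sup>+x\<in>A. (ennreal (v x powr q) * indicator {x. v x > 0} x) \<partial>lborel)"
    by (rule nn_integral_completion)
  finally show "monge_ampere (ball 0 1) v A =
    (\<integral>\<^sup>+x\<in>A. (ennreal (v x powr q) * indicator {x. v x > 0} x) \<partial>lborel)" .
qed

lemma coord_subspace_eq: "coord_subspace K = {x. Q x = 0}"
  by (auto simp: coord_subspace_def Q_def vec_eq_iff)

text \<open>P x is a nearest point, and Q is a linear map of norm at most 1 that annihilates the
  subspace.\<close>

lemma infdist_coord_subspace: "infdist x (coord_subspace K) = norm (Q x)"
proof (rule antisym)
  have "Q (P x) = 0" by (simp add: P_def Q_def vec_eq_iff)
  then have "infdist x (coord_subspace K) \<le> dist x (P x)" by (intro infdist_le) (simp add: coord_subspace_eq)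
  also have "x - P x = Q x" using PQ[of x] by (metis add_diff_cancel_left')
  then have "dist x (P x) = norm (Q x)" by (simp add: dist_norm)
  finally show "infdist x (coord_subspace K) \<le> norm (Q x)" .
  have ne: "coord_subspace K \<noteq> {}" by (auto simp: coord_subspace_def intro!: exI[of _ 0])
  show "norm (Q x) \<le> infdist x (coord_subspace K)"
    unfolding infdist_notempty[OF ne]
  proof (rule cINF_greatest[OF ne])
    fix y assume "y \<in> coord_subspace K"
    then have "Q x = Q (x - y)" using linear_diff[OF bl(2)[THEN bounded_linear.linear], of x y] by (simp add: coord_subspace_eq)
    also have "norm \<dots> \<le> norm (x - y)"
      by (rule norm_le_componentwise_cart) (simp add: Q_def)
    finally show "norm (Q x) \<le> dist x y" by (simp add: dist_norm)
  qed
qed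

text \<open>w^\<sigma> is 2^(-\<sigma>) times the distance to the power 2\<sigma>; this is the
  source of \<sigma> = s/2.\<close>

lemma singular_solution:
  "has_singular_solution K q (2 * \<sigma>)"
  unfolding has_singular_solution_def
proof (intro exI[of _ v] conjI)
  show "\<forall>x\<in>ball 0 1. 0 \<le> v x" using v_nonneg by blast
  show "{x \<in> ball 0 1. v x = 0} = coord_subspace K \<inter> ball 0 1"
    using v_pos by (fastforce simp: coord_subspace_eq v_def)
  have W: "W x powr \<sigma> = (1/2) powr \<sigma> * infdist x (coord_subspace K) powr (2 * \<sigma>)" for x
  proof -
    have "W x = (1/2) * norm (Q x) powr 2" by (simp add: W_def powr_numeral power2_norm_eq_inner)
    then have "W x powr \<sigma> = (1/2) powr \<sigma> * (norm (Q x) powr 2) powr \<sigma>" by (simp only: powr_mult)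
    then show ?thesis by (simp only: powr_powr infdist_coord_subspace)
  qed
  show "\<exists>c C :: real. 0 < c \<and> 0 < C \<and>
      (\<forall>x\<in>ball 0 1.
         c * infdist x (coord_subspace K) powr (2 * \<sigma>) \<le> v x \<and>
         v x \<le> C * infdist x (coord_subspace K) powr (2 * \<sigma>))"
    using c c_le_C v_le v_ge
    by (intro exI[of _ "c * (1/2) powr \<sigma>"] exI[of _ "C * (1/2) powr \<sigma>"]) (auto simp: W mult.assoc)
qed (rule convex_on_v aleksandrov_v)+

end

subsection \<open>Profiles of the form \<open>A w^\<sigma> \<phi> (w^\<delta> Y(t))\<close>\<close>

text \<open>\<open>e\<close> is w G_w divided by A w^\<sigma>, \<open>e1\<close> is its derivative
  in \<tau>, and \<open>X\<close> is the radial entry G_t + 2 t G_tt divided by A w^(\<sigma> +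
  \<delta>). The last hypothesis is the Monge-Ampere equation with the powers of A and w collected;
  it is demanded only along \<tau> = w^\<delta> Y(t), which lets the caller trade t and w for
  \<tau>.\<close>

lemma separated_profile_solution:
  fixes K :: "'n::finite set" and q \<sigma> \<delta> A b :: real
    and \<phi> \<phi>1 \<phi>2 Y Y1 Y2 :: "real \<Rightarrow> real"
  defines "e \<equiv> \<lambda>\<tau>. \<sigma> * \<phi> \<tau> + \<delta> * \<tau> * \<phi>1 \<tau>"
    and "e1 \<equiv> \<lambda>\<tau>. (\<sigma> + \<delta>) * \<phi>1 \<tau> + \<delta> * \<tau> * \<phi>2 \<tau>"
    and "X \<equiv> \<lambda>t w \<tau>. \<phi>1 \<tau> * (Y1 t + 2 * t * Y2 t) + 2 * t * w powr \<delta> * \<phi>2 \<tau> * (Y1 t)\<^sup>2"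
  assumes K: "K \<noteq> {}" "- K \<noteq> {}" and q: "q \<ge> 0" and \<sigma>: "\<sigma> > 0" and \<delta>: "\<delta> \<ge> 0" and A: "A > 0"
    and Y: "\<And>t. 0 \<le> t \<Longrightarrow> t < 1/2 \<Longrightarrow> (Y has_real_derivative Y1 t) (at t)"
      "\<And>t. 0 \<le> t \<Longrightarrow> t < 1/2 \<Longrightarrow> (Y1 has_real_derivative Y2 t) (at t)"
      "\<And>t. 0 \<le> t \<Longrightarrow> t < 1/2 \<Longrightarrow> 0 \<le> Y t \<and> Y t \<le> b \<and> 0 < Y1 t"
    and \<phi>: "\<And>\<tau>. 0 \<le> \<tau> \<Longrightarrow> \<tau> \<le> b \<Longrightarrow> (\<phi> has_real_derivative \<phi>1 \<tau>) (at \<tau>)"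
      "\<And>\<tau>. 0 \<le> \<tau> \<Longrightarrow> \<tau> \<le> b \<Longrightarrow> (\<phi>1 has_real_derivative \<phi>2 \<tau>) (at \<tau>)"
      "\<And>\<tau>. 0 \<le> \<tau> \<Longrightarrow> \<tau> \<le> b \<Longrightarrow> 1/2 \<le> \<phi> \<tau> \<and> \<phi> \<tau> \<le> 2 \<and> 0 < \<phi>1 \<tau>"
    and X: "\<And>t w \<tau>. 0 \<le> t \<Longrightarrow> t < 1/2 \<Longrightarrow> 0 < w \<Longrightarrow> w < 1/2 \<Longrightarrow> 0 \<le> \<tau> \<Longrightarrow> \<tau> \<le> b \<Longrightarrow>
        \<tau> = w powr \<delta> * Y t \<Longrightarrow> 0 < X t w \<tau>"
    and eq: "\<And>t w \<tau>. 0 \<le> t \<Longrightarrow> t < 1/2 \<Longrightarrow> 0 < w \<Longrightarrow> w < 1/2 \<Longrightarrow> 0 \<le> \<tau> \<Longrightarrow> \<tau> \<le> b \<Longrightarrow>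
        \<tau> = w powr \<delta> * Y t \<Longrightarrow>
        A ^ (card K + card (- K)) * w powr (\<sigma> * (card K + card (- K)) + \<delta> * card K - card (- K))
          * (\<phi>1 \<tau> * Y1 t) ^ (card K - 1) * e \<tau> ^ (card (- K) - 1)
          * (X t w \<tau> * ((2 * \<sigma> - 1) * e \<tau> + 2 * \<delta> * \<tau> * e1 \<tau>) - 4 * t * w powr \<delta> * (e1 \<tau>)\<^sup>2 * (Y1 t)\<^sup>2)
        = A powr q * w powr (\<sigma> * q) * \<phi> \<tau> powr q"
  shows "has_singular_solution K q (2 * \<sigma>)"
proof -
  define \<tau> where "\<tau> t w = w powr \<delta> * Y t" for t w
  define G where "G t w = A * w powr \<sigma> * \<phi> (\<tau> t w)" for t w
  define G1 where "G1 t w = A * w powr \<sigma> * w powr \<delta> * \<phi>1 (\<tau> t w) * Y1 t" for t w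
  define G2 where "G2 t w = A * w powr \<sigma> / w * e (\<tau> t w)" for t w
  define G11 where "G11 t w = A * w powr \<sigma> * ((w powr \<delta>)\<^sup>2 * \<phi>2 (\<tau> t w) * (Y1 t)\<^sup>2 + w powr \<delta> * \<phi>1 (\<tau> t w) * Y2 t)" for t w
  define G12 where "G12 t w = A * w powr \<sigma> * w powr \<delta> / w * e1 (\<tau> t w) * Y1 t" for t w
  define G22 where "G22 t w = A * w powr \<sigma> / w\<^sup>2 * ((\<sigma> - 1) * e (\<tau> t w) + \<delta> * \<tau> t w * e1 (\<tau> t w))" for t w
  have \<tau>: "0 \<le> \<tau> t w" "\<tau> t w \<le> b" if "0 \<le> t" "t < 1/2" "0 < w" "w < 1/2" for t w
  proof -
    \<comment> \<open>Here \<delta> >= 0, and with it the upper bound on s, enters: the argument of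
      \<phi> never exceeds Y t, so [0, b] suffices as its domain.\<close>
    have "w powr \<delta> \<le> 1" using that \<delta> by (intro powr_le1) auto
    then have "w powr \<delta> * Y t \<le> 1 * Y t" using Y(3)[of t] that by (intro mult_right_mono) auto
    then show "0 \<le> \<tau> t w" "\<tau> t w \<le> b" using Y(3)[of t] that by (auto simp: \<tau>_def)
  qed
  have dpow: "((\<lambda>p :: real \<times> real. snd p powr r) has_derivative (\<lambda>h. (r * w powr r / w) * snd h)) (at (t, w))"
    if "w > 0" for t w r :: real
  proof -
    have "((\<lambda>x. x powr r) has_real_derivative r * w powr r / w) (at w)"
      using has_real_derivative_powr[OF that, of r] that by (simp add: powr_diff)
    then show ?thesis
      using has_derivative_compose[of snd snd "(t, w)" UNIV "\<lambda>x. x powr r" "\<lambda>h. r * w powr r / w * h"]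
      by (simp only: has_field_derivative_def snd_conv bounded_linear_imp_has_derivative[OF bounded_linear_snd])
  qed
  have dfst: "((\<lambda>p :: real \<times> real. f (fst p)) has_derivative (\<lambda>h. f' * fst h)) (at (t, w))"
    if "(f has_real_derivative f') (at t)" for f f' t and w :: real
    using has_derivative_compose[of fst fst "(t, w)" UNIV f "\<lambda>h. f' * h"] that
    by (simp add: has_field_derivative_def bounded_linear_imp_has_derivative bounded_linear_fst)
  have d\<tau>: "((\<lambda>p. \<tau> (fst p) (snd p)) has_derivative
     (\<lambda>h. w powr \<delta> * Y1 t * fst h + \<delta> * \<tau> t w / w * snd h)) (at (t, w))"
    if "0 \<le> t" "t < 1/2" "0 < w" for t w
    unfolding \<tau>_def
    by (rule has_derivative_eq_rhs, rule has_derivative_mult[OF dpow[OF that(3)] dfst[OF Y(1)[OF that(1,2)]]])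
       (use that in \<open>simp add: fun_eq_iff field_simps\<close>)
  have d\<tau>f: "((\<lambda>p. f (\<tau> (fst p) (snd p))) has_derivative
     (\<lambda>h. f' * (w powr \<delta> * Y1 t * fst h + \<delta> * \<tau> t w / w * snd h))) (at (t, w))"
    if "0 \<le> t" "t < 1/2" "0 < w" "(f has_real_derivative f') (at (\<tau> t w))" for f f' t w
    using has_derivative_compose[OF d\<tau>[OF that(1-3)], of f "\<lambda>h. f' * h"] that(4)
    by (simp add: has_field_derivative_def)
  have de: "(e has_real_derivative e1 \<tau>) (at \<tau>)" if "0 \<le> \<tau>" "\<tau> \<le> b" for \<tau>
    unfolding e_def e1_def using \<phi>(1,2)[OF that]
    by (auto intro!: derivative_eq_intros simp: algebra_simps)
  have epos: "0 < e \<tau>" if "0 \<le> \<tau>" "\<tau> \<le> b" for \<tau>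
    unfolding e_def using \<phi>(3)[OF that] that \<sigma> \<delta> by (intro add_pos_nonneg mult_pos_pos mult_nonneg_nonneg) auto
  interpret cylindrical_profile K q \<sigma> "A / 2" "2 * A" G G1 G2 G11 G12 G22
  proof
    show "K \<noteq> {}" "- K \<noteq> {}" "0 \<le> q" "0 < \<sigma>" "0 < A / 2" using K q \<sigma> A by auto
    fix t w :: real assume tw: "0 \<le> t" "t < 1/2" "0 < w" "w < 1/2"
    note ta = \<tau>[OF tw]
    show "((\<lambda>p. G (fst p) (snd p)) has_derivative (\<lambda>h. G1 t w * fst h + G2 t w * snd h)) (at (t, w))"
      unfolding G_def
      by (rule has_derivative_eq_rhs, (rule has_derivative_mult has_derivative_const dpow[OF tw(3)] d\<tau>f[OF tw(1-3) \<phi>(1)[OF ta]])+)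
         (use tw in \<open>simp add: fun_eq_iff G1_def G2_def e_def field_simps\<close>)
    show "((\<lambda>p. G1 (fst p) (snd p)) has_derivative (\<lambda>h. G11 t w * fst h + G12 t w * snd h)) (at (t, w))"
      unfolding G1_def
      by (rule has_derivative_eq_rhs, (rule has_derivative_mult has_derivative_const dpow[OF tw(3)]
            dfst[OF Y(2)[OF tw(1,2)]] d\<tau>f[OF tw(1-3) \<phi>(2)[OF ta]])+)
         (use tw in \<open>simp add: fun_eq_iff G11_def G12_def e1_def field_simps power2_eq_square\<close>)
    \<comment> \<open>Writing the quotient by w as a power lets the product rule work factor by
      factor; both forms agree on the open half plane w > 0.\<close>
    have "((\<lambda>p. A * snd p powr \<sigma> * snd p powr (-1) * e (\<tau> (fst p) (snd p))) has_derivative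
       (\<lambda>h. G12 t w * fst h + G22 t w * snd h)) (at (t, w))"
      by (rule has_derivative_eq_rhs, (rule has_derivative_mult has_derivative_const dpow[OF tw(3)]
            d\<tau>f[OF tw(1-3) de[OF ta]])+)
         (use tw in \<open>simp add: fun_eq_iff G22_def G12_def field_simps power2_eq_square powr_minus\<close>)
    then show "((\<lambda>p. G2 (fst p) (snd p)) has_derivative (\<lambda>h. G12 t w * fst h + G22 t w * snd h)) (at (t, w))"
    proof (rule has_derivative_transform_within_open)
      show "open (UNIV \<times> {0 :: real <..})" by (intro open_Times) auto
    qed (use tw in \<open>auto simp: G2_def powr_minus divide_simps\<close>)
    have G11: "G1 t w + 2 * t * G11 t w = A * w powr \<sigma> * w powr \<delta> * X t w (\<tau> t w)"
      by (simp add: G1_def G11_def X_def algebra_simps power2_eq_square)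
    show "0 < G1 t w \<and> 0 < G2 t w \<and> 0 < G1 t w + 2 * t * G11 t w"
      unfolding G11 using A tw \<phi>(3)[OF ta] Y(3)[OF tw(1,2)] epos[OF ta] X[OF tw ta \<tau>_def]
      by (simp add: G1_def G2_def)
    have "(1/2) * (A * w powr \<sigma>) \<le> \<phi> (\<tau> t w) * (A * w powr \<sigma>)" "\<phi> (\<tau> t w) * (A * w powr \<sigma>) \<le> 2 * (A * w powr \<sigma>)"
      using \<phi>(3)[OF ta] A by (intro mult_right_mono; simp)+
    then show "A / 2 * w powr \<sigma> \<le> G t w \<and> G t w \<le> 2 * A * w powr \<sigma>"
      by (simp add: G_def mult_ac)
    have G22: "G2 t w + 2 * w * G22 t w = A * w powr \<sigma> / w * ((2 * \<sigma> - 1) * e (\<tau> t w) + 2 * \<delta> * \<tau> t w * e1 (\<tau> t w))"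
      using tw by (simp add: G2_def G22_def field_simps power2_eq_square)
    define Z where "Z = X t w (\<tau> t w) * ((2 * \<sigma> - 1) * e (\<tau> t w) + 2 * \<delta> * \<tau> t w * e1 (\<tau> t w)) - 4 * t * w powr \<delta> * (e1 (\<tau> t w))\<^sup>2 * (Y1 t)\<^sup>2"
    define p d where "p = w powr \<sigma>" and "d = w powr \<delta>"
    obtain k m where km: "card K = Suc k" "card (- K) = Suc m"
      using K by (metis card_gt_0_iff finite gr0_implies_Suc)
    have "(G1 t w + 2 * t * G11 t w) * (G2 t w + 2 * w * G22 t w) - 4 * t * w * (G12 t w)\<^sup>2 = A\<^sup>2 * p\<^sup>2 * (d / w) * Z"
      unfolding G11 G22 G12_def Z_def p_def[symmetric] d_def[symmetric] using tw
      by (simp add: field_simps power2_eq_square)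
    then have "G1 t w ^ (card K - 1) * G2 t w ^ (card (- K) - 1) *
        ((G1 t w + 2 * t * G11 t w) * (G2 t w + 2 * w * G22 t w) - 4 * t * w * (G12 t w)\<^sup>2)
      = (A * p * d * (\<phi>1 (\<tau> t w) * Y1 t)) ^ k * (A * p / w * e (\<tau> t w)) ^ m * (A\<^sup>2 * p\<^sup>2 * (d / w) * Z)"
      by (simp add: km G1_def G2_def p_def d_def mult.assoc)
    also have "\<dots> = A ^ (card K + card (- K)) * (p ^ (card K + card (- K)) * d ^ card K / w ^ card (- K))
       * (\<phi>1 (\<tau> t w) * Y1 t) ^ k * e (\<tau> t w) ^ m * Z"
      using tw by (simp add: km power_mult_distrib power_divide power_add power2_eq_square field_simps)
    \<comment> \<open>Each of card K factors carries w^(\<sigma> + \<delta>), and each of card (- K)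
      factors carries w^(\<sigma> - 1).\<close>
    also have "p ^ (card K + card (- K)) * d ^ card K / w ^ card (- K) =
        w powr (\<sigma> * (card K + card (- K)) + \<delta> * card K - card (- K))"
      using tw by (simp add: p_def d_def powr_add powr_diff powr_realpow powr_power distrib_left power_add mult.commute)
    also have "A ^ (card K + card (- K)) * w powr (\<sigma> * (card K + card (- K)) + \<delta> * card K - card (- K))
       * (\<phi>1 (\<tau> t w) * Y1 t) ^ k * e (\<tau> t w) ^ m * Z = A powr q * w powr (\<sigma> * q) * \<phi> (\<tau> t w) powr q"
      using eq[OF tw ta \<tau>_def] by (simp add: km Z_def)
    also have "\<dots> = G t w powr q"
      using A tw \<phi>(3)[OF ta] by (simp add: G_def powr_mult powr_powr)
    finally show "G1 t w ^ (card K - 1) * G2 t w ^ (card (- K) - 1) *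
        ((G1 t w + 2 * t * G11 t w) * (G2 t w + 2 * w * G22 t w) - 4 * t * w * (G12 t w)\<^sup>2)
      = G t w powr q" .
  qed
  show ?thesis by (rule singular_solution)
qed

text \<open>An amplitude A scales the determinant by A^n and the right-hand side by A^q, so for q <
  n it can absorb any positive constant c.\<close>

lemma scaling_constant:
  fixes c q :: real and n :: nat
  assumes "c > 0" "q < n"
  obtains A :: real where "A > 0" "A ^ n * c = A powr q"
proof (rule that)
  define A where "A = c powr (- 1 / (n - q))"
  show "A > 0" using assms by (simp add: A_def)
  have "A powr (n - q) = c powr (- 1 / (n - q) * (n - q))" by (simp only: A_def powr_powr)
  also have "\<dots> = inverse c" using assms by (simp add: powr_minus)
  finally have "A powr (n - q) = inverse c" .
  then have "A powr n * c = A powr q" using \<open>A > 0\<close> assms by (simp add: powr_diff field_simps)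
  then show "A ^ n * c = A powr q" using \<open>A > 0\<close> by (simp add: powr_realpow)
qed

text \<open>Phase space of the ODEs: the middle coordinate is \<phi>, confined so that v is
  comparable to w^\<sigma>; the last one is a power of \<phi>', kept positive so that roots are
  smooth.\<close>

lemma open_slab: "open {p :: real \<times> real \<times> real. 1/2 < fst (snd p) \<and> fst (snd p) < 2 \<and> 0 < snd (snd p)}"
  by (intro open_Collect_conj open_Collect_less continuous_intros)

section \<open>The case s > 1\<close>

text \<open>For Y t = \<rho> t the product t w^\<delta> Y1^2 equals \<rho> \<tau>, so apart from a
  power of w, matched by the choice of \<delta>, everything depends on \<tau> alone. The unknown of
  the ODE is M = \<phi>1^k, since \<phi>1^(k-1) (\<phi>1 + 2 \<tau> \<phi>2) = M + (2\<tau>/k) M';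
  hence the exponent \<alpha> = k/2.\<close>

lemma singular_solution_superlinear:
  fixes K :: "'n::finite set" and q \<sigma> :: real
  assumes K: "K \<noteq> {}" "- K \<noteq> {}" and q: "0 \<le> q" "q < card K + card (- K)" and \<sigma>: "1/2 < \<sigma>"
    and \<sigma>_le: "\<sigma> * (card K + card (- K) - q) \<le> card (- K)"
  shows "has_singular_solution K q (2 * \<sigma>)"
proof -
  define k m where "k = card K" and "m = card (- K)"
  have k: "k > 0" and m: "m > 0" using K by (simp_all add: k_def m_def card_gt_0_iff)
  define \<delta> where "\<delta> = (m - \<sigma> * (k + m - q)) / k"
  have \<delta>: "\<delta> \<ge> 0" using \<sigma>_le k by (simp add: \<delta>_def k_def m_def)
  have \<delta>k: "\<sigma> * (k + m) + \<delta> * k - m = \<sigma> * q" using k by (simp add: \<delta>_def field_simps)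
  define V where "V = {p :: real \<times> real \<times> real. 1/2 < fst (snd p) \<and> fst (snd p) < 2 \<and> 0 < snd (snd p)}"
  define E where "E p = \<sigma> * fst (snd p) + \<delta> * (fst p * snd (snd p) powr (1 / k))" for p :: "real \<times> real \<times> real"
  \<comment> \<open>Put r = \<phi>1 + 2 \<tau> \<phi>2, so that e1 = (\<sigma> + \<delta>/2) \<phi>1
    + (\<delta>/2) r. In the radial determinant the terms in r^2 cancel, and what is left is D r -
    (\<delta> + 2\<sigma>)^2 \<tau> \<phi>1^2. At the base point D = (2\<sigma> - 1) \<sigma>, which
    is positive because s > 1.\<close>
  define D where "D p = (2 * \<sigma> - 1) * E p - (\<delta> + 2 * \<sigma>) * \<delta> * (fst p * snd (snd p) powr (1 / k))" for p
  \<comment> \<open>The equation solved for \<phi>1^(k-1) r. Every occurrence of M carries the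
    factor t, so h is constant in M at t = 0, as the existence result demands.\<close>
  define h where "h p = (fst (snd p) powr q * E p powr (- real (m - 1))
    + (\<delta> + 2 * \<sigma>)\<^sup>2 * (fst p * snd (snd p) powr (1 / k) * snd (snd p))) * inverse (D p)" for p
  define U where "U = {p \<in> {p \<in> V. E p > 0}. D p > 0}"
  have CE: "C1_on E V" unfolding E_def by (intro C1_intros) (auto simp: V_def)
  then have CD: "C1_on D V" unfolding D_def by (intro C1_intros) (auto simp: V_def)
  have oV: "open V" unfolding V_def by (rule open_slab)
  have oU: "open U" unfolding U_def
    by (intro open_C1_pos oV CE C1_on_subset[OF CD]) auto
  have UV: "U \<subseteq> V" by (auto simp: U_def)
  have Ch: "C1_on h U" unfolding h_def
    by (intro C1_intros C1_on_subset[OF CE UV] C1_on_subset[OF CD UV]) (auto simp: U_def V_def)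
  define m0 where "m0 = \<sigma> powr (- real (m - 1)) * inverse ((2 * \<sigma> - 1) * \<sigma>)"
  have h0: "h (0, 1, M) = m0" for M by (simp add: h_def E_def D_def m0_def)
  have m0: "m0 > 0" using \<sigma> by (simp add: m0_def)
  have p0: "(0, 1, m0) \<in> U" using \<sigma> m0 by (simp add: U_def V_def E_def D_def)
  obtain \<epsilon> and \<phi> \<phi>1 \<phi>2 :: "real \<Rightarrow> real" where \<epsilon>: "\<epsilon> > 0"
    and \<phi>: "\<And>t. 0 \<le> t \<Longrightarrow> t < \<epsilon> \<Longrightarrow> (\<phi> has_real_derivative \<phi>1 t) (at t)"
      "\<And>t. 0 \<le> t \<Longrightarrow> t < \<epsilon> \<Longrightarrow> (\<phi>1 has_real_derivative \<phi>2 t) (at t)"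
      "\<And>t. 0 \<le> t \<Longrightarrow> t < \<epsilon> \<Longrightarrow> 0 < \<phi>1 t"
      "\<And>t. 0 \<le> t \<Longrightarrow> t < \<epsilon> \<Longrightarrow> (t, \<phi> t, \<phi>1 t ^ k) \<in> U"
    and ode: "\<And>t. 0 \<le> t \<Longrightarrow> t < \<epsilon> \<Longrightarrow>
      \<phi>1 t ^ k + t / (k / 2) * (k * \<phi>1 t ^ (k - 1) * \<phi>2 t) = h (t, \<phi> t, \<phi>1 t ^ k)"
    by (rule briot_bouquet_power[OF _ m0 k oU p0 _ Ch h0, of "k / 2"])
       (use k in \<open>auto simp: U_def V_def\<close>)
  \<comment> \<open>For t < 1/2 and w < 1 the argument w^\<delta> \<rho> t stays below \<rho>/2,
    inside the interval of existence.\<close>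
  define \<rho> where "\<rho> = \<epsilon>"
  have \<rho>: "\<rho> > 0" "\<rho> / 2 < \<epsilon>" using \<epsilon> by (auto simp: \<rho>_def)
  obtain A where A: "A > 0" "A ^ (k + m) * \<rho> ^ k = A powr q"
    using scaling_constant[of "\<rho> ^ k" q "k + m"] \<rho> q by (auto simp: k_def m_def)
  have main: "0 < \<phi>1 \<tau> + 2 * \<tau> * \<phi>2 \<tau> \<and>
     \<phi>1 \<tau> ^ (k - 1) * e ^ (m - 1) * ((\<phi>1 \<tau> + 2 * \<tau> * \<phi>2 \<tau>) * ((2 * \<sigma> - 1) * e + 2 * \<delta> * \<tau> * e1) - 4 * \<tau> * e1\<^sup>2) = \<phi> \<tau> powr q"
    if \<tau>: "0 \<le> \<tau>" "\<tau> < \<epsilon>" and e: "e = \<sigma> * \<phi> \<tau> + \<delta> * \<tau> * \<phi>1 \<tau>" and e1: "e1 = (\<sigma> + \<delta>) * \<phi>1 \<tau> + \<delta> * \<tau> * \<phi>2 \<tau>" for \<tau> e e1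
  proof -
    define d where "d = (2 * \<sigma> - 1) * e - (\<delta> + 2 * \<sigma>) * \<delta> * \<tau> * \<phi>1 \<tau>"
    define n where "n = \<phi>1 \<tau> ^ (k - 1)"
    have f1: "\<phi>1 \<tau> > 0" using \<phi>(3)[OF \<tau>] .
    have n: "n > 0" "\<phi>1 \<tau> ^ k = n * \<phi>1 \<tau>"
      using f1 power_minus_mult[OF k, of "\<phi>1 \<tau>"] by (simp_all add: n_def)
    have root: "(\<phi>1 \<tau> ^ k) powr (1 / k) = \<phi>1 \<tau>" using f1 k by (rule powr_inverse_power)
    have E: "E (\<tau>, \<phi> \<tau>, \<phi>1 \<tau> ^ k) = e" and D: "D (\<tau>, \<phi> \<tau>, \<phi>1 \<tau> ^ k) = d"
      by (simp_all add: E_def D_def root e d_def mult.assoc)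
    have U: "e > 0" "d > 0" "\<phi> \<tau> > 0" using \<phi>(4)[OF \<tau>] unfolding U_def V_def by (auto simp: E D)
    have epow: "e powr (- real (m - 1)) = inverse (e ^ (m - 1))" using U(1) by (simp add: powr_minus powr_realpow)
    define H where "H = n * (\<phi>1 \<tau> + 2 * \<tau> * \<phi>2 \<tau>)"
    have "H = h (\<tau>, \<phi> \<tau>, \<phi>1 \<tau> ^ k)"
      using ode[OF \<tau>] k unfolding H_def n(2) n_def by (simp add: algebra_simps)
    also have "\<dots> = (\<phi> \<tau> powr q * inverse (e ^ (m - 1)) + (\<delta> + 2 * \<sigma>)\<^sup>2 * (\<tau> * \<phi>1 \<tau> * (n * \<phi>1 \<tau>))) * inverse d"
      unfolding h_def fst_conv snd_conv root E D epow by (simp only: n(2))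
    finally have H: "H = (\<phi> \<tau> powr q * inverse (e ^ (m - 1)) + (\<delta> + 2 * \<sigma>)\<^sup>2 * (\<tau> * \<phi>1 \<tau> * (n * \<phi>1 \<tau>))) * inverse d" .
    \<comment> \<open>The mixed term has been moved to the side of the positive right-hand side, so
      the ODE itself yields the convexity condition on the radial entry.\<close>
    have "H > 0" unfolding H using U f1 n \<tau> by (intro mult_pos_pos add_pos_nonneg mult_nonneg_nonneg) auto
    then have pos: "0 < \<phi>1 \<tau> + 2 * \<tau> * \<phi>2 \<tau>" unfolding H_def using n(1) by (simp add: zero_less_mult_iff)
    have "n * ((\<phi>1 \<tau> + 2 * \<tau> * \<phi>2 \<tau>) * ((2 * \<sigma> - 1) * e + 2 * \<delta> * \<tau> * e1) - 4 * \<tau> * e1\<^sup>2)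
      = H * d - (\<delta> + 2 * \<sigma>)\<^sup>2 * (\<tau> * \<phi>1 \<tau> * (n * \<phi>1 \<tau>))"
      unfolding H_def d_def e1 by (simp add: algebra_simps power2_eq_square)
    also have "H * d = \<phi> \<tau> powr q * inverse (e ^ (m - 1)) + (\<delta> + 2 * \<sigma>)\<^sup>2 * (\<tau> * \<phi>1 \<tau> * (n * \<phi>1 \<tau>))"
    proof -
      have "inverse d * d = 1" using U by simp
      then show ?thesis unfolding H mult.assoc[of _ "inverse d" d] by simp
    qed
    finally have core: "n * ((\<phi>1 \<tau> + 2 * \<tau> * \<phi>2 \<tau>) * ((2 * \<sigma> - 1) * e + 2 * \<delta> * \<tau> * e1) - 4 * \<tau> * e1\<^sup>2)
      = \<phi> \<tau> powr q * inverse (e ^ (m - 1))" by simp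
    have "n * e ^ (m - 1) * ((\<phi>1 \<tau> + 2 * \<tau> * \<phi>2 \<tau>) * ((2 * \<sigma> - 1) * e + 2 * \<delta> * \<tau> * e1) - 4 * \<tau> * e1\<^sup>2)
      = e ^ (m - 1) * (n * ((\<phi>1 \<tau> + 2 * \<tau> * \<phi>2 \<tau>) * ((2 * \<sigma> - 1) * e + 2 * \<delta> * \<tau> * e1) - 4 * \<tau> * e1\<^sup>2))"
      by (simp only: mult_ac)
    also have "\<dots> = \<phi> \<tau> powr q" unfolding core using U(1) by simp
    finally show ?thesis using pos unfolding n_def by blast
  qed
  show ?thesis
  proof (rule separated_profile_solution[where \<delta> = \<delta> and A = A and b = "\<rho> / 2" and \<phi> = \<phi> and ?\<phi>1.0 = \<phi>1 and ?\<phi>2.0 = \<phi>2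
        and Y = "\<lambda>t. \<rho> * t" and ?Y1.0 = "\<lambda>_. \<rho>" and ?Y2.0 = "\<lambda>_. 0", OF K])
    fix t w \<tau> :: real
    assume tw: "0 \<le> t" "t < 1/2" "0 < w" "w < 1/2" and \<tau>: "0 \<le> \<tau>" "\<tau> \<le> \<rho> / 2" "\<tau> = w powr \<delta> * (\<rho> * t)"
    have \<tau>': "\<tau> < \<epsilon>" using \<tau>(2) \<rho>(2) by (rule le_less_trans)
    let ?e = "\<sigma> * \<phi> \<tau> + \<delta> * \<tau> * \<phi>1 \<tau>" and ?e1 = "(\<sigma> + \<delta>) * \<phi>1 \<tau> + \<delta> * \<tau> * \<phi>2 \<tau>"
    let ?X = "\<phi>1 \<tau> * (\<rho> + 2 * t * 0) + 2 * t * w powr \<delta> * \<phi>2 \<tau> * \<rho>\<^sup>2"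
    note main = main[OF \<tau>(1) \<tau>' refl refl]
    have X: "?X = \<rho> * (\<phi>1 \<tau> + 2 * \<tau> * \<phi>2 \<tau>)" "4 * t * w powr \<delta> * r * \<rho>\<^sup>2 = \<rho> * (4 * \<tau> * r)" for r
      by (simp_all add: \<tau>(3) algebra_simps power2_eq_square)
    show "0 < ?X" unfolding X using main \<rho> by simp
    have "A ^ (k + m) * w powr (\<sigma> * (k + m) + \<delta> * k - m)
          * (\<phi>1 \<tau> * \<rho>) ^ (k - 1) * ?e ^ (m - 1)
          * (\<rho> * (\<phi>1 \<tau> + 2 * \<tau> * \<phi>2 \<tau>) * ((2 * \<sigma> - 1) * ?e + 2 * \<delta> * \<tau> * ?e1) - \<rho> * (4 * \<tau> * ?e1\<^sup>2))
       = (A ^ (k + m) * (\<rho> * \<rho> ^ (k - 1))) * w powr (\<sigma> * q) * (\<phi>1 \<tau> ^ (k - 1) * ?e ^ (m - 1)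
          * ((\<phi>1 \<tau> + 2 * \<tau> * \<phi>2 \<tau>) * ((2 * \<sigma> - 1) * ?e + 2 * \<delta> * \<tau> * ?e1) - 4 * \<tau> * ?e1\<^sup>2))"
      unfolding \<delta>k power_mult_distrib by (simp only: right_diff_distrib mult_ac)
    also have "\<rho> * \<rho> ^ (k - 1) = \<rho> ^ k" using power_minus_mult[OF k, of \<rho>] by (simp add: mult.commute)
    also have "A ^ (k + m) * \<dots> = A powr q" by (rule A(2))
    finally have fin: "A ^ (k + m) * w powr (\<sigma> * (k + m) + \<delta> * k - m)
          * (\<phi>1 \<tau> * \<rho>) ^ (k - 1) * ?e ^ (m - 1)
          * (\<rho> * (\<phi>1 \<tau> + 2 * \<tau> * \<phi>2 \<tau>) * ((2 * \<sigma> - 1) * ?e + 2 * \<delta> * \<tau> * ?e1) - \<rho> * (4 * \<tau> * ?e1\<^sup>2))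
       = A powr q * w powr (\<sigma> * q) * \<phi> \<tau> powr q" by (simp only: conjunct2[OF main])
    then show "A ^ (card K + card (- K)) * w powr (\<sigma> * (card K + card (- K)) + \<delta> * card K - card (- K))
          * (\<phi>1 \<tau> * \<rho>) ^ (card K - 1) * ?e ^ (card (- K) - 1)
          * (?X * ((2 * \<sigma> - 1) * ?e + 2 * \<delta> * \<tau> * ?e1) - 4 * t * w powr \<delta> * ?e1\<^sup>2 * \<rho>\<^sup>2)
        = A powr q * w powr (\<sigma> * q) * \<phi> \<tau> powr q"
      unfolding X by (simp only: k_def m_def)
  next
    fix \<tau> :: real assume "0 \<le> \<tau>" "\<tau> \<le> \<rho> / 2"
    then have \<tau>: "0 \<le> \<tau>" "\<tau> < \<epsilon>" using \<rho> by auto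
    show "(\<phi> has_real_derivative \<phi>1 \<tau>) (at \<tau>)" "(\<phi>1 has_real_derivative \<phi>2 \<tau>) (at \<tau>)"
      using \<phi> \<tau> by auto
    show "1/2 \<le> \<phi> \<tau> \<and> \<phi> \<tau> \<le> 2 \<and> 0 < \<phi>1 \<tau>"
      using \<phi>(3,4)[OF \<tau>] by (auto simp: U_def V_def)
  qed (use q \<sigma> \<delta> A \<rho> in \<open>auto intro!: derivative_eq_intros\<close>)
qed

section \<open>The case s = 1\<close>

text \<open>At \<sigma> = 1/2 the summand (2\<sigma> - 1) e drops out, so e1 divides the radial
  determinant; in the cofactor the terms with \<phi>2 cancel. The determinant is then 2 w^\<delta>
  \<phi>1 e1 times a function of t alone, and the equation separates into one in t for Y and one in
  \<tau> for \<phi>.\<close>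

lemma singular_solution_linear:
  fixes K :: "'n::finite set" and q :: real
  assumes K: "K \<noteq> {}" "- K \<noteq> {}" and q: "0 \<le> q" "q < card K + card (- K)"
    and kq: "card K < card (- K) + q"
  shows "has_singular_solution K q (2 * (1/2))"
proof -
  define k m where "k = card K" and "m = card (- K)"
  have k: "k > 0" and m: "m > 0" using K by (simp_all add: k_def m_def card_gt_0_iff)
  \<comment> \<open>The radial determinant supplies an extra w^\<delta>, so the other powers of w
    must combine to q/2 - \<delta> instead of q/2. Positivity of \<delta> is the condition k < m +
    q.\<close>
  define \<delta> where "\<delta> = (q + m - k) / (2 * (k + 1))"
  have \<delta>: "\<delta> > 0" using kq by (simp add: \<delta>_def k_def m_def)
  have \<delta>k: "1/2 * (k + m) + \<delta> * k - m = 1/2 * q - \<delta>" by (simp add: \<delta>_def field_simps)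
  define V where "V = {p :: real \<times> real \<times> real. 1/2 < fst (snd p) \<and> fst (snd p) < 2 \<and> 0 < snd (snd p)}"
  have oV: "open V" unfolding V_def by (rule open_slab)
  obtain \<epsilon>1 and Z Z1 Z2 :: "real \<Rightarrow> real" where \<epsilon>1: "\<epsilon>1 > 0"
    and Z: "\<And>t. 0 \<le> t \<Longrightarrow> t < \<epsilon>1 \<Longrightarrow> (Z has_real_derivative Z1 t) (at t)"
      "\<And>t. 0 \<le> t \<Longrightarrow> t < \<epsilon>1 \<Longrightarrow> (Z1 has_real_derivative Z2 t) (at t)"
      "\<And>t. 0 \<le> t \<Longrightarrow> t < \<epsilon>1 \<Longrightarrow> 0 < Z1 t" "\<And>t. 0 \<le> t \<Longrightarrow> t < \<epsilon>1 \<Longrightarrow> 1/2 < Z t \<and> Z t < 2"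
    and odeZ: "\<And>t. 0 \<le> t \<Longrightarrow> t < \<epsilon>1 \<Longrightarrow>
      \<delta> * Z t * (Z1 t ^ (k - 1) * (Z1 t + 2 * t * Z2 t)) - (1 + 2 * \<delta>) * t * Z1 t ^ (k + 1) = \<delta>"
  proof -
    \<comment> \<open>The equation in t, solved for Z1^(k-1) (Z1 + 2 t Z2) = M + (2t/k) M' with M =
      Z1^k. The separation constant is normalized to \<delta>, which makes M = 1 at t = 0.\<close>
    define h where "h p = (1 + (1 + 2 * \<delta>) / \<delta> * (fst p * snd (snd p) powr (1 / k) * snd (snd p))) * inverse (fst (snd p))" for p :: "real \<times> real \<times> real"
    have Ch: "C1_on h V" unfolding h_def by (intro C1_intros) (auto simp: V_def)
    have h0: "h (0, 1, M) = 1" for M by (simp add: h_def)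
    have p0: "(0, 1, 1) \<in> V" by (simp add: V_def)
    obtain \<epsilon> and \<phi> \<phi>1 \<phi>2 :: "real \<Rightarrow> real" where \<epsilon>: "\<epsilon> > 0"
      and \<phi>: "\<And>t. 0 \<le> t \<Longrightarrow> t < \<epsilon> \<Longrightarrow> (\<phi> has_real_derivative \<phi>1 t) (at t)"
        "\<And>t. 0 \<le> t \<Longrightarrow> t < \<epsilon> \<Longrightarrow> (\<phi>1 has_real_derivative \<phi>2 t) (at t)"
        "\<And>t. 0 \<le> t \<Longrightarrow> t < \<epsilon> \<Longrightarrow> 0 < \<phi>1 t"
        "\<And>t. 0 \<le> t \<Longrightarrow> t < \<epsilon> \<Longrightarrow> (t, \<phi> t, \<phi>1 t ^ k) \<in> V"
      and ode: "\<And>t. 0 \<le> t \<Longrightarrow> t < \<epsilon> \<Longrightarrow>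
        \<phi>1 t ^ k + t / (k / 2) * (k * \<phi>1 t ^ (k - 1) * \<phi>2 t) = h (t, \<phi> t, \<phi>1 t ^ k)"
      by (rule briot_bouquet_power[OF _ zero_less_one k oV p0 _ Ch h0, of "k / 2"])
         (use k in \<open>auto simp: V_def\<close>)
    show thesis
    proof (rule that[OF \<epsilon> \<phi>(1-3)])
      fix t assume t: "0 \<le> t" "t < \<epsilon>"
      show V: "1/2 < \<phi> t \<and> \<phi> t < 2" using \<phi>(4)[OF t] by (simp add: V_def)
      have f1: "\<phi>1 t > 0" using \<phi>(3)[OF t] .
      have n: "\<phi>1 t ^ k = \<phi>1 t ^ (k - 1) * \<phi>1 t" using power_minus_mult[OF k, of "\<phi>1 t"] by simp
      have root: "(\<phi>1 t ^ k) powr (1 / k) = \<phi>1 t" using f1 k by (rule powr_inverse_power)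
      have "\<phi>1 t ^ (k - 1) * (\<phi>1 t + 2 * t * \<phi>2 t) = h (t, \<phi> t, \<phi>1 t ^ k)"
        using ode[OF t] k by (simp add: n algebra_simps)
      also have "\<dots> = (1 + (1 + 2 * \<delta>) / \<delta> * (t * \<phi>1 t * \<phi>1 t ^ k)) * inverse (\<phi> t)"
        by (simp only: h_def fst_conv snd_conv root)
      finally show "\<delta> * \<phi> t * (\<phi>1 t ^ (k - 1) * (\<phi>1 t + 2 * t * \<phi>2 t)) - (1 + 2 * \<delta>) * t * \<phi>1 t ^ (k + 1) = \<delta>"
        using V \<delta> by (simp add: field_simps)
    qed
  qed
  obtain \<epsilon>2 and \<phi> \<phi>1 \<phi>2 :: "real \<Rightarrow> real" where \<epsilon>2: "\<epsilon>2 > 0"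
    and \<phi>: "\<And>t. 0 \<le> t \<Longrightarrow> t < \<epsilon>2 \<Longrightarrow> (\<phi> has_real_derivative \<phi>1 t) (at t)"
      "\<And>t. 0 \<le> t \<Longrightarrow> t < \<epsilon>2 \<Longrightarrow> (\<phi>1 has_real_derivative \<phi>2 t) (at t)"
      "\<And>t. 0 \<le> t \<Longrightarrow> t < \<epsilon>2 \<Longrightarrow> 0 < \<phi>1 t" "\<And>t. 0 \<le> t \<Longrightarrow> t < \<epsilon>2 \<Longrightarrow> 1/2 < \<phi> t \<and> \<phi> t < 2"
    and ode\<phi>: "\<And>t e e1. 0 \<le> t \<Longrightarrow> t < \<epsilon>2 \<Longrightarrow> e = 1/2 * \<phi> t + \<delta> * t * \<phi>1 t \<Longrightarrow>
      e1 = (1/2 + \<delta>) * \<phi>1 t + \<delta> * t * \<phi>2 t \<Longrightarrow>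
      0 < e1 \<and> 2 * \<delta> * \<phi>1 t ^ k * e1 * e ^ (m - 1) = \<phi> t powr q"
  proof -
    define E where "E p = 1/2 * fst (snd p) + \<delta> * (fst p * snd (snd p) powr (1 / real (k + 1)))" for p :: "real \<times> real \<times> real"
    \<comment> \<open>The reciprocal of 2 \<delta> (1/2 + \<delta>), the coefficient of
      \<phi>1^(k+1) in 2 \<delta> \<phi>1^k e1.\<close>
    define \<kappa> where "\<kappa> = 1 / (\<delta> * (1 + 2 * \<delta>))"
    have \<kappa>: "\<kappa> > 0" using \<delta> by (simp add: \<kappa>_def)
    define h where "h p = \<kappa> * (fst (snd p) powr q * E p powr (- real (m - 1)))" for p
    define U where "U = {p \<in> V. E p > 0}"
    have CE: "C1_on E V" unfolding E_def by (intro C1_intros) (auto simp: V_def)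
    have oU: "open U" unfolding U_def by (intro open_C1_pos oV CE)
    have UV: "U \<subseteq> V" by (auto simp: U_def)
    have Ch: "C1_on h U" unfolding h_def
      by (intro C1_intros C1_on_subset[OF CE UV]) (auto simp: U_def V_def)
    define m0 where "m0 = \<kappa> * (1/2) powr (- real (m - 1))"
    have h0: "h (0, 1, M) = m0" for M by (simp add: h_def E_def m0_def)
    have m0: "m0 > 0" using \<kappa> by (simp add: m0_def)
    have p0: "(0, 1, m0) \<in> U" using m0 by (simp add: U_def V_def E_def)
    \<comment> \<open>Chosen so that \<phi>1^k e1 = (1/2 + \<delta>) (M + (t/\<alpha>) M') for M =
      \<phi>1^(k+1).\<close>
    define \<alpha> where "\<alpha> = (k + 1) * (1/2 + \<delta>) / \<delta>"
    have \<alpha>: "\<alpha> > 0" using \<delta> by (simp add: \<alpha>_def)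
    obtain \<epsilon> and \<phi> \<phi>1 \<phi>2 :: "real \<Rightarrow> real" where \<epsilon>: "\<epsilon> > 0"
      and \<phi>: "\<And>t. 0 \<le> t \<Longrightarrow> t < \<epsilon> \<Longrightarrow> (\<phi> has_real_derivative \<phi>1 t) (at t)"
        "\<And>t. 0 \<le> t \<Longrightarrow> t < \<epsilon> \<Longrightarrow> (\<phi>1 has_real_derivative \<phi>2 t) (at t)"
        "\<And>t. 0 \<le> t \<Longrightarrow> t < \<epsilon> \<Longrightarrow> 0 < \<phi>1 t"
        "\<And>t. 0 \<le> t \<Longrightarrow> t < \<epsilon> \<Longrightarrow> (t, \<phi> t, \<phi>1 t ^ (k + 1)) \<in> U"
      and ode: "\<And>t. 0 \<le> t \<Longrightarrow> t < \<epsilon> \<Longrightarrow>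
        \<phi>1 t ^ (k + 1) + t / \<alpha> * (real (k + 1) * \<phi>1 t ^ (k + 1 - 1) * \<phi>2 t) = h (t, \<phi> t, \<phi>1 t ^ (k + 1))"
      by (rule briot_bouquet_power[OF \<alpha> m0 _ oU p0 _ Ch h0, of "k + 1"])
         (auto simp: U_def V_def)
    show thesis
    proof (rule that[OF \<epsilon> \<phi>(1-3)])
      fix t assume t: "0 \<le> t" "t < \<epsilon>"
      show V: "1/2 < \<phi> t \<and> \<phi> t < 2" using \<phi>(4)[OF t] by (simp add: U_def V_def)
      fix e e1 assume e: "e = 1/2 * \<phi> t + \<delta> * t * \<phi>1 t" and e1: "e1 = (1/2 + \<delta>) * \<phi>1 t + \<delta> * t * \<phi>2 t"
      have f1: "\<phi>1 t > 0" using \<phi>(3)[OF t] .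
      have root: "(\<phi>1 t ^ (k + 1)) powr (1 / real (k + 1)) = \<phi>1 t" using f1 by (intro powr_inverse_power) auto
      have E: "E (t, \<phi> t, \<phi>1 t ^ (k + 1)) = e" by (simp only: E_def fst_conv snd_conv root e mult.assoc)
      have U: "e > 0" using \<phi>(4)[OF t] unfolding U_def by (auto simp only: E)
      have epow: "e powr (- real (m - 1)) = inverse (e ^ (m - 1))" using U(1) by (simp add: powr_minus powr_realpow)
      have "(1/2 + \<delta>) * (\<phi>1 t ^ (k + 1) + t / \<alpha> * (real (k + 1) * \<phi>1 t ^ (k + 1 - 1) * \<phi>2 t)) = \<phi>1 t ^ k * e1"
      proof -
        have "(1/2 + \<delta>) / \<alpha> * real (k + 1) = \<delta>" using \<delta> by (simp add: \<alpha>_def)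
        then have "(1/2 + \<delta>) * (t / \<alpha> * (real (k + 1) * \<phi>1 t ^ (k + 1 - 1) * \<phi>2 t)) = \<delta> * t * \<phi>1 t ^ k * \<phi>2 t"
        proof -
          assume "(1/2 + \<delta>) / \<alpha> * real (k + 1) = \<delta>"
          then have "\<delta> * t * \<phi>1 t ^ k * \<phi>2 t = ((1/2 + \<delta>) / \<alpha> * real (k + 1)) * t * \<phi>1 t ^ k * \<phi>2 t" by (simp only:)
          then show ?thesis by simp
        qed
        then show ?thesis by (simp add: e1 distrib_left algebra_simps)
      qed
      also have "\<phi>1 t ^ (k + 1) + t / \<alpha> * (real (k + 1) * \<phi>1 t ^ (k + 1 - 1) * \<phi>2 t) = \<kappa> * (\<phi> t powr q * inverse (e ^ (m - 1)))"
        by (simp only: ode[OF t] h_def fst_conv snd_conv E epow)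
      finally have eq: "\<phi>1 t ^ k * e1 = (1/2 + \<delta>) * (\<kappa> * (\<phi> t powr q * inverse (e ^ (m - 1))))" by simp
      have "0 < (1/2 + \<delta>) * (\<kappa> * (\<phi> t powr q * inverse (e ^ (m - 1))))" using V U \<kappa> \<delta> by simp
      then have "0 < e1" unfolding eq[symmetric] using f1 by (simp add: zero_less_mult_iff)
      moreover have "2 * \<delta> * \<phi>1 t ^ k * e1 * e ^ (m - 1) = \<phi> t powr q"
      proof -
        have "2 * \<delta> * \<phi>1 t ^ k * e1 * e ^ (m - 1) = 2 * \<delta> * (\<phi>1 t ^ k * e1) * e ^ (m - 1)" by simp
        also have "\<dots> = (\<delta> * (1 + 2 * \<delta>) * \<kappa>) * (\<phi> t powr q * (inverse (e ^ (m - 1)) * e ^ (m - 1)))"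
        unfolding eq by (simp add: algebra_simps)
        also have "\<delta> * (1 + 2 * \<delta>) * \<kappa> = 1" using \<delta> by (simp add: \<kappa>_def)
        also have "inverse (e ^ (m - 1)) * e ^ (m - 1) = 1" using U by simp
        finally show ?thesis by simp
      qed
      ultimately show "0 < e1 \<and> 2 * \<delta> * \<phi>1 t ^ k * e1 * e ^ (m - 1) = \<phi> t powr q" by simp
    qed
  qed
  \<comment> \<open>\<rho> fits t < 1/2 into the domain of Z. As Z < 2, the amplitude \<mu> keeps Y
    below 2\<mu> < \<epsilon>2, inside the domain of \<phi>.\<close>
  define \<rho> \<mu> where "\<rho> = \<epsilon>1" and "\<mu> = \<epsilon>2 / 4"
  have \<rho>: "\<rho> > 0" "\<And>t. 0 \<le> t \<Longrightarrow> t < 1/2 \<Longrightarrow> 0 \<le> \<rho> * t \<and> \<rho> * t < \<epsilon>1"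
    using \<epsilon>1 by (auto simp: \<rho>_def)
  have \<mu>: "\<mu> > 0" "2 * \<mu> < \<epsilon>2" using \<epsilon>2 by (auto simp: \<mu>_def)
  obtain A where A: "A > 0" "A ^ (k + m) * (\<mu> ^ (k + 1) * \<rho> ^ k) = A powr q"
    using scaling_constant[of "\<mu> ^ (k + 1) * \<rho> ^ k" q "k + m"] \<rho> \<mu> q by (auto simp: k_def m_def)
  define Y Y1 Y2 where "Y t = \<mu> * Z (\<rho> * t)" "Y1 t = \<mu> * \<rho> * Z1 (\<rho> * t)" "Y2 t = \<mu> * \<rho>\<^sup>2 * Z2 (\<rho> * t)" for t
  note Ydefs = this
  \<comment> \<open>The expression is homogeneous of degree k + 1 in Y, and the dilation of t by
    \<rho> multiplies it by \<rho>^k; A is chosen to absorb both factors.\<close>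
  have Yeq: "Y1 t ^ (k - 1) * (\<delta> * Y t * (Y1 t + 2 * t * Y2 t) - (1 + 2 * \<delta>) * t * (Y1 t)\<^sup>2) = \<mu> ^ (k + 1) * \<rho> ^ k * \<delta>"
    if t: "0 \<le> t" "t < 1/2" for t
  proof -
    obtain j where j: "k = Suc j" using k gr0_implies_Suc by auto
    have "Y1 t ^ (k - 1) * (\<delta> * Y t * (Y1 t + 2 * t * Y2 t) - (1 + 2 * \<delta>) * t * (Y1 t)\<^sup>2) =
      \<mu> ^ (k + 1) * \<rho> ^ k * (\<delta> * Z (\<rho> * t) * (Z1 (\<rho> * t) ^ (k - 1) * (Z1 (\<rho> * t) + 2 * (\<rho> * t) * Z2 (\<rho> * t))) - (1 + 2 * \<delta>) * (\<rho> * t) * Z1 (\<rho> * t) ^ (k + 1))"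
      by (simp add: Ydefs j power_mult_distrib power2_eq_square algebra_simps)
    then show ?thesis using odeZ[of "\<rho> * t"] \<rho>(2)[OF t] by simp
  qed
  show ?thesis
  proof (rule separated_profile_solution[where \<delta> = \<delta> and A = A and b = "2 * \<mu>" and \<phi> = \<phi> and ?\<phi>1.0 = \<phi>1 and ?\<phi>2.0 = \<phi>2
        and Y = Y and ?Y1.0 = Y1 and ?Y2.0 = Y2, OF K])
    fix t assume t: "0 \<le> t" "t < (1/2 :: real)"
    note lt = \<rho>(2)[OF t]
    show "(Y has_real_derivative Y1 t) (at t)" unfolding Ydefs
      using lt by (auto intro!: derivative_eq_intros DERIV_chain2[OF Z(1)])
    show "(Y1 has_real_derivative Y2 t) (at t)" unfolding Ydefs
      using lt by (auto intro!: derivative_eq_intros DERIV_chain2[OF Z(2)] simp: power2_eq_square)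
    have "0 < Z (\<rho> * t)" "Z (\<rho> * t) \<le> 2" "0 < Z1 (\<rho> * t)" using Z(3,4)[of "\<rho> * t"] lt by auto
    then show "0 \<le> Y t \<and> Y t \<le> 2 * \<mu> \<and> 0 < Y1 t" using \<rho>(1) \<mu>(1) by (simp add: Ydefs)
  next
    fix \<tau> :: real assume "0 \<le> \<tau>" "\<tau> \<le> 2 * \<mu>"
    then have \<tau>: "0 \<le> \<tau>" "\<tau> < \<epsilon>2" using \<mu> by auto
    show "(\<phi> has_real_derivative \<phi>1 \<tau>) (at \<tau>)" "(\<phi>1 has_real_derivative \<phi>2 \<tau>) (at \<tau>)"
      using \<phi> \<tau> by auto
    show "1/2 \<le> \<phi> \<tau> \<and> \<phi> \<tau> \<le> 2 \<and> 0 < \<phi>1 \<tau>" using \<phi>(3,4)[OF \<tau>] by auto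
  next
    fix t w \<tau> :: real
    assume tw: "0 \<le> t" "t < 1/2" "0 < w" "w < 1/2" and \<tau>: "0 \<le> \<tau>" "\<tau> \<le> 2 * \<mu>" "\<tau> = w powr \<delta> * Y t"
    have \<tau>': "\<tau> < \<epsilon>2" using \<tau>(2) \<mu>(2) by (rule le_less_trans)
    let ?e = "1/2 * \<phi> \<tau> + \<delta> * \<tau> * \<phi>1 \<tau>" and ?e1 = "(1/2 + \<delta>) * \<phi>1 \<tau> + \<delta> * \<tau> * \<phi>2 \<tau>"
    let ?X = "\<phi>1 \<tau> * (Y1 t + 2 * t * Y2 t) + 2 * t * w powr \<delta> * \<phi>2 \<tau> * (Y1 t)\<^sup>2"
    let ?B = "\<delta> * Y t * (Y1 t + 2 * t * Y2 t) - (1 + 2 * \<delta>) * t * (Y1 t)\<^sup>2"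
    define d where "d = w powr \<delta>"
    have d: "d > 0" using tw by (simp add: d_def)
    note ode = ode\<phi>[OF \<tau>(1) \<tau>' refl refl]
    have f1: "\<phi>1 \<tau> > 0" using \<phi>(3)[OF \<tau>(1) \<tau>'] .
    have Y: "Y t > 0" "Y1 t > 0"
      using Z(3,4)[of "\<rho> * t"] \<rho>(1) \<rho>(2)[OF tw(1,2)] \<mu>(1) by (auto simp: Ydefs)
    have "0 < Y1 t ^ (k - 1) * ?B" unfolding Yeq[OF tw(1,2)] using \<mu> \<rho> \<delta> by simp
    then have B: "0 < ?B" using Y(2) by (simp add: zero_less_mult_iff)
    have id: "?X * ((2 * (1/2) - 1) * ?e + 2 * \<delta> * \<tau> * ?e1) - 4 * t * d * ?e1\<^sup>2 * (Y1 t)\<^sup>2 = 2 * d * \<phi>1 \<tau> * ?e1 * ?B"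
      unfolding \<tau>(3) d_def[symmetric] by (simp add: algebra_simps power2_eq_square)
    \<comment> \<open>The factored determinant and the square moved to its side are nonnegative, the
      former positive, so 2 \<delta> \<tau> e1 X > 0. Here \<tau> > 0 even at t = 0, because Y
      starts at a positive value.\<close>
    show "0 < ?X"
    proof -
      have "0 < 2 * d * \<phi>1 \<tau> * ?e1 * ?B + 4 * t * d * ?e1\<^sup>2 * (Y1 t)\<^sup>2"
      proof (rule add_pos_nonneg)
        show "0 < 2 * d * \<phi>1 \<tau> * ?e1 * ?B" using conjunct1[OF ode] d f1 B by (intro mult_pos_pos) simp_all
        show "0 \<le> 4 * t * d * ?e1\<^sup>2 * (Y1 t)\<^sup>2" using d tw by simp
      qed
      also have "\<dots> = (2 * \<delta> * \<tau> * ?e1) * ?X" unfolding id[symmetric] by simp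
      finally show ?thesis by (rule zero_less_mult_pos) (use \<delta> \<tau>(3) d_def d Y ode in simp)
    qed
    have "A ^ (k + m) * w powr (1/2 * (k + m) + \<delta> * k - m)
          * (\<phi>1 \<tau> * Y1 t) ^ (k - 1) * ?e ^ (m - 1) * (2 * d * \<phi>1 \<tau> * ?e1 * ?B)
       = A ^ (k + m) * w powr (1/2 * q) * (2 * (\<phi>1 \<tau> ^ (k - 1) * \<phi>1 \<tau>) * ?e1 * ?e ^ (m - 1)) * (Y1 t ^ (k - 1) * ?B)"
      unfolding \<delta>k using d by (simp add: powr_diff d_def[symmetric] power_mult_distrib mult_ac)
    also have "\<phi>1 \<tau> ^ (k - 1) * \<phi>1 \<tau> = \<phi>1 \<tau> ^ k" by (rule power_minus_mult[OF k])
    also have "A ^ (k + m) * w powr (1/2 * q) * (2 * \<phi>1 \<tau> ^ k * ?e1 * ?e ^ (m - 1)) * (Y1 t ^ (k - 1) * ?B)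
       = (A ^ (k + m) * (\<mu> ^ (k + 1) * \<rho> ^ k)) * w powr (1/2 * q) * (2 * \<delta> * \<phi>1 \<tau> ^ k * ?e1 * ?e ^ (m - 1))"
      unfolding Yeq[OF tw(1,2)] by (simp only: mult_ac)
    also have "\<dots> = A powr q * w powr (1/2 * q) * \<phi> \<tau> powr q"
      by (simp only: A(2) conjunct2[OF ode])
    finally show "A ^ (card K + card (- K)) * w powr (1/2 * (card K + card (- K)) + \<delta> * card K - card (- K))
          * (\<phi>1 \<tau> * Y1 t) ^ (card K - 1) * ?e ^ (card (- K) - 1)
          * (?X * ((2 * (1/2) - 1) * ?e + 2 * \<delta> * \<tau> * ?e1) - 4 * t * w powr \<delta> * ?e1\<^sup>2 * (Y1 t)\<^sup>2)
        = A powr q * w powr (1/2 * q) * \<phi> \<tau> powr q"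
      unfolding id[unfolded d_def] by (simp only: k_def m_def d_def)
  qed (use q \<delta> A in auto)
qed

theorem theorem1p2:
  fixes q s :: real and k :: nat and K :: "'n::finite set"
  assumes "0 \<le> q" and "q < real CARD('n)"
    and "real CARD('n) + q > 2"
    and "k \<ge> 1" and "real k < (real CARD('n) + q) / 2"
    and "1 \<le> s" and "s \<le> (2 * real CARD('n) - 2 * real k) / (real CARD('n) - q)"
    and "card K = k"
  shows "\<exists>v :: real ^ 'n \<Rightarrow> real.
    (\<forall>x\<in>ball 0 1. 0 \<le> v x) \<and>
    convex_on (ball 0 1) v \<and>
    aleksandrov_solution (ball 0 1) v
      (\<lambda>x. ennreal (v x powr q) * indicator {x. v x > 0} x) \<and>
    {x \<in> ball 0 1. v x = 0} = coord_subspace K \<inter> ball 0 1 \<and>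
    (\<exists>c C :: real. 0 < c \<and> 0 < C \<and>
      (\<forall>x\<in>ball 0 1.
         c * infdist x (coord_subspace K) powr s \<le> v x \<and>
         v x \<le> C * infdist x (coord_subspace K) powr s))"
proof -
  have "card K + card (- K) = card (K \<union> - K)" by (rule card_Un_disjoint[symmetric]) auto
  then have n: "CARD('n) = card K + card (- K)" by (simp add: Compl_partition)
  have "K \<noteq> {}" using assms by auto
  have "real k < real CARD('n)" using assms(2,5) by simp
  then have "card (- K) \<noteq> 0" using n assms(8) by auto
  then have "- K \<noteq> {}" by auto
  note K = \<open>K \<noteq> {}\<close> \<open>- K \<noteq> {}\<close>
  have "has_singular_solution K q s"
  proof (cases "s = 1")
    case True
    \<comment> \<open>With n = k + m this is k < (n + q)/2; it makes \<delta> positive.\<close>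
    have "real (card K) < real (card (- K)) + q" using assms(5,8) n by (simp add: field_simps)
    from singular_solution_linear[OF K assms(1) _ this] show ?thesis using assms(2) n True by simp
  next
    case False
    \<comment> \<open>The upper bound on s, in the form \<sigma> (n - q) <= m that makes \<delta>
      nonnegative.\<close>
    have "s / 2 * (real (card K + card (- K)) - q) \<le> real (card (- K))"
      using assms(2,7,8) n by (simp add: field_simps)
    from singular_solution_superlinear[OF K assms(1) _ _ this] show ?thesis using assms(2,6) n False by simp
  qed
  then show ?thesis unfolding has_singular_solution_def .
qed

end
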